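(* The functional $J:L^\infty_+(\Omega)^2\to\mathbb{R}$, $$J(\sigma,q)=\sum_{k=1}^K\int_\Omega\Bigl(\sigma|\nabla(u^{(g_k)}-u^{(f_k)})|^2+q|u^{(g_k)}-u^{(f_k)}|^2\Bigr)dx+\frac{\rho}{2}\int_\Omega(\sigma^2+q^2)\,dx,$$ is Fréchet differentiable, and its Fréchet derivative at $(\sigma,q)\in L^\infty_+(\Omega)^2$ in the direction $(\tilde\sigma,\tilde q)\in L^\infty_+(\Omega)^2$ is given by $$J'(\sigma,q)(\tilde\sigma,\tilde q)=\sum_{k=1}^K\int_\Omega\Bigl(\tilde\sigma\bigl(|\nabla u^{(f_k)}|^2-|\nabla u^{(g_k)}|^2\bigr)+\tilde q\bigl((u^{(f_k)})^2-(u^{(g_k)})^2\bigr)\Bigr)dx+\rho\int_\Omega(\sigma\tilde\sigma+q\tilde q)\,dx.$$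
   Context: Let $\Omega\subset\mathbb{R}^d$ ($d\ge2$) be a bounded domain with smooth boundary; functions are real-valued. $L^\infty_+(\Omega)$ denotes the set of functions in $L^\infty(\Omega)$ with positive essential infimum. For $\sigma,q\in L^\infty_+(\Omega)$ the Neumann-to-Dirichlet operator is $\Lambda(\sigma,q):L^2(\partial\Omega)\to L^2(\partial\Omega)$, $g\mapsto u|_{\partial\Omega}$, where $u\in H^1(\Omega)$ is the weak solution of $-\nabla\cdot(\sigma\nabla u)+qu=0$ in $\Omega$, $\sigma\partial_\nu u=g$ on $\partial\Omega$. Let $K\in\mathbb{N}$, let $g_1,\dots,g_K\in L^2(\partial\Omega)$ be given input fluxes and $f_k\in L^2(\partial\Omega)$ the corresponding measurements, $f_k=\Lambda(\sigma^\dagger,q^\dagger)g_k$ for some fixed (unknown) $\sigma^\dagger,q^\dagger\in L^\infty_+(\Omega)$; the $f_k$ do not depend on $(\sigma,q)$. $\rho\ge0$ is a fixed regularization parameter. For $(\sigma,q)\in L^\infty_+(\Omega)^2$, the functions $u^{(g_k)},u^{(f_k)}\in H^1(\Omega)$ (depending on $(\sigma,q)$) are the weak solutions of $$-\nabla\cdot(\sigma\nabla u^{(g_k)})+qu^{(g_k)}=0\ \text{in }\Omega,\quad\sigma\partial_\nu u^{(g_k)}=g_k\ \text{on }\partial\Omega,$$ $$-\nabla\cdot(\sigma\nabla u^{(f_k)})+qu^{(f_k)}=0\ \text{in }\Omega,\quad u^{(f_k)}=f_k\ \text{on }\partial\Omega.$$ *)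

theory Defs
  imports "HOL-Analysis.Analysis" "HOL-Probability.Essential_Supremum"
begin

section \<open>Smooth functions and smoothly bounded domains\<close>

definition partial :: "('a::euclidean_space \<Rightarrow> real) \<Rightarrow> 'a \<Rightarrow> 'a \<Rightarrow> real"
  where "partial \<phi> i x = frechet_derivative \<phi> (at x) i"

primrec Ck :: "nat \<Rightarrow> ('a::euclidean_space \<Rightarrow> real) \<Rightarrow> bool"
  where
    "Ck 0 \<phi> \<longleftrightarrow> continuous_on UNIV \<phi>"
  | "Ck (Suc n) \<phi> \<longleftrightarrow> (\<forall>x. \<phi> differentiable (at x)) \<and> (\<forall>i\<in>Basis. Ck n (partial \<phi> i))"

definition smooth :: "('a::euclidean_space \<Rightarrow> real) \<Rightarrow> bool"
  where "smooth \<phi> \<longleftrightarrow> (\<forall>n. Ck n \<phi>)"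

text \<open>After relabelling and reorienting the coordinate axes, the set is locally the epigraph of a
  smooth function of the remaining coordinates. The distinguished oriented axis is \<open>b\<close>; a function
  of the remaining coordinates is a function on the whole space that is constant along \<open>b\<close>.\<close>

definition smooth_boundary :: "'a::euclidean_space set \<Rightarrow> bool"
  where "smooth_boundary \<Omega> \<longleftrightarrow>
    (\<forall>x0\<in>frontier \<Omega>. \<exists>r>0. \<exists>b\<in>Basis \<union> uminus ` Basis. \<exists>\<gamma>. smooth \<gamma> \<and>
       (\<forall>x t. \<gamma> (x + t *\<^sub>R b) = \<gamma> x) \<and>
       \<Omega> \<inter> ball x0 r = {x \<in> ball x0 r. \<gamma> x < x \<bullet> b})"

definition smooth_bounded_domain :: "'a::euclidean_space set \<Rightarrow> bool"
  where "smooth_bounded_domain \<Omega> \<longleftrightarrow>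
    open \<Omega> \<and> connected \<Omega> \<and> \<Omega> \<noteq> {} \<and> bounded \<Omega> \<and> smooth_boundary \<Omega>"

section \<open>Surface measure\<close>

text \<open>The \<open>m\<close>-dimensional Hausdorff measure, normalised so that it agrees with \<open>m\<close>-dimensional
  Lebesgue measure on \<open>m\<close>-planes. Coverings are padded with empty sets, which contribute nothing
  as long as \<open>m > 0\<close>; only this case is used.\<close>

definition hausdorff_content :: "nat \<Rightarrow> real \<Rightarrow> 'a::metric_space set \<Rightarrow> ennreal"
  where "hausdorff_content m \<delta> A =
    (INF U \<in> {U :: nat \<Rightarrow> 'a set. A \<subseteq> (\<Union>i. U i) \<and> (\<forall>i. bounded (U i) \<and> diameter (U i) \<le> \<delta>)}.
       (\<Sum>i. ennreal (unit_ball_vol (real m) * (diameter (U i) / 2) ^ m)))"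

definition hausdorff_outer :: "nat \<Rightarrow> 'a::metric_space set \<Rightarrow> ennreal"
  where "hausdorff_outer m A = (SUP \<delta>\<in>{0<..}. hausdorff_content m \<delta> A)"

definition hausdorff_measure :: "nat \<Rightarrow> 'a::metric_space measure"
  where "hausdorff_measure m = measure_of UNIV (sets borel) (hausdorff_outer m)"

definition surface_measure :: "'a::euclidean_space set \<Rightarrow> 'a measure"
  where "surface_measure \<Omega> = restrict_space (hausdorff_measure (DIM('a) - 1)) (frontier \<Omega>)"

section \<open>Function spaces\<close>

text \<open>Elements of all function spaces are functions rather than classes modulo null sets.\<close>

definition L2 :: "'a measure \<Rightarrow> ('a \<Rightarrow> 'b::euclidean_space) set"
  where "L2 M = {f \<in> borel_measurable M. integrable M (\<lambda>x. (norm (f x))\<^sup>2)}"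

definition Linf :: "'a measure \<Rightarrow> ('a \<Rightarrow> real) set"
  where "Linf M = {f \<in> borel_measurable M. esssup M (\<lambda>x. ereal \<bar>f x\<bar>) < \<infinity>}"

definition Linf_norm :: "'a measure \<Rightarrow> ('a \<Rightarrow> real) \<Rightarrow> real"
  where "Linf_norm M f = real_of_ereal (esssup M (\<lambda>x. ereal \<bar>f x\<bar>))"

definition essinf :: "'a measure \<Rightarrow> ('a \<Rightarrow> real) \<Rightarrow> ereal"
  where "essinf M f = - esssup M (\<lambda>x. ereal (- f x))"

definition Linf_pos :: "'a measure \<Rightarrow> ('a \<Rightarrow> real) set"
  where "Linf_pos M = {f \<in> Linf M. 0 < essinf M f}"

definition test_functions :: "'a::euclidean_space set \<Rightarrow> ('a \<Rightarrow> real) set"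
  where "test_functions \<Omega> =
    {\<phi>. smooth \<phi> \<and> compact (closure {x. \<phi> x \<noteq> 0}) \<and> closure {x. \<phi> x \<noteq> 0} \<subseteq> \<Omega>}"

definition weak_gradient :: "'a::euclidean_space set \<Rightarrow> ('a \<Rightarrow> real) \<Rightarrow> ('a \<Rightarrow> 'a) \<Rightarrow> bool"
  where "weak_gradient \<Omega> u G \<longleftrightarrow>
    (\<forall>\<phi>\<in>test_functions \<Omega>. \<forall>i\<in>Basis.
       (LINT x|lebesgue_on \<Omega>. u x * partial \<phi> i x) = - (LINT x|lebesgue_on \<Omega>. (G x \<bullet> i) * \<phi> x))"

definition H1 :: "'a::euclidean_space set \<Rightarrow> ('a \<Rightarrow> real) set"
  where "H1 \<Omega> = {u \<in> L2 (lebesgue_on \<Omega>). \<exists>G\<in>L2 (lebesgue_on \<Omega>). weak_gradient \<Omega> u G}"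

text \<open>The gradient of an \<open>H1\<close> function, which is determined up to a null set.\<close>

definition grad :: "'a::euclidean_space set \<Rightarrow> ('a \<Rightarrow> real) \<Rightarrow> 'a \<Rightarrow> 'a"
  where "grad \<Omega> u = (SOME G. G \<in> L2 (lebesgue_on \<Omega>) \<and> weak_gradient \<Omega> u G)"

definition H1_norm :: "'a::euclidean_space set \<Rightarrow> ('a \<Rightarrow> real) \<Rightarrow> real"
  where "H1_norm \<Omega> u = sqrt (LINT x|lebesgue_on \<Omega>. (u x)\<^sup>2 + (norm (grad \<Omega> u x))\<^sup>2)"

text \<open>The trace operator is the continuous extension to \<open>H1\<close> of the restriction of functions that
  are smooth up to the boundary; \<open>has_trace\<close> describes its graph.\<close>

definition has_trace :: "'a::euclidean_space set \<Rightarrow> ('a \<Rightarrow> real) \<Rightarrow> ('a \<Rightarrow> real) \<Rightarrow> bool"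
  where "has_trace \<Omega> u h \<longleftrightarrow> u \<in> H1 \<Omega> \<and> h \<in> L2 (surface_measure \<Omega>) \<and>
    (\<exists>\<phi>. (\<forall>n::nat. smooth (\<phi> n)) \<and>
       (\<lambda>n. H1_norm \<Omega> (\<lambda>x. \<phi> n x - u x)) \<longlonglongrightarrow> 0 \<and>
       (\<lambda>n. LINT x|surface_measure \<Omega>. (\<phi> n x - h x)\<^sup>2) \<longlonglongrightarrow> 0)"

definition boundary_trace :: "'a::euclidean_space set \<Rightarrow> ('a \<Rightarrow> real) \<Rightarrow> 'a \<Rightarrow> real"
  where "boundary_trace \<Omega> u = (SOME h. has_trace \<Omega> u h)"

section \<open>The boundary value problems\<close>

definition energy_form ::
    "'a::euclidean_space set \<Rightarrow> ('a \<Rightarrow> real) \<Rightarrow> ('a \<Rightarrow> real) \<Rightarrow> ('a \<Rightarrow> real) \<Rightarrow> ('a \<Rightarrow> real) \<Rightarrow> real"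
  where "energy_form \<Omega> \<sigma> q u v =
    (LINT x|lebesgue_on \<Omega>. \<sigma> x * (grad \<Omega> u x \<bullet> grad \<Omega> v x) + q x * u x * v x)"

definition neumann_weak_solution ::
    "'a::euclidean_space set \<Rightarrow> ('a \<Rightarrow> real) \<Rightarrow> ('a \<Rightarrow> real) \<Rightarrow> ('a \<Rightarrow> real) \<Rightarrow> ('a \<Rightarrow> real) \<Rightarrow> bool"
  where "neumann_weak_solution \<Omega> \<sigma> q g u \<longleftrightarrow> u \<in> H1 \<Omega> \<and>
    (\<forall>v\<in>H1 \<Omega>. energy_form \<Omega> \<sigma> q u v = (LINT x|surface_measure \<Omega>. g x * boundary_trace \<Omega> v x))"

definition dirichlet_weak_solution ::
    "'a::euclidean_space set \<Rightarrow> ('a \<Rightarrow> real) \<Rightarrow> ('a \<Rightarrow> real) \<Rightarrow> ('a \<Rightarrow> real) \<Rightarrow> ('a \<Rightarrow> real) \<Rightarrow> bool"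
  where "dirichlet_weak_solution \<Omega> \<sigma> q f u \<longleftrightarrow> u \<in> H1 \<Omega> \<and>
    (AE x in surface_measure \<Omega>. boundary_trace \<Omega> u x = f x) \<and>
    (\<forall>v\<in>H1 \<Omega>. (AE x in surface_measure \<Omega>. boundary_trace \<Omega> v x = 0) \<longrightarrow> energy_form \<Omega> \<sigma> q u v = 0)"

definition neumann_solution ::
    "'a::euclidean_space set \<Rightarrow> ('a \<Rightarrow> real) \<Rightarrow> ('a \<Rightarrow> real) \<Rightarrow> ('a \<Rightarrow> real) \<Rightarrow> 'a \<Rightarrow> real"
  where "neumann_solution \<Omega> \<sigma> q g = (SOME u. neumann_weak_solution \<Omega> \<sigma> q g u)"

definition dirichlet_solution ::
    "'a::euclidean_space set \<Rightarrow> ('a \<Rightarrow> real) \<Rightarrow> ('a \<Rightarrow> real) \<Rightarrow> ('a \<Rightarrow> real) \<Rightarrow> 'a \<Rightarrow> real"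
  where "dirichlet_solution \<Omega> \<sigma> q f = (SOME u. dirichlet_weak_solution \<Omega> \<sigma> q f u)"

definition neumann_to_dirichlet ::
    "'a::euclidean_space set \<Rightarrow> ('a \<Rightarrow> real) \<Rightarrow> ('a \<Rightarrow> real) \<Rightarrow> ('a \<Rightarrow> real) \<Rightarrow> 'a \<Rightarrow> real"
  where "neumann_to_dirichlet \<Omega> \<sigma> q g = boundary_trace \<Omega> (neumann_solution \<Omega> \<sigma> q g)"

section \<open>The functional and its Frechet derivative\<close>

definition kohn_vogelius ::
    "'a::euclidean_space set \<Rightarrow> nat \<Rightarrow> (nat \<Rightarrow> 'a \<Rightarrow> real) \<Rightarrow> (nat \<Rightarrow> 'a \<Rightarrow> real) \<Rightarrow> real \<Rightarrow>
     ('a \<Rightarrow> real) \<times> ('a \<Rightarrow> real) \<Rightarrow> real"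
  where "kohn_vogelius \<Omega> K g f \<rho> = (\<lambda>(\<sigma>, q).
    (\<Sum>k=1..K. let w = (\<lambda>x. neumann_solution \<Omega> \<sigma> q (g k) x - dirichlet_solution \<Omega> \<sigma> q (f k) x)
       in LINT x|lebesgue_on \<Omega>. \<sigma> x * (norm (grad \<Omega> w x))\<^sup>2 + q x * (w x)\<^sup>2)
    + \<rho> / 2 * (LINT x|lebesgue_on \<Omega>. (\<sigma> x)\<^sup>2 + (q x)\<^sup>2))"

definition Linf2_norm :: "'a measure \<Rightarrow> ('a \<Rightarrow> real) \<times> ('a \<Rightarrow> real) \<Rightarrow> real"
  where "Linf2_norm M = (\<lambda>(s, r). max (Linf_norm M s) (Linf_norm M r))"

definition bounded_linear_Linf2 ::
    "'a measure \<Rightarrow> (('a \<Rightarrow> real) \<times> ('a \<Rightarrow> real) \<Rightarrow> real) \<Rightarrow> bool"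
  where "bounded_linear_Linf2 M D \<longleftrightarrow>
    (\<forall>s\<in>Linf M. \<forall>r\<in>Linf M. \<forall>s'\<in>Linf M. \<forall>r'\<in>Linf M.
       D (\<lambda>x. s x + s' x, \<lambda>x. r x + r' x) = D (s, r) + D (s', r')) \<and>
    (\<forall>c. \<forall>s\<in>Linf M. \<forall>r\<in>Linf M. D (\<lambda>x. c * s x, \<lambda>x. c * r x) = c * D (s, r)) \<and>
    (\<exists>C. \<forall>s\<in>Linf M. \<forall>r\<in>Linf M. \<bar>D (s, r)\<bar> \<le> C * Linf2_norm M (s, r))"

text \<open>Frechet derivative of a functional defined on the open subset \<open>Linf_pos M \<times> Linf_pos M\<close> of
  the space \<open>Linf M \<times> Linf M\<close>. The space depends on \<open>M\<close> and is not a type, so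
  \<open>has_derivative\<close> does not apply.\<close>

definition has_frechet_derivative_Linf2 ::
    "'a measure \<Rightarrow> (('a \<Rightarrow> real) \<times> ('a \<Rightarrow> real) \<Rightarrow> real) \<Rightarrow>
     (('a \<Rightarrow> real) \<times> ('a \<Rightarrow> real) \<Rightarrow> real) \<Rightarrow> ('a \<Rightarrow> real) \<times> ('a \<Rightarrow> real) \<Rightarrow> bool"
  where "has_frechet_derivative_Linf2 M F D = (\<lambda>(\<sigma>, q).
    bounded_linear_Linf2 M D \<and>
    (\<forall>\<epsilon>>0. \<exists>\<delta>>0. \<forall>s\<in>Linf M. \<forall>r\<in>Linf M. Linf2_norm M (s, r) < \<delta> \<longrightarrow>
       (\<lambda>x. \<sigma> x + s x) \<in> Linf_pos M \<and> (\<lambda>x. q x + r x) \<in> Linf_pos M \<and>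
       \<bar>F (\<lambda>x. \<sigma> x + s x, \<lambda>x. q x + r x) - F (\<sigma>, q) - D (s, r)\<bar> \<le> \<epsilon> * Linf2_norm M (s, r)))"

end

theory Submission
  imports Defs "HOL-Computational_Algebra.Polynomial"
begin

text \<open>
  Let \<open>a\<close> be the energy form of \<open>(\<sigma>, q)\<close>, let \<open>l v\<close> be the integral of \<open>g v\<close> over the boundary, and let
  \<open>u\<close> and \<open>v\<close> be the Neumann and the Dirichlet state for one pair \<open>(g, f)\<close>. The Neumann problem for
  \<open>u\<close>, tested with \<open>u\<close> and with \<open>v\<close>, turns the misfit into
  \<open>a(u - v, u - v) = l u - 2 \<integral> g f + a(v, v)\<close> (\<open>misfit_energy\<close>). The mixed term is free of the
  coefficients, so only the two energies have to be differentiated. Perturb \<open>a\<close> to \<open>a' = a + b\<close>, with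
  states \<open>u'\<close> and \<open>v'\<close>. By symmetry \<open>l u' - l u = a(u, u') - a'(u', u) = - b(u', u)\<close>. Since \<open>v' - v\<close>
  has zero trace, likewise \<open>a'(v', v') - a(v, v) = b(v', v)\<close>. Replacing \<open>u'\<close> by \<open>u\<close> and \<open>v'\<close> by
  \<open>v\<close> costs \<open>b(u' - u, u)\<close> and \<open>b(v' - v, v)\<close>. By coercivity the differences of the states are of
  first order in the perturbation, so these costs are of second order (\<open>second_order_remainder\<close>,
  \<open>neumann_energy_variation\<close>, \<open>dirichlet_energy_variation\<close>). What remains, \<open>b(v, v) - b(u, u)\<close>, is
  the claimed derivative.

  The states come from the Riesz representation theorem, on \<open>H1\<close> and on its subspace of functions with
  zero trace (\<open>weak_solution_exists\<close>). This rests on the following facts about \<open>H1\<close>.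

  \<^item> The weak gradient is unique almost everywhere, hence linear: a mollified function is a pairing with
    test functions and approximates the function in \<open>L2\<close> (\<open>fundamental_lemma_of_variations\<close>).
    With the completeness of \<open>L2\<close> this makes \<open>H1\<close> complete.

  \<^item> Globally smooth functions are dense in \<open>H1\<close> (\<open>smooth_dense_H1\<close>). Near a boundary point the
    mollifier is supported in a cone that points into the domain, so that mollification commutes with
    the weak gradient up to the boundary.

  \<^item> The trace inequality (\<open>smooth_trace_inequality\<close>) bounds the boundary values of a smooth function
    in \<open>L2\<close> by its \<open>H1\<close> norm. Over a graph, the Hausdorff measure is at most a constant times the
    volume of the cylinder above (\<open>surface_measure_le\<close>), and the values on the graph are controlled
    by those in the cylinder through the fundamental theorem of calculus along vertical lines.

  Density and the trace inequality together make the trace a bounded linear operator on all of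
  \<open>H1\<close>, well defined up to null sets.
\<close>

section \<open>Smooth functions\<close>

lemma partial_eq: "(\<phi> has_derivative \<phi>') (at x) \<Longrightarrow> partial \<phi> i x = \<phi>' i"
  by (simp add: partial_def frechet_derivative_at[symmetric])

lemma Ck_continuous: "Ck n \<phi> \<Longrightarrow> continuous_on UNIV \<phi>"
  by (cases n) (auto simp: continuous_on_eq_continuous_at differentiable_imp_continuous_within)

lemma Ck_SucD: "Ck (Suc n) \<phi> \<Longrightarrow> Ck n \<phi>"
  by (induction n arbitrary: \<phi>)
    (auto simp: continuous_on_eq_continuous_at differentiable_imp_continuous_within)

lemma Ck_differentiable: "Ck (Suc n) \<phi> \<Longrightarrow> (\<phi> has_derivative frechet_derivative \<phi> (at x)) (at x)"
  by (simp add: frechet_derivative_works)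

lemma Ck_SucI:
  assumes "\<And>x. (\<phi> has_derivative \<phi>' x) (at x)" and "\<And>i. i \<in> Basis \<Longrightarrow> Ck n (\<lambda>x. \<phi>' x i)"
  shows "Ck (Suc n) \<phi>"
proof -
  have "partial \<phi> i = (\<lambda>x. \<phi>' x i)" for i
    using partial_eq[OF assms(1)] by auto
  then show ?thesis
    using assms by (auto simp: differentiable_def)
qed

lemma Ck_const: "Ck n (\<lambda>x. c)"
proof (induction n arbitrary: c)
  case (Suc n)
  show ?case by (rule Ck_SucI[where \<phi>'="\<lambda>_ _. 0"]) (simp_all add: Suc)
qed simp

lemma Ck_add: "Ck n f \<Longrightarrow> Ck n g \<Longrightarrow> Ck n (\<lambda>x. f x + g x)"
proof (induction n arbitrary: f g)
  case 0
  then show ?case by (auto intro: continuous_intros)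
next
  case (Suc n)
  show ?case
  proof (rule Ck_SucI)
    show "((\<lambda>x. f x + g x) has_derivative (\<lambda>h. frechet_derivative f (at x) h + frechet_derivative g (at x) h)) (at x)" for x
      by (rule has_derivative_add[OF Ck_differentiable[OF Suc.prems(1)] Ck_differentiable[OF Suc.prems(2)]])
  next
    fix i :: 'a assume "i \<in> Basis"
    then show "Ck n (\<lambda>x. frechet_derivative f (at x) i + frechet_derivative g (at x) i)"
      using Suc.IH[of "partial f i" "partial g i"] Suc.prems by (simp add: partial_def[abs_def])
  qed
qed

lemma Ck_mult: "Ck n f \<Longrightarrow> Ck n g \<Longrightarrow> Ck n (\<lambda>x. f x * g x)"
proof (induction n arbitrary: f g)
  case 0
  then show ?case by (auto intro: continuous_intros)
next
  case (Suc n)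
  show ?case
  proof (rule Ck_SucI)
    show "((\<lambda>x. f x * g x) has_derivative (\<lambda>h. f x * frechet_derivative g (at x) h + frechet_derivative f (at x) h * g x)) (at x)" for x
      by (rule has_derivative_mult[OF Ck_differentiable[OF Suc.prems(1)] Ck_differentiable[OF Suc.prems(2)]])
  next
    fix i :: 'a assume "i \<in> Basis"
    then show "Ck n (\<lambda>x. f x * frechet_derivative g (at x) i + frechet_derivative f (at x) i * g x)"
      using Suc.IH[of "f" "partial g i"] Suc.IH[of "partial f i" "g"] Suc.prems Ck_SucD[of n f] Ck_SucD[of n g]
      by (simp add: partial_def[abs_def] Ck_add)
  qed
qed

lemma Ck_inverse: "Ck n f \<Longrightarrow> (\<And>x. f x \<noteq> 0) \<Longrightarrow> Ck n (\<lambda>x. inverse (f x))"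
proof (induction n)
  case 0
  then show ?case by (auto intro: continuous_intros)
next
  case (Suc n)
  have inv: "Ck n (\<lambda>x. inverse (f x))"
    using Suc Ck_SucD by blast
  show ?case
  proof (rule Ck_SucI)
    show "((\<lambda>x. inverse (f x)) has_derivative (\<lambda>h. - (inverse (f x) * frechet_derivative f (at x) h * inverse (f x)))) (at x)" for x
      using Deriv.has_derivative_inverse[OF Suc.prems(2) Ck_differentiable[OF Suc.prems(1)], of x] by simp
  next
    fix i :: 'a assume "i \<in> Basis"
    then have p: "Ck n (partial f i)" using Suc.prems by simp
    have "Ck n (\<lambda>x. (-1) * (inverse (f x) * partial f i x * inverse (f x)))"
      by (intro Ck_mult Ck_const inv p)
    then show "Ck n (\<lambda>x. - (inverse (f x) * frechet_derivative f (at x) i * inverse (f x)))"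
      by (simp add: partial_def)
  qed
qed

text \<open>The functions \<open>p (1/t) exp (-1/t)\<close>, extended by zero to \<open>t \<le> 0\<close>, form a class that is closed
  under differentiation, with \<open>flat_deriv\<close> acting on \<open>p\<close>. So \<open>exp (-1/t)\<close> is smooth, and so are its
  compositions with smooth functions.\<close>

definition flat :: "real poly \<Rightarrow> real \<Rightarrow> real"
  where "flat p t = (if t > 0 then poly p (1/t) * exp (- (1/t)) else 0)"

definition flat_deriv :: "real poly \<Rightarrow> real poly"
  where "flat_deriv p = [:0, 0, 1:] * (p - pderiv p)"

lemma poly_times_exp_minus_tendsto_0: "((\<lambda>s. poly p s * exp (- s)) \<longlongrightarrow> (0::real)) at_top"
proof -
  have "((\<lambda>s. \<Sum>i\<le>degree p. coeff p i * (s ^ i / exp s)) \<longlongrightarrow> (\<Sum>i\<le>degree p. coeff p i * 0)) at_top"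
    by (intro tendsto_intros tendsto_power_div_exp_0)
  moreover have "poly p s * exp (- s) = (\<Sum>i\<le>degree p. coeff p i * (s ^ i / exp s))" for s
    by (simp add: poly_altdef sum_distrib_right exp_minus divide_inverse mult.assoc)
  ultimately show ?thesis by simp
qed

lemma flat_tendsto_0: "(flat p \<longlongrightarrow> 0) (at_right 0)"
proof -
  have "((\<lambda>t. poly p (inverse t) * exp (- inverse t)) \<longlongrightarrow> 0) (at_right 0)"
    using filterlim_compose[OF poly_times_exp_minus_tendsto_0 filterlim_inverse_at_top_right] .
  then show ?thesis
    by (rule Lim_transform_eventually)
      (auto simp: flat_def eventually_at_filter inverse_eq_divide)
qed

lemma flat_has_derivative: "(flat p has_real_derivative flat (flat_deriv p) t) (at t)"
proof -
  consider "t > 0" | "t < 0" | "t = 0" by linarith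
  then show ?thesis
  proof cases
    case 1
    have "((\<lambda>t. poly p (1/t) * exp (- (1/t))) has_real_derivative flat (flat_deriv p) t) (at t)"
      using 1 by (auto intro!: derivative_eq_intros DERIV_chain[of "poly p", unfolded o_def] poly_DERIV
          simp: flat_def flat_deriv_def field_simps power2_eq_square)
    then show ?thesis
    proof (rule DERIV_cong_ev[THEN iffD1, rotated -1])
      show "\<forall>\<^sub>F x in nhds t. poly p (1/x) * exp (- (1/x)) = flat p x"
        using eventually_nhds_in_open[of "{0<..}" t] 1
        by (auto simp: flat_def elim!: eventually_mono)
    qed auto
  next
    case 2
    have "((\<lambda>t. 0) has_real_derivative flat (flat_deriv p) t) (at t)"
      using 2 by (auto simp: flat_def)
    then show ?thesis
    proof (rule DERIV_cong_ev[THEN iffD1, rotated -1])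
      show "\<forall>\<^sub>F x in nhds t. 0 = flat p x"
        using eventually_nhds_in_open[of "{..<0}" t] 2
        by (auto simp: flat_def elim!: eventually_mono)
    qed auto
  next
    case 3
    \<comment> \<open>On the right of \<open>0\<close> the difference quotient of \<open>flat p\<close> is again a flat function.\<close>
    have r: "((\<lambda>h. flat p h / h) \<longlongrightarrow> 0) (at_right 0)"
    proof (rule Lim_transform_eventually[OF flat_tendsto_0[of "[:0,1:] * p"]])
      show "\<forall>\<^sub>F h in at_right 0. flat ([:0,1:] * p) h = flat p h / h"
        by (auto simp: flat_def eventually_at_filter)
    qed
    have l: "((\<lambda>h. flat p h / h) \<longlongrightarrow> 0) (at_left 0)"
      by (rule Lim_transform_eventually[OF tendsto_const])
        (auto simp: flat_def eventually_at_filter)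
    have "((\<lambda>h. flat p h / h) \<longlongrightarrow> 0) (at 0)"
      using filterlim_split_at[OF l r] .
    then show ?thesis
      using 3 by (auto simp: DERIV_def flat_def)
  qed
qed

text \<open>The induction is over all polynomials at once, because differentiation changes \<open>p\<close>.\<close>

lemma Ck_flat: "Ck n f \<Longrightarrow> Ck n (\<lambda>x. flat p (f x))"
proof (induction n arbitrary: p)
  case 0
  have "continuous_on UNIV (flat p)"
    using DERIV_isCont[OF flat_has_derivative] by (simp add: continuous_on_eq_continuous_at)
  then show ?case
    using 0 continuous_on_compose2[of UNIV "flat p" UNIV f] by auto
next
  case (Suc n)
  show ?case
  proof (rule Ck_SucI)
    show "((\<lambda>x. flat p (f x)) has_derivative (\<lambda>h. flat (flat_deriv p) (f x) * frechet_derivative f (at x) h)) (at x)" for x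
      using has_derivative_compose[OF Ck_differentiable[OF Suc.prems]
          flat_has_derivative[of p "f x", unfolded has_field_derivative_def]] by simp
  next
    fix i :: 'a assume i: "i \<in> Basis"
    have "Ck n (\<lambda>x. flat (flat_deriv p) (f x) * partial f i x)"
      using i Suc Ck_SucD by (intro Ck_mult Suc.IH) auto
    then show "Ck n (\<lambda>x. flat (flat_deriv p) (f x) * frechet_derivative f (at x) i)"
      by (simp add: partial_def)
  qed
qed

lemma Ck_inner: "Ck n (\<lambda>x. x \<bullet> v)"
proof (cases n)
  case (Suc m)
  have "Ck (Suc m) (\<lambda>x. x \<bullet> v)"
    by (rule Ck_SucI[where \<phi>'="\<lambda>_ h. h \<bullet> v"])
      (simp_all add: Ck_const bounded_linear_imp_has_derivative bounded_linear_inner_left)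
  with Suc show ?thesis by simp
qed (auto intro: continuous_intros)

lemma Ck_affine: "Ck n f \<Longrightarrow> Ck n (\<lambda>x. f (s *\<^sub>R x + c))"
proof (induction n arbitrary: f)
  case 0
  then show ?case by (auto intro!: continuous_on_compose2[of UNIV f] continuous_intros)
next
  case (Suc n)
  show ?case
  proof (rule Ck_SucI)
    have "((\<lambda>x. f (s *\<^sub>R x + c)) has_derivative (\<lambda>h. frechet_derivative f (at (s *\<^sub>R x + c)) (s *\<^sub>R h))) (at x)" for x
      by (rule has_derivative_compose[of "\<lambda>x. s *\<^sub>R x + c" "\<lambda>h. s *\<^sub>R h"])
        (auto intro!: derivative_eq_intros Ck_differentiable[OF Suc.prems])
    moreover have "frechet_derivative f (at (s *\<^sub>R x + c)) (s *\<^sub>R h) = s * frechet_derivative f (at (s *\<^sub>R x + c)) h" for x h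
      using linear_frechet_derivative[of f "at (s *\<^sub>R x + c)"] Suc.prems by (simp add: linear_cmul)
    ultimately show "((\<lambda>x. f (s *\<^sub>R x + c)) has_derivative (\<lambda>h. s * frechet_derivative f (at (s *\<^sub>R x + c)) h)) (at x)" for x
      by simp
  next
    fix i :: 'a assume i: "i \<in> Basis"
    have "Ck n (\<lambda>x. s * partial f i (s *\<^sub>R x + c))"
      using Suc.prems i by (intro Ck_mult Ck_const Suc.IH) auto
    then show "Ck n (\<lambda>x. s * frechet_derivative f (at (s *\<^sub>R x + c)) i)"
      by (simp add: partial_def)
  qed
qed

lemma Ck_sum: "finite I \<Longrightarrow> (\<And>i. i \<in> I \<Longrightarrow> Ck n (f i)) \<Longrightarrow> Ck n (\<lambda>x. \<Sum>i\<in>I. f i x)"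
  by (induction I rule: finite_induct) (simp_all add: Ck_const Ck_add)

lemma smooth_partial: "smooth \<phi> \<Longrightarrow> i \<in> Basis \<Longrightarrow> smooth (partial \<phi> i)"
  unfolding smooth_def using Ck.simps(2) by blast

lemma smooth_continuous: "smooth \<phi> \<Longrightarrow> continuous_on S \<phi>"
  unfolding smooth_def using Ck_continuous continuous_on_subset by blast

lemma smooth_has_derivative: "smooth \<phi> \<Longrightarrow> (\<phi> has_derivative (\<lambda>h. frechet_derivative \<phi> (at x) h)) (at x)"
  unfolding smooth_def using Ck_differentiable by blast

lemma smooth_const: "smooth (\<lambda>x. c)" by (simp add: smooth_def Ck_const)

lemma smooth_add: "smooth f \<Longrightarrow> smooth g \<Longrightarrow> smooth (\<lambda>x. f x + g x)"
  by (simp add: smooth_def Ck_add)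

lemma smooth_mult: "smooth f \<Longrightarrow> smooth g \<Longrightarrow> smooth (\<lambda>x. f x * g x)"
  by (simp add: smooth_def Ck_mult)

lemma smooth_inverse: "smooth f \<Longrightarrow> (\<And>x. f x \<noteq> 0) \<Longrightarrow> smooth (\<lambda>x. inverse (f x))"
  by (simp add: smooth_def Ck_inverse)

lemma smooth_flat: "smooth f \<Longrightarrow> smooth (\<lambda>x. flat p (f x))"
  by (simp add: smooth_def Ck_flat)

lemma smooth_inner: "smooth (\<lambda>x. x \<bullet> v)"
  by (simp add: smooth_def Ck_inner)

lemma smooth_affine: "smooth f \<Longrightarrow> smooth (\<lambda>x. f (s *\<^sub>R x + c))"
  by (simp add: smooth_def Ck_affine)

lemma smooth_sum: "finite I \<Longrightarrow> (\<And>i. i \<in> I \<Longrightarrow> smooth (h i)) \<Longrightarrow> smooth (\<lambda>x. \<Sum>i\<in>I. h i x)"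
  by (simp add: smooth_def Ck_sum)

lemma smooth_diff: "smooth f \<Longrightarrow> smooth g \<Longrightarrow> smooth (\<lambda>x. f x - g x)"
  using smooth_add[OF _ smooth_mult[OF smooth_const[of "-1"]], of f g] by simp

lemma smooth_shift: "smooth f \<Longrightarrow> smooth (\<lambda>x. f (x - c))"
  using smooth_affine[of f 1 "-c"] by simp

lemma smooth_dist_square: "smooth (\<lambda>x. r - (norm (x - c))\<^sup>2)"
proof -
  have "smooth (\<lambda>x. \<Sum>i\<in>Basis. ((x - c) \<bullet> i) * ((x - c) \<bullet> i))"
    by (intro smooth_sum smooth_mult smooth_shift[where f="\<lambda>x. x \<bullet> _"] smooth_inner) auto
  then have "smooth (\<lambda>x. (norm (x - c))\<^sup>2)"
    by (simp add: power2_norm_eq_inner euclidean_inner[of "_ - c" "_ - c"])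
  then show ?thesis by (intro smooth_diff smooth_const)
qed

lemma partial_add: "smooth f \<Longrightarrow> smooth g \<Longrightarrow> partial (\<lambda>x. f x + g x) i x = partial f i x + partial g i x"
  using partial_eq[OF has_derivative_add[OF smooth_has_derivative smooth_has_derivative]]
  by (simp add: partial_def)

lemma partial_mult: "smooth f \<Longrightarrow> smooth g \<Longrightarrow> partial (\<lambda>x. f x * g x) i x = f x * partial g i x + partial f i x * g x"
  using partial_eq[OF has_derivative_mult[OF smooth_has_derivative smooth_has_derivative]]
  by (simp add: partial_def)

lemma partial_shift:
  assumes "smooth f" shows "partial (\<lambda>y. f (y - c)) i x = partial f i (x - c)"
proof -
  have "((\<lambda>y. f (y - c)) has_derivative (\<lambda>h. frechet_derivative f (at (x - c)) h)) (at x)"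
    by (rule has_derivative_compose[of "\<lambda>y. y - c" "\<lambda>h. h"])
      (auto intro!: derivative_eq_intros smooth_has_derivative[OF assms])
  from partial_eq[OF this] show ?thesis by (simp only: partial_def)
qed

text \<open>The classical gradient, in contrast to the weak gradient \<open>grad\<close>.\<close>

definition cgrad :: "('a::euclidean_space \<Rightarrow> real) \<Rightarrow> 'a \<Rightarrow> 'a"
  where "cgrad \<phi> x = (\<Sum>i\<in>Basis. partial \<phi> i x *\<^sub>R i)"

lemma cgrad_inner: "i \<in> Basis \<Longrightarrow> cgrad \<phi> x \<bullet> i = partial \<phi> i x"
  by (simp add: cgrad_def)

lemma smooth_has_derivative_cgrad:
  assumes "smooth \<phi>" shows "(\<phi> has_derivative (\<lambda>h. cgrad \<phi> x \<bullet> h)) (at x)"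
proof -
  have lin: "linear (frechet_derivative \<phi> (at x))"
    using smooth_has_derivative[OF assms, of x] by (simp add: has_derivative_linear)
  have "frechet_derivative \<phi> (at x) h = cgrad \<phi> x \<bullet> h" for h
  proof -
    have "frechet_derivative \<phi> (at x) h = frechet_derivative \<phi> (at x) (\<Sum>i\<in>Basis. (h \<bullet> i) *\<^sub>R i)"
      by (simp add: euclidean_representation)
    also have "\<dots> = (\<Sum>i\<in>Basis. (h \<bullet> i) * partial \<phi> i x)"
      by (simp add: linear_sum[OF lin] linear_cmul[OF lin] partial_def)
    finally show ?thesis
      by (simp add: cgrad_def inner_sum_left inner_commute[of h] mult.commute[of "_ \<bullet> _"])
  qed
  then show ?thesis using smooth_has_derivative[OF assms, of x] by (simp add: fun_eq_iff[symmetric])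
qed

lemma cgrad_continuous: "smooth \<phi> \<Longrightarrow> continuous_on S (cgrad \<phi>)"
  unfolding cgrad_def[abs_def] by (intro continuous_intros smooth_continuous smooth_partial) auto

lemma smooth_lipschitz_on_compact:
  assumes "smooth \<phi>" and "compact S" and "convex S"
  obtains L where "L \<ge> 0" and "\<And>x y. x \<in> S \<Longrightarrow> y \<in> S \<Longrightarrow> \<bar>\<phi> x - \<phi> y\<bar> \<le> L * norm (x - y)"
proof -
  have "bounded (cgrad \<phi> ` S)"
    by (intro compact_imp_bounded compact_continuous_image cgrad_continuous assms)
  then obtain L where L: "L > 0" "\<And>x. x \<in> S \<Longrightarrow> norm (cgrad \<phi> x) \<le> L"
    unfolding bounded_pos by auto
  have "norm (\<phi> x - \<phi> y) \<le> L * norm (x - y)" if "x \<in> S" "y \<in> S" for x y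
  proof (rule differentiable_bound[OF \<open>convex S\<close> _ _ that])
    show "(\<phi> has_derivative (\<lambda>h. cgrad \<phi> x \<bullet> h)) (at x within S)" for x
      using smooth_has_derivative_cgrad[OF assms(1)] has_derivative_at_withinI by blast
    show "onorm (\<lambda>h. cgrad \<phi> x \<bullet> h) \<le> L" if "x \<in> S" for x
    proof (rule onorm_bound)
      show "norm (cgrad \<phi> x \<bullet> h) \<le> L * norm h" for h
        using Cauchy_Schwarz_ineq2[of "cgrad \<phi> x" h] mult_right_mono[OF L(2)[OF that], of "norm h"] by simp
    qed (use L in simp)
  qed
  then show ?thesis using that[of L] L by auto
qed

text \<open>Since \<open>flat 1\<close> is positive exactly on the positive reals, this smooth function is positive exactly
  inside the ball of radius \<open>r > 0\<close>.\<close>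

definition bump :: "'a::euclidean_space \<Rightarrow> real \<Rightarrow> 'a \<Rightarrow> real"
  where "bump c r x = flat 1 (r\<^sup>2 - (norm (x - c))\<^sup>2)"

lemma smooth_bump: "smooth (bump c r)"
  unfolding bump_def[abs_def] by (intro smooth_flat smooth_dist_square)

lemma bump_nonneg: "bump c r x \<ge> 0"
  by (simp add: bump_def flat_def)

lemma bump_nonzero_iff:
  assumes "r > 0" shows "bump c r x \<noteq> 0 \<longleftrightarrow> x \<in> ball c r"
proof -
  have "0 < r\<^sup>2 - (norm (x - c))\<^sup>2 \<longleftrightarrow> norm (x - c) < r"
    using assms power2_less_imp_less[of "norm (x - c)" r] power_strict_mono[of "norm (x - c)" r 2] by auto
  then show ?thesis
    by (auto simp: bump_def flat_def dist_norm norm_minus_commute)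
qed

text \<open>The quotient \<open>e / (e + d)\<close>, where \<open>e\<close> is positive inside the large ball and \<open>d\<close> outside the closed
  small one. These two regions cover the space, so the denominator is positive.\<close>

lemma cutoff_exists:
  assumes "(r::real) > 0"
  obtains \<beta> :: "'a::euclidean_space \<Rightarrow> real" where "smooth \<beta>"
    and "\<And>x. x \<in> ball c (r/2) \<Longrightarrow> \<beta> x = 1" and "\<And>x. x \<notin> ball c r \<Longrightarrow> \<beta> x = 0"
proof -
  let ?e = "bump c r" and ?d = "\<lambda>x::'a. flat 1 ((norm (x - c))\<^sup>2 - (r/2)\<^sup>2)"
  have "smooth (\<lambda>x. 0 - ((r/2)\<^sup>2 - (norm (x - c))\<^sup>2))"
    by (intro smooth_diff smooth_dist_square smooth_const)
  then have d: "smooth ?d" by (intro smooth_flat) simp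
  have pos: "?e x + ?d x \<noteq> 0" for x
  proof -
    have "?e x \<ge> 0" "?d x \<ge> 0" by (auto simp: bump_nonneg flat_def)
    moreover have "?e x > 0 \<or> ?d x > 0"
    proof -
      have "(r/2)\<^sup>2 < r\<^sup>2" using assms by (simp add: power_divide)
      then have "0 < r\<^sup>2 - (norm (x - c))\<^sup>2 \<or> 0 < (norm (x - c))\<^sup>2 - (r/2)\<^sup>2" by linarith
      then show ?thesis by (auto simp: bump_def flat_def)
    qed
    ultimately show ?thesis by linarith
  qed
  show ?thesis
  proof
    show "smooth (\<lambda>x. ?e x * inverse (?e x + ?d x))"
      by (intro smooth_mult smooth_inverse smooth_add smooth_bump d pos)
    fix x
    show "?e x * inverse (?e x + ?d x) = 1" if "x \<in> ball c (r/2)"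
    proof -
      have "norm (x - c) < r/2" using that by (simp add: dist_norm norm_minus_commute)
      then have "(norm (x - c))\<^sup>2 < (r/2)\<^sup>2" by (intro power_strict_mono) auto
      then have "?d x = 0" by (simp add: flat_def)
      then show ?thesis using pos[of x] by simp
    qed
    show "?e x * inverse (?e x + ?d x) = 0" if "x \<notin> ball c r"
      using that bump_nonzero_iff[OF assms, of c x] by auto
  qed
qed

lemma partial_zero_outside:
  assumes "x \<notin> closure {x. \<phi> x \<noteq> 0}" shows "partial \<phi> i x = 0"
proof -
  have ev: "\<forall>\<^sub>F y in nhds x. \<phi> y = 0"
  proof -
    have "\<forall>\<^sub>F y in nhds x. y \<in> - closure {x. \<phi> x \<noteq> 0}"
      by (rule eventually_nhds_in_open) (use assms in auto)
    then show ?thesis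
      by eventually_elim (use closure_subset[of "{x. \<phi> x \<noteq> 0}"] in auto)
  qed
  have "(\<phi> has_derivative (\<lambda>h. 0)) (at x)"
    by (rule has_derivative_transform_eventually[where f="\<lambda>x. 0" ])
      (use ev eventually_nhds_x_imp_x[OF ev] in \<open>auto simp: eventually_at_filter elim: eventually_mono\<close>)
  then show ?thesis by (rule partial_eq)
qed

text \<open>Makes translates of a mollifier admissible in the definition of the weak gradient.\<close>

lemma test_functions_shift:
  assumes "smooth k" "closure {x. k x \<noteq> 0} \<subseteq> cball c r"
    and "cball (x + c) r \<subseteq> \<Omega>"
  shows "(\<lambda>y. k (y - x)) \<in> test_functions \<Omega>"
proof -
  have "{y. k (y - x) \<noteq> 0} \<subseteq> cball (x + c) r"
  proof
    fix y assume "y \<in> {y. k (y - x) \<noteq> 0}"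
    then have "y - x \<in> cball c r" using assms(2) closure_subset[of "{x. k x \<noteq> 0}"] by auto
    then show "y \<in> cball (x + c) r" by (simp add: dist_norm algebra_simps)
  qed
  then have sub: "closure {y. k (y - x) \<noteq> 0} \<subseteq> cball (x + c) r"
    using closure_minimal by blast
  then have "compact (closure {y. k (y - x) \<noteq> 0})"
    using bounded_subset[OF bounded_cball] by (auto simp: compact_eq_bounded_closed)
  with sub assms show ?thesis
    by (auto simp: test_functions_def intro: smooth_shift)
qed

section \<open>Semidefinite forms and the Riesz representation theorem\<close>

text \<open>The carrier is a set of functions because the spaces below depend on the domain. The form is only
  semidefinite because functions that agree almost everywhere are not identified.\<close>

locale form_space =
  fixes V :: "('x \<Rightarrow> real) set" and B :: "('x \<Rightarrow> real) \<Rightarrow> ('x \<Rightarrow> real) \<Rightarrow> real"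
  assumes lincomb_closed: "u \<in> V \<Longrightarrow> v \<in> V \<Longrightarrow> (\<lambda>x. c * u x + d * v x) \<in> V"
    and form_sym: "B u v = B v u"
    and form_lincomb: "u \<in> V \<Longrightarrow> v \<in> V \<Longrightarrow> w \<in> V \<Longrightarrow>
      B (\<lambda>x. c * u x + d * v x) w = c * B u w + d * B v w"
    and form_nonneg: "u \<in> V \<Longrightarrow> 0 \<le> B u u"
begin

lemma form_square:
  assumes "u \<in> V" "v \<in> V"
  shows "B (\<lambda>x. c * u x + d * v x) (\<lambda>x. c * u x + d * v x)
    = c\<^sup>2 * B u u + 2 * c * d * B u v + d\<^sup>2 * B v v"
proof -
  let ?w = "\<lambda>x. c * u x + d * v x"
  have w: "?w \<in> V" by (intro lincomb_closed assms)
  have "B ?w ?w = c * B u ?w + d * B v ?w" by (intro form_lincomb assms w)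
  also have "B u ?w = c * B u u + d * B v u"
    using form_lincomb[OF assms assms(1), of c d] form_sym[of u ?w] by simp
  also have "B v ?w = c * B u v + d * B v v"
    using form_lincomb[OF assms assms(2), of c d] form_sym[of v ?w] by simp
  finally show ?thesis
    using form_sym[of v u] by (simp add: power2_eq_square algebra_simps)
qed

lemma form_Cauchy_Schwarz:
  assumes "u \<in> V" "v \<in> V"
  shows "(B u v)\<^sup>2 \<le> B u u * B v v"
proof -
  have nn: "0 \<le> c\<^sup>2 * B u u + 2 * c * d * B u v + d\<^sup>2 * B v v" for c d
    using form_nonneg[OF lincomb_closed[OF assms, of c d]] form_square[OF assms, of c d] by simp
  show ?thesis
  proof (cases "B v v = 0")
    case True
    \<comment> \<open>Otherwise moving far enough from \<open>u\<close> along the null vector \<open>v\<close> would make the form negative.\<close>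
    have "B u v = 0"
    proof (rule ccontr)
      assume *: "B u v \<noteq> 0"
      from nn[of 1 "- ((B u u + 1) / (2 * B u v))"] * True show False
        by (simp add: field_simps)
    qed
    then show ?thesis using True by simp
  next
    case False
    then have p: "B v v > 0" using form_nonneg[OF assms(2)] by simp
    from nn[of "B v v" "- B u v"]
    have "0 \<le> B v v * (B u u * B v v - (B u v)\<^sup>2)"
      by (simp add: power2_eq_square algebra_simps)
    then show ?thesis using p by (simp add: zero_le_mult_iff)
  qed
qed

lemma form_Cauchy_Schwarz_sqrt:
  assumes "u \<in> V" "v \<in> V"
  shows "\<bar>B u v\<bar> \<le> sqrt (B u u) * sqrt (B v v)"
  using real_sqrt_le_mono[OF form_Cauchy_Schwarz[OF assms]] by (simp add: real_sqrt_mult)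

lemma diff_closed: "u \<in> V \<Longrightarrow> v \<in> V \<Longrightarrow> (\<lambda>x. u x - v x) \<in> V"
  using lincomb_closed[of u v 1 "-1"] by simp

lemma form_diff_left: "u \<in> V \<Longrightarrow> v \<in> V \<Longrightarrow> w \<in> V \<Longrightarrow> B (\<lambda>x. u x - v x) w = B u w - B v w"
  using form_lincomb[of u v w 1 "-1"] by simp

lemma form_tendsto:
  assumes "\<And>n. u n \<in> V" "u' \<in> V" "v \<in> V"
    and lim: "(\<lambda>n. B (\<lambda>x. u n x - u' x) (\<lambda>x. u n x - u' x)) \<longlonglongrightarrow> 0"
  shows "(\<lambda>n::nat. B (u n) v) \<longlonglongrightarrow> B u' v"
proof -
  have "(\<lambda>n. B (u n) v - B u' v) \<longlonglongrightarrow> 0"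
  proof (rule Lim_null_comparison[where g="\<lambda>n. sqrt (B (\<lambda>x. u n x - u' x) (\<lambda>x. u n x - u' x)) * sqrt (B v v)"])
    show "\<forall>\<^sub>F n in sequentially. norm (B (u n) v - B u' v)
        \<le> sqrt (B (\<lambda>x. u n x - u' x) (\<lambda>x. u n x - u' x)) * sqrt (B v v)"
      using form_Cauchy_Schwarz_sqrt[OF diff_closed[OF assms(1,2)] assms(3)]
        form_diff_left[OF assms(1,2,3)] by simp
    show "(\<lambda>n. sqrt (B (\<lambda>x. u n x - u' x) (\<lambda>x. u n x - u' x)) * sqrt (B v v)) \<longlonglongrightarrow> 0"
      using tendsto_mult[OF tendsto_real_sqrt[OF lim] tendsto_const[of "sqrt (B v v)"]] by simp
  qed
  then show ?thesis by (simp add: LIM_zero_iff)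
qed

text \<open>The solution minimises \<open>E v = B v v - 2 l v\<close>. The parallelogram law makes a minimising sequence
  Cauchy. An almost minimiser solves the equation up to a small error, as its first variation shows, and
  the error disappears in the limit.\<close>

theorem Riesz_representation:
  assumes ne: "V \<noteq> {}"
    and complete: "\<And>u. (\<And>n. u n \<in> V) \<Longrightarrow>
      (\<And>\<epsilon>. \<epsilon> > 0 \<Longrightarrow> \<exists>N. \<forall>m\<ge>N. \<forall>n\<ge>N. B (\<lambda>x. u m x - u n x) (\<lambda>x. u m x - u n x) < \<epsilon>) \<Longrightarrow>
      \<exists>u'\<in>V. (\<lambda>n::nat. B (\<lambda>x. u n x - u' x) (\<lambda>x. u n x - u' x)) \<longlonglongrightarrow> 0"
    and l_lin: "\<And>u v c d. u \<in> V \<Longrightarrow> v \<in> V \<Longrightarrow> l (\<lambda>x. c * u x + d * v x) = c * l u + d * l v"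
    and l_bdd: "\<And>v. v \<in> V \<Longrightarrow> \<bar>l v\<bar> \<le> C * sqrt (B v v)"
  shows "\<exists>u\<in>V. \<forall>v\<in>V. B u v = l v"
proof -
  define E where "E v = B v v - 2 * l v" for v
  have E_lower: "- (C\<^sup>2) \<le> E v" if "v \<in> V" for v
  proof -
    have "0 \<le> (sqrt (B v v) - C)\<^sup>2" by simp
    then have "2 * (C * sqrt (B v v)) \<le> B v v + C\<^sup>2"
      using form_nonneg[OF that] by (simp add: power2_diff algebra_simps)
    then show ?thesis using l_bdd[OF that] by (simp add: E_def)
  qed
  have E_lincomb: "E (\<lambda>x. c * u x + d * v x)
      = c\<^sup>2 * B u u + 2 * c * d * B u v + d\<^sup>2 * B v v - 2 * (c * l u + d * l v)"
    if "u \<in> V" "v \<in> V" for u v c d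
    using that by (simp add: E_def form_square l_lin)
  define m where "m = Inf (E ` V)"
  have bb: "bdd_below (E ` V)" by (rule bdd_belowI2[where m="- (C\<^sup>2)"]) (rule E_lower)
  have m_le: "m \<le> E v" if "v \<in> V" for v
    unfolding m_def by (rule cInf_lower) (use that bb in auto)
  have "\<exists>v\<in>V. E v < m + 1 / real (Suc n)" for n
    using cInf_less_iff[of "E ` V" "m + 1 / real (Suc n)"] ne bb by (auto simp: m_def)
  then obtain u where u: "\<And>n. u n \<in> V" "\<And>n. E (u n) < m + 1 / real (Suc n)" by metis
  have par: "B (\<lambda>x. u i x - u j x) (\<lambda>x. u i x - u j x) \<le> 2 * (1 / real (Suc i) + 1 / real (Suc j))" for i j
  proof -
    have "m \<le> E (\<lambda>x. (1/2) * u i x + (1/2) * u j x)"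
      by (intro m_le lincomb_closed u)
    then have "m \<le> (B (u i) (u i) + 2 * B (u i) (u j) + B (u j) (u j)) / 4 - (l (u i) + l (u j))"
      using E_lincomb[OF u(1) u(1), of "1/2" i "1/2" j] by (simp add: power2_eq_square field_simps)
    moreover have "B (\<lambda>x. u i x - u j x) (\<lambda>x. u i x - u j x)
        = B (u i) (u i) - 2 * B (u i) (u j) + B (u j) (u j)"
      using form_square[OF u(1) u(1), of 1 i "-1" j] by simp
    moreover have "a \<le> 2 * (ei + ej)"
      if "m \<le> (bi + 2 * bij + bj) / 4 - (li + lj)" "a = bi - 2 * bij + bj"
        "bi - 2 * li < m + ei" "bj - 2 * lj < m + ej" for a ei ej bi bj bij li lj :: real
      using that by argo
    ultimately show ?thesis using u(2)[of i] u(2)[of j] unfolding E_def by blast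
  qed
  have "\<exists>u'\<in>V. (\<lambda>n::nat. B (\<lambda>x. u n x - u' x) (\<lambda>x. u n x - u' x)) \<longlonglongrightarrow> 0"
  proof (rule complete[OF u(1)])
    fix \<epsilon> :: real assume "\<epsilon> > 0"
    then obtain N :: nat where N: "N > 0" "inverse (real N) < \<epsilon> / 4"
      using ex_inverse_of_nat_less[of "\<epsilon>/4"] by auto
    have "B (\<lambda>x. u i x - u j x) (\<lambda>x. u i x - u j x) < \<epsilon>" if "i \<ge> N" "j \<ge> N" for i j
    proof -
      have *: "1 / real (Suc k) \<le> inverse (real N)" if "k \<ge> N" for k
        using that N by (simp add: inverse_eq_divide frac_le)
      show ?thesis using par[of i j] *[OF that(1)] *[OF that(2)] N(2) by argo
    qed
    then show "\<exists>N. \<forall>m\<ge>N. \<forall>n\<ge>N. B (\<lambda>x. u m x - u n x) (\<lambda>x. u m x - u n x) < \<epsilon>" by blast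
  qed
  then obtain u' where u': "u' \<in> V" "(\<lambda>n. B (\<lambda>x. u n x - u' x) (\<lambda>x. u n x - u' x)) \<longlonglongrightarrow> 0" by blast
  have "B u' v = l v" if v: "v \<in> V" for v
  proof -
    have lim0: "(\<lambda>n. sqrt (1 / real (Suc n) * B v v)) \<longlonglongrightarrow> 0"
      using tendsto_real_sqrt[OF tendsto_mult[OF lim_1_over_n[THEN LIMSEQ_Suc] tendsto_const[of "B v v"]]] by simp
    have "\<bar>B (u n) v - l v\<bar> \<le> sqrt (1 / real (Suc n) * B v v)" for n
    proof -
      define b where "b = B (u n) v - l v"
      define e where "e = 1 / real (Suc n)"
      \<comment> \<open>Along the line through \<open>u n\<close> in direction \<open>v\<close>, \<open>E\<close> stays above \<open>m\<close>, hence above \<open>E (u n) - e\<close>.\<close>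
      have q: "0 \<le> e + 2 * t * b + t\<^sup>2 * B v v" for t
      proof -
        have "m \<le> E (\<lambda>x. 1 * u n x + t * v x)" by (intro m_le lincomb_closed u v)
        also have "\<dots> = E (u n) + 2 * t * b + t\<^sup>2 * B v v"
          using E_lincomb[OF u(1) v, of 1 n t] by (simp add: E_def b_def algebra_simps)
        finally show ?thesis using u(2)[of n] by (simp add: e_def)
      qed
      have e: "e > 0" by (simp add: e_def)
      have "b\<^sup>2 \<le> e * B v v"
      proof (cases "B v v = 0")
        case True
        have "b = 0"
        proof (rule ccontr)
          assume "b \<noteq> 0"
          with q[of "- e / b"] True e show False by simp
        qed
        then show ?thesis using True by simp
      next
        case False
        then have p: "B v v > 0" using form_nonneg[OF v] by simp
        from q[of "- b / B v v"] p show ?thesis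
          by (simp add: field_simps power2_eq_square)
      qed
      then show ?thesis
        using real_sqrt_le_mono[of "b\<^sup>2" "e * B v v"] by (simp add: b_def e_def)
    qed
    then have "(\<lambda>n. B (u n) v - l v) \<longlonglongrightarrow> 0"
      by (intro Lim_null_comparison[OF _ lim0]) auto
    then have "(\<lambda>n. B (u n) v) \<longlonglongrightarrow> l v" by (simp add: LIM_zero_iff)
    with form_tendsto[OF u(1) u'(1) v u'(2)] show ?thesis using LIMSEQ_unique by blast
  qed
  with u'(1) show ?thesis by blast
qed

end

section \<open>Square integrable functions\<close>

lemma L2_measurable: "f \<in> L2 M \<Longrightarrow> f \<in> borel_measurable M"
  by (simp add: L2_def)

lemma L2_integrable: "f \<in> L2 M \<Longrightarrow> integrable M (\<lambda>x. (norm (f x))\<^sup>2)"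
  by (simp add: L2_def)

lemma L2_bound:
  assumes "integrable M w" "f \<in> borel_measurable M" "AE x in M. (norm (f x))\<^sup>2 \<le> w x"
  shows "f \<in> L2 M"
proof -
  note [measurable] = assms(2)
  have "integrable M (\<lambda>x. (norm (f x))\<^sup>2)"
    by (rule Bochner_Integration.integrable_bound[OF assms(1)]) (use assms(3) in \<open>auto elim!: eventually_mono\<close>)
  then show ?thesis using assms(2) by (simp add: L2_def)
qed

lemma L2_nn_integral:
  "f \<in> L2 M \<Longrightarrow> (\<integral>\<^sup>+x. ennreal ((norm (f x))\<^sup>2) \<partial>M) = ennreal (LINT x|M. (norm (f x))\<^sup>2)"
  by (intro nn_integral_eq_integral L2_integrable) auto

lemma L2_I_nn:
  assumes "f \<in> borel_measurable M" "(\<integral>\<^sup>+x. ennreal ((norm (f x))\<^sup>2) \<partial>M) < \<infinity>"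
  shows "f \<in> L2 M"
proof -
  note [measurable] = assms(1)
  have "integrable M (\<lambda>x. (norm (f x))\<^sup>2)"
    using assms(2) by (intro integrableI_bounded) auto
  then show ?thesis using assms(1) by (simp add: L2_def)
qed

lemma norm_add_square: "(norm (a + b))\<^sup>2 \<le> 2 * (norm a)\<^sup>2 + 2 * (norm (b::'b::real_normed_vector))\<^sup>2"
proof -
  have "(norm (a + b))\<^sup>2 \<le> (norm a + norm b)\<^sup>2"
    by (intro power_mono norm_triangle_ineq norm_ge_zero)
  also have "\<dots> \<le> 2 * (norm a)\<^sup>2 + 2 * (norm b)\<^sup>2"
    using zero_le_power2[of "norm a - norm b"] by (simp add: power2_sum power2_diff)
  finally show ?thesis .
qed

lemma L2_add:
  assumes "f \<in> L2 M" "g \<in> L2 M" shows "(\<lambda>x. f x + g x) \<in> L2 M"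
proof (rule L2_bound)
  show "integrable M (\<lambda>x. 2 * (norm (f x))\<^sup>2 + 2 * (norm (g x))\<^sup>2)"
    using assms by (auto simp: L2_def)
  show "(\<lambda>x. f x + g x) \<in> borel_measurable M"
    using assms by (auto simp: L2_def)
qed (simp add: norm_add_square)

lemma L2_scaleR:
  assumes "f \<in> L2 M" shows "(\<lambda>x. c *\<^sub>R f x) \<in> L2 M"
proof (rule L2_bound)
  show "integrable M (\<lambda>x. c\<^sup>2 * (norm (f x))\<^sup>2)"
    using assms by (auto simp: L2_def)
  show "(\<lambda>x. c *\<^sub>R f x) \<in> borel_measurable M"
    using assms by (auto simp: L2_def)
qed (simp add: power_mult_distrib)

lemma L2_diff: "f \<in> L2 M \<Longrightarrow> g \<in> L2 M \<Longrightarrow> (\<lambda>x. f x - g x) \<in> L2 M"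
  using L2_add[OF _ L2_scaleR[of g M "-1"], of f] by simp

lemma L2_lincomb: "f \<in> L2 M \<Longrightarrow> g \<in> L2 M \<Longrightarrow> (\<lambda>x. c *\<^sub>R f x + d *\<^sub>R g x) \<in> L2 M"
  by (intro L2_add L2_scaleR)

lemma L2_lincomb_real: "f \<in> L2 M \<Longrightarrow> g \<in> L2 M \<Longrightarrow> (\<lambda>x. c * f x + d * g x :: real) \<in> L2 M"
  using L2_lincomb[of f M g c d] by simp

lemma L2_inner_component:
  assumes "f \<in> L2 M" "norm i \<le> 1" shows "(\<lambda>x. f x \<bullet> i) \<in> L2 M"
proof (rule L2_bound[OF L2_integrable[OF assms(1)]])
  show "(\<lambda>x. f x \<bullet> i) \<in> borel_measurable M"
    using assms by (auto simp: L2_def)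
  have "\<bar>f x \<bullet> i\<bar> \<le> norm (f x)" for x
    using Cauchy_Schwarz_ineq2[of "f x" i] mult_left_mono[OF assms(2), of "norm (f x)"] by simp
  then have "(norm (f x \<bullet> i))\<^sup>2 \<le> (norm (f x))\<^sup>2" for x
    by (intro power_mono) auto
  then show "AE x in M. (norm (f x \<bullet> i))\<^sup>2 \<le> (norm (f x))\<^sup>2" by simp
qed

lemma L2_bounded_mult:
  assumes "f \<in> L2 M" "b \<in> borel_measurable M" "AE x in M. \<bar>b x\<bar> \<le> C"
  shows "(\<lambda>x. b x *\<^sub>R f x) \<in> L2 M"
proof (rule L2_bound)
  show "integrable M (\<lambda>x. C\<^sup>2 * (norm (f x))\<^sup>2)"
    using assms by (auto simp: L2_def)
  show "(\<lambda>x. b x *\<^sub>R f x) \<in> borel_measurable M"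
    using assms by (auto simp: L2_def)
  show "AE x in M. (norm (b x *\<^sub>R f x))\<^sup>2 \<le> C\<^sup>2 * (norm (f x))\<^sup>2"
    using assms(3)
  proof eventually_elim
    case (elim x)
    then have "(\<bar>b x\<bar>)\<^sup>2 \<le> C\<^sup>2" by (intro power_mono) auto
    then show ?case by (simp add: power_mult_distrib mult_right_mono)
  qed
qed

lemma L2_AE_cong:
  assumes "f \<in> L2 M" "g \<in> borel_measurable M" "AE x in M. f x = g x"
  shows "g \<in> L2 M"
  by (rule L2_bound[OF L2_integrable[OF assms(1)] assms(2)]) (use assms(3) in \<open>auto elim!: eventually_mono\<close>)

lemma L2_inner_integrable:
  assumes "f \<in> L2 M" "g \<in> L2 M" shows "integrable M (\<lambda>x. f x \<bullet> g x)"
proof (rule Bochner_Integration.integrable_bound)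
  show "integrable M (\<lambda>x. (norm (f x))\<^sup>2 + (norm (g x))\<^sup>2)"
    using assms by (auto simp: L2_def)
  show "(\<lambda>x. f x \<bullet> g x) \<in> borel_measurable M"
    using assms by (auto simp: L2_def)
  have "\<bar>f x \<bullet> g x\<bar> \<le> (norm (f x))\<^sup>2 + (norm (g x))\<^sup>2" for x
  proof -
    have "\<bar>f x \<bullet> g x\<bar> \<le> norm (f x) * norm (g x)" by (rule Cauchy_Schwarz_ineq2)
    also have "\<dots> \<le> (norm (f x))\<^sup>2 + (norm (g x))\<^sup>2"
      using zero_le_power2[of "norm (f x) - norm (g x)"] mult_nonneg_nonneg[OF norm_ge_zero norm_ge_zero, of "f x" "g x"]
      unfolding power2_diff by linarith
    finally show ?thesis .
  qed
  then show "AE x in M. norm (f x \<bullet> g x) \<le> norm ((norm (f x))\<^sup>2 + (norm (g x))\<^sup>2)" by simp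
qed

lemma L2_mult_integrable: "f \<in> L2 M \<Longrightarrow> g \<in> L2 M \<Longrightarrow> integrable M (\<lambda>x. f x * g x :: real)"
  using L2_inner_integrable[of f M g] by simp

lemma L2_form_space: "form_space (L2 M) (\<lambda>u v. LINT x|M. u x * v x)"
proof
  fix u v w :: "'a \<Rightarrow> real" and c d
  show "(LINT x|M. u x * v x) = (LINT x|M. v x * u x)" by (simp add: mult.commute)
  assume "u \<in> L2 M" "v \<in> L2 M"
  then show "(\<lambda>x. c * u x + d * v x) \<in> L2 M" by (rule L2_lincomb_real)
  assume "w \<in> L2 M"
  with \<open>u \<in> L2 M\<close> \<open>v \<in> L2 M\<close>
  show "(LINT x|M. (c * u x + d * v x) * w x) = c * (LINT x|M. u x * w x) + d * (LINT x|M. v x * w x)"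
    by (simp add: distrib_right mult.assoc L2_mult_integrable)
qed simp

lemma L2_Cauchy_Schwarz:
  fixes f g :: "'a \<Rightarrow> real"
  assumes "f \<in> L2 M" "g \<in> L2 M"
  shows "\<bar>LINT x|M. f x * g x\<bar> \<le> sqrt (LINT x|M. (f x)\<^sup>2) * sqrt (LINT x|M. (g x)\<^sup>2)"
  using form_space.form_Cauchy_Schwarz_sqrt[OF L2_form_space assms] by (simp add: power2_eq_square)

text \<open>Along a subsequence whose increments \<open>d\<^sub>k\<close> have square integral at most \<open>4^(-k)\<close>, the sum of the
  \<open>2\<^sup>k d\<^sub>k\<^sup>2\<close> is integrable and so finite almost everywhere. Hence the increments decay geometrically,
  and the subsequence converges pointwise. Fatou's lemma carries the Cauchy property to the limit.\<close>

theorem L2_complete: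
  fixes f :: "nat \<Rightarrow> 'a \<Rightarrow> 'b::euclidean_space"
  assumes f: "\<And>n. f n \<in> L2 M"
    and Cauchy: "\<And>\<epsilon>. \<epsilon> > 0 \<Longrightarrow> \<exists>N. \<forall>m\<ge>N. \<forall>n\<ge>N. (LINT x|M. (norm (f m x - f n x))\<^sup>2) < \<epsilon>"
  obtains h where "h \<in> L2 M" "(\<lambda>n. LINT x|M. (norm (f n x - h x))\<^sup>2) \<longlonglongrightarrow> 0"
proof -
  note [measurable] = L2_measurable[OF f]
  have "\<exists>N. \<forall>m\<ge>N. \<forall>n\<ge>N. (LINT x|M. (norm (f m x - f n x))\<^sup>2) < (1/4)^k" for k
    by (rule Cauchy) simp
  then obtain N where N: "\<And>k m n. m \<ge> N k \<Longrightarrow> n \<ge> N k \<Longrightarrow> (LINT x|M. (norm (f m x - f n x))\<^sup>2) < (1/4)^k"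
    by metis
  define r where "r k = (\<Sum>j\<le>k. N j) + k" for k
  have N_le: "N k \<le> sum N {..k}" for k
    by (rule member_le_sum) auto
  have r_ge: "r k \<ge> N k" "r (Suc k) \<ge> N k" for k
    using N_le[of k] by (auto simp: r_def)
  have r_top: "filterlim r at_top sequentially"
    by (rule filterlim_at_top_mono[OF filterlim_ident]) (simp add: r_def)
  have nn: "(\<integral>\<^sup>+x. ennreal ((norm (f m x - f n x))\<^sup>2) \<partial>M) = ennreal (LINT x|M. (norm (f m x - f n x))\<^sup>2)" for m n
    using L2_nn_integral[OF L2_diff[OF f f]] .
  let ?d = "\<lambda>k x. norm (f (r (Suc k)) x - f (r k) x)"
  have "(\<integral>\<^sup>+x. (\<Sum>k. ennreal (2^k * (?d k x)\<^sup>2)) \<partial>M) = (\<Sum>k. \<integral>\<^sup>+x. ennreal (2^k * (?d k x)\<^sup>2) \<partial>M)"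
    by (rule nn_integral_suminf) measurable
  also have "\<dots> \<le> (\<Sum>k. ennreal ((1/2)^k))"
  proof (rule suminf_le)
    fix k
    have "(\<integral>\<^sup>+x. ennreal (2^k * (?d k x)\<^sup>2) \<partial>M) = ennreal (2^k) * (\<integral>\<^sup>+x. ennreal ((?d k x)\<^sup>2) \<partial>M)"
      by (simp add: ennreal_mult nn_integral_cmult)
    also have "\<dots> \<le> ennreal (2^k) * ennreal ((1/4)^k)"
      unfolding nn using N[OF r_ge(2) r_ge(1), of k] by (intro mult_left_mono ennreal_leI) auto
    also have "\<dots> = ennreal ((1/2)^k)"
    proof -
      have "2^k * (1/4)^k = ((1/2)::real)^k" unfolding power_mult_distrib[symmetric] by simp
      then show ?thesis by (simp add: ennreal_mult[symmetric])
    qed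
    finally show "(\<integral>\<^sup>+x. ennreal (2^k * (?d k x)\<^sup>2) \<partial>M) \<le> ennreal ((1/2)^k)" .
  qed auto
  also have "\<dots> < \<infinity>"
    using summable_geometric[of "1/2::real"] by (subst suminf_ennreal2) auto
  finally have "AE x in M. (\<Sum>k. ennreal (2^k * (?d k x)\<^sup>2)) \<noteq> \<infinity>"
    by (intro nn_integral_PInf_AE) auto
  then have conv: "AE x in M. convergent (\<lambda>k. f (r k) x)"
  proof eventually_elim
    case (elim x)
    define a where "a k = ennreal (2^k * (?d k x)\<^sup>2)" for k
    define S where "S = (\<Sum>k. a k)"
    have "S \<noteq> \<infinity>" using elim unfolding S_def a_def .
    then obtain C where C: "S = ennreal C" "C \<ge> 0" by (cases S) auto
    have bound: "?d k x \<le> sqrt C * (sqrt (1/2))^k" for k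
    proof -
      have "a k \<le> S"
        unfolding S_def using sum_le_suminf[of a "{k}"] by simp
      then have "2^k * (?d k x)\<^sup>2 \<le> C" using C by (simp add: a_def)
      then have "(?d k x)\<^sup>2 \<le> C * (1/2)^k" by (simp add: power_one_over field_simps)
      then have "sqrt ((?d k x)\<^sup>2) \<le> sqrt (C * (1/2)^k)" by (rule real_sqrt_le_mono)
      then show ?thesis by (simp add: real_sqrt_mult real_sqrt_power)
    qed
    have "summable (\<lambda>k. sqrt C * (sqrt (1/2))^k)"
      by (intro summable_mult summable_geometric) simp
    then have "summable (\<lambda>k. f (r (Suc k)) x - f (r k) x)"
      by (rule summable_comparison_test'[where N=0]) (use bound in auto)
    then have "convergent (\<lambda>n. \<Sum>k<n. f (r (Suc k)) x - f (r k) x)"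
      by (simp add: summable_iff_convergent)
    then have "convergent (\<lambda>n. f (r n) x - f (r 0) x)"
      by (simp add: sum_lessThan_telescope[of "\<lambda>k. f (r k) x"])
    from convergent_add[OF this convergent_const[of "f (r 0) x"]]
    show ?case by simp
  qed
  define h where "h x = lim (\<lambda>k. f (r k) x)" for x
  have [measurable]: "h \<in> borel_measurable M" unfolding h_def by measurable
  have key: "(\<integral>\<^sup>+x. ennreal ((norm (f n x - h x))\<^sup>2) \<partial>M) \<le> ennreal \<epsilon>"
    if n: "\<forall>m\<ge>L. (LINT x|M. (norm (f n x - f m x))\<^sup>2) < \<epsilon>" for n L \<epsilon>
  proof -
    have "(\<integral>\<^sup>+x. ennreal ((norm (f n x - h x))\<^sup>2) \<partial>M)
        = (\<integral>\<^sup>+x. liminf (\<lambda>k. ennreal ((norm (f n x - f (r k) x))\<^sup>2)) \<partial>M)"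
    proof (rule nn_integral_cong_AE, use conv in eventually_elim)
      fix x assume "convergent (\<lambda>k. f (r k) x)"
      then have "(\<lambda>k. f (r k) x) \<longlonglongrightarrow> h x" by (simp add: h_def convergent_LIMSEQ_iff)
      then have "(\<lambda>k. ennreal ((norm (f n x - f (r k) x))\<^sup>2)) \<longlonglongrightarrow> ennreal ((norm (f n x - h x))\<^sup>2)"
        by (intro tendsto_intros)
      from lim_imp_Liminf[OF _ this]
      show "ennreal ((norm (f n x - h x))\<^sup>2) = liminf (\<lambda>k. ennreal ((norm (f n x - f (r k) x))\<^sup>2))"
        by simp
    qed
    also have "\<dots> \<le> liminf (\<lambda>k. \<integral>\<^sup>+x. ennreal ((norm (f n x - f (r k) x))\<^sup>2) \<partial>M)"
      by (rule nn_integral_liminf) measurable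
    also have "\<dots> \<le> ennreal \<epsilon>"
    proof (rule Liminf_le)
      have "\<forall>\<^sub>F k in sequentially. r k \<ge> L" using r_top by (simp add: filterlim_at_top)
      then show "\<forall>\<^sub>F k in sequentially. (\<integral>\<^sup>+x. ennreal ((norm (f n x - f (r k) x))\<^sup>2) \<partial>M) \<le> ennreal \<epsilon>"
        by eventually_elim (use n in \<open>auto simp only: nn intro!: ennreal_leI less_imp_le[of "LINT x|M. _ x" \<epsilon>]\<close>)
    qed simp
    finally show ?thesis .
  qed
  have ex: "\<exists>N. \<forall>n\<ge>N. (\<integral>\<^sup>+x. ennreal ((norm (f n x - h x))\<^sup>2) \<partial>M) \<le> ennreal \<epsilon>" if "\<epsilon> > 0" for \<epsilon>
    using Cauchy[OF that] key by meson
  obtain N1 where "(\<integral>\<^sup>+x. ennreal ((norm (f N1 x - h x))\<^sup>2) \<partial>M) \<le> ennreal 1"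
    using ex[of 1] by auto
  then have "(\<lambda>x. f N1 x - h x) \<in> L2 M"
    by (intro L2_I_nn) (auto intro: le_less_trans)
  from L2_diff[OF f[of N1] this] have h: "h \<in> L2 M" by simp
  have "(\<lambda>n. LINT x|M. (norm (f n x - h x))\<^sup>2) \<longlonglongrightarrow> 0"
  proof (rule LIMSEQ_I)
    fix \<epsilon> :: real assume "\<epsilon> > 0"
    then obtain N where N: "\<forall>n\<ge>N. (\<integral>\<^sup>+x. ennreal ((norm (f n x - h x))\<^sup>2) \<partial>M) \<le> ennreal (\<epsilon>/2)"
      using ex[of "\<epsilon>/2"] by auto
    have "(LINT x|M. (norm (f n x - h x))\<^sup>2) \<le> \<epsilon>/2" if "n \<ge> N" for n
    proof -
      have "ennreal (LINT x|M. (norm (f n x - h x))\<^sup>2) \<le> ennreal (\<epsilon>/2)"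
        using N that L2_nn_integral[OF L2_diff[OF f[of n] h]] by metis
      then show ?thesis using \<open>\<epsilon> > 0\<close> by (subst (asm) ennreal_le_iff) auto
    qed
    then show "\<exists>N. \<forall>n\<ge>N. norm ((LINT x|M. (norm (f n x - h x))\<^sup>2) - 0) < \<epsilon>"
      using \<open>\<epsilon> > 0\<close> by (intro exI[of _ N]) (fastforce intro: le_less_trans[of _ "\<epsilon>/2"])
  qed
  with h that show ?thesis by blast
qed

section \<open>Mollification\<close>

lemma nn_integral_lborel_shift:
  fixes f :: "'a::euclidean_space \<Rightarrow> ennreal"
  assumes [measurable]: "f \<in> borel_measurable borel"
  shows "(\<integral>\<^sup>+x. f (x + z) \<partial>lborel) = (\<integral>\<^sup>+x. f x \<partial>lborel)"
proof -
  have "(\<integral>\<^sup>+x. f x \<partial>lborel) = (\<integral>\<^sup>+x. f x \<partial>distr lborel borel ((+) z))"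
    by (simp add: lborel_distr_plus)
  also have "\<dots> = (\<integral>\<^sup>+x. f (z + x) \<partial>lborel)"
    by (rule nn_integral_distr) auto
  finally show ?thesis by (simp add: add.commute)
qed

lemma integral_lborel_shift:
  fixes f :: "'a::euclidean_space \<Rightarrow> real"
  assumes f: "integrable lborel f"
  shows "integrable lborel (\<lambda>x. f (x + z))" "(LINT x|lborel. f (x + z)) = (LINT x|lborel. f x)"
proof -
  have [measurable]: "f \<in> borel_measurable borel" using f by auto
  show "integrable lborel (\<lambda>x. f (x + z))"
    using f integrable_distr_eq[of "(+) z" lborel borel f] by (simp add: lborel_distr_plus add.commute)
  show "(LINT x|lborel. f (x + z)) = (LINT x|lborel. f x)"
    using integral_distr[of "(+) z" lborel borel f] by (simp add: lborel_distr_plus add.commute)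
qed

text \<open>Continuity at zero of the translations, as a map into \<open>L1\<close>. It is established for indicators of open
  sets, then of Borel sets by outer regularity, then for all integrable functions by approximation.\<close>

definition translation_continuous :: "('a::euclidean_space \<Rightarrow> real) \<Rightarrow> bool"
  where "translation_continuous f \<longleftrightarrow> ((\<lambda>z. LINT x|lborel. \<bar>f (x + z) - f x\<bar>) \<longlongrightarrow> 0) (at 0)"

lemma translation_continuous_approx:
  fixes f :: "'a::euclidean_space \<Rightarrow> real"
  assumes f: "integrable lborel f"
    and appr: "\<And>\<epsilon>. \<epsilon> > 0 \<Longrightarrow> \<exists>g. integrable lborel g \<and> translation_continuous g \<and> (LINT x|lborel. \<bar>f x - g x\<bar>) < \<epsilon>"
  shows "translation_continuous f"
  unfolding translation_continuous_def
proof (rule tendstoI)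
  fix \<epsilon> :: real assume "\<epsilon> > 0"
  then obtain g where g: "integrable lborel g" "translation_continuous g" "(LINT x|lborel. \<bar>f x - g x\<bar>) < \<epsilon>/3"
    using appr[of "\<epsilon>/3"] by auto
  have "\<forall>\<^sub>F z in at 0. dist (LINT x|lborel. \<bar>g (x + z) - g x\<bar>) 0 < \<epsilon>/3"
    using g(2) \<open>\<epsilon> > 0\<close> unfolding translation_continuous_def by (intro tendstoD) auto
  then show "\<forall>\<^sub>F z in at 0. dist (LINT x|lborel. \<bar>f (x + z) - f x\<bar>) 0 < \<epsilon>"
  proof eventually_elim
    case (elim z)
    note sf = integral_lborel_shift(1)[OF f, of z]
    note sg = integral_lborel_shift(1)[OF g(1), of z]
    have d: "integrable lborel (\<lambda>x. \<bar>f x - g x\<bar>)" using f g(1) by auto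
    note sd = integral_lborel_shift[OF d, of z]
    have "(LINT x|lborel. \<bar>f (x + z) - f x\<bar>)
        \<le> (LINT x|lborel. \<bar>f (x + z) - g (x + z)\<bar> + \<bar>g (x + z) - g x\<bar> + \<bar>f x - g x\<bar>)"
      using sf sg f g(1) by (intro integral_mono) auto
    also have "\<dots> = (LINT x|lborel. \<bar>f x - g x\<bar>) + (LINT x|lborel. \<bar>g (x + z) - g x\<bar>) + (LINT x|lborel. \<bar>f x - g x\<bar>)"
      using sf sg f g(1) sd d by simp
    finally have "(LINT x|lborel. \<bar>f (x + z) - f x\<bar>) < \<epsilon>" using elim g(3) by simp
    moreover have "0 \<le> (LINT x|lborel. \<bar>f (x + z) - f x\<bar>)" by simp
    ultimately show ?case by simp
  qed
qed

lemma translation_continuous_lincomb: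
  fixes f g :: "'a::euclidean_space \<Rightarrow> real"
  assumes "integrable lborel f" "integrable lborel g" "translation_continuous f" "translation_continuous g"
  shows "translation_continuous (\<lambda>x. c * f x + d * g x)"
  unfolding translation_continuous_def
proof (rule Lim_null_comparison)
  have "((\<lambda>z. \<bar>c\<bar> * (LINT x|lborel. \<bar>f (x + z) - f x\<bar>) + \<bar>d\<bar> * (LINT x|lborel. \<bar>g (x + z) - g x\<bar>)) \<longlongrightarrow> \<bar>c\<bar> * 0 + \<bar>d\<bar> * 0) (at 0)"
    using assms(3,4) unfolding translation_continuous_def by (intro tendsto_intros)
  then show "((\<lambda>z. \<bar>c\<bar> * (LINT x|lborel. \<bar>f (x + z) - f x\<bar>) + \<bar>d\<bar> * (LINT x|lborel. \<bar>g (x + z) - g x\<bar>)) \<longlongrightarrow> 0) (at 0)"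
    by simp
  have "norm (LINT x|lborel. \<bar>c * f (x + z) + d * g (x + z) - (c * f x + d * g x)\<bar>)
      \<le> \<bar>c\<bar> * (LINT x|lborel. \<bar>f (x + z) - f x\<bar>) + \<bar>d\<bar> * (LINT x|lborel. \<bar>g (x + z) - g x\<bar>)" for z
  proof -
    note sf = integral_lborel_shift(1)[OF assms(1), of z]
    note sg = integral_lborel_shift(1)[OF assms(2), of z]
    have "(LINT x|lborel. \<bar>c * f (x + z) + d * g (x + z) - (c * f x + d * g x)\<bar>)
        \<le> (LINT x|lborel. \<bar>c\<bar> * \<bar>f (x + z) - f x\<bar> + \<bar>d\<bar> * \<bar>g (x + z) - g x\<bar>)"
    proof (intro integral_mono)
      fix x
      have "c * f (x + z) + d * g (x + z) - (c * f x + d * g x) = c * (f (x + z) - f x) + d * (g (x + z) - g x)"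
        by (simp add: algebra_simps)
      then show "\<bar>c * f (x + z) + d * g (x + z) - (c * f x + d * g x)\<bar> \<le> \<bar>c\<bar> * \<bar>f (x + z) - f x\<bar> + \<bar>d\<bar> * \<bar>g (x + z) - g x\<bar>"
        using abs_triangle_ineq[of "c * (f (x + z) - f x)" "d * (g (x + z) - g x)"] by (simp add: abs_mult)
    qed (use sf sg assms in auto)
    also have "\<dots> = \<bar>c\<bar> * (LINT x|lborel. \<bar>f (x + z) - f x\<bar>) + \<bar>d\<bar> * (LINT x|lborel. \<bar>g (x + z) - g x\<bar>)"
      using sf sg assms by simp
    finally show ?thesis by simp
  qed
  then show "\<forall>\<^sub>F z in at 0. norm (LINT x|lborel. \<bar>c * f (x + z) + d * g (x + z) - (c * f x + d * g x)\<bar>)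
      \<le> \<bar>c\<bar> * (LINT x|lborel. \<bar>f (x + z) - f x\<bar>) + \<bar>d\<bar> * (LINT x|lborel. \<bar>g (x + z) - g x\<bar>)" by simp
qed

text \<open>The \<open>L1\<close> distance of the indicator of \<open>U\<close> from its translate is \<open>2 |U| - 2 |U \<inter> (U - z)|\<close>. As \<open>U\<close> is
  open, a point of \<open>U\<close> stays in \<open>U\<close> under small translations.\<close>

lemma translation_continuous_open:
  fixes U :: "'a::euclidean_space set"
  assumes U: "open U" "emeasure lborel U < \<infinity>"
  shows "translation_continuous (indicator U)"
  unfolding translation_continuous_def
proof (subst tendsto_at_iff_sequentially, intro allI impI, unfold o_def)
  fix z :: "nat \<Rightarrow> 'a" assume "\<forall>i. z i \<in> UNIV - {0}" and z: "z \<longlonglongrightarrow> 0"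
  have [measurable]: "U \<in> sets borel" using U by auto
  have int: "integrable lborel (indicator U :: 'a \<Rightarrow> real)" using U by auto
  note sh = integral_lborel_shift[OF int]
  have int2: "integrable lborel (\<lambda>x. indicator U x * indicator U (x + z n) :: real)" for n
    by (rule Bochner_Integration.integrable_bound[OF int]) (auto simp: indicator_def)
  have "(\<lambda>n. LINT x|lborel. indicator U x * indicator U (x + z n)) \<longlonglongrightarrow> (LINT x|lborel. indicator U x :: real)"
  proof (rule integral_dominated_convergence[where w="indicator U"])
    show "AE x in lborel. (\<lambda>n. indicator U x * indicator U (x + z n)) \<longlonglongrightarrow> (indicator U x :: real)"
    proof (rule AE_I2)
      fix x
      show "(\<lambda>n. indicator U x * indicator U (x + z n)) \<longlonglongrightarrow> (indicator U x :: real)"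
      proof (cases "x \<in> U")
        case True
        have "(\<lambda>n. x + z n) \<longlonglongrightarrow> x" using tendsto_add[OF tendsto_const z, of x] by simp
        then have "\<forall>\<^sub>F n in sequentially. x + z n \<in> U"
          using topological_tendstoD U(1) True by blast
        then show ?thesis
          by (intro tendsto_eventually) (auto elim!: eventually_mono simp: True)
      qed simp
    qed
  qed (use int in \<open>auto simp: indicator_def\<close>)
  then have "(\<lambda>n. 2 * (LINT x|lborel. indicator U x) - 2 * (LINT x|lborel. indicator U x * indicator U (x + z n)))
    \<longlonglongrightarrow> 2 * (LINT x|lborel. indicator U x) - 2 * (LINT x|lborel. indicator U x :: real)"
    by (intro tendsto_intros)
  moreover have "(LINT x|lborel. \<bar>indicator U (x + z n) - indicator U x :: real\<bar>)
    = 2 * (LINT x|lborel. indicator U x) - 2 * (LINT x|lborel. indicator U x * indicator U (x + z n))" for n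
  proof -
    have "(LINT x|lborel. \<bar>indicator U (x + z n) - indicator U x :: real\<bar>)
      = (LINT x|lborel. indicator U (x + z n) + indicator U x - 2 * (indicator U x * indicator U (x + z n)))"
      by (intro Bochner_Integration.integral_cong) (auto simp: indicator_def)
    also have "\<dots> = 2 * (LINT x|lborel. indicator U x) - 2 * (LINT x|lborel. indicator U x * indicator U (x + z n))"
      using sh int int2 by simp
    finally show ?thesis .
  qed
  ultimately show "(\<lambda>n. LINT x|lborel. \<bar>indicator U (x + z n) - indicator U x :: real\<bar>) \<longlonglongrightarrow> 0"
    by simp
qed

lemma translation_continuous_indicator:
  fixes A :: "'a::euclidean_space set"
  assumes A: "A \<in> sets lborel" "emeasure lborel A < \<infinity>"
  shows "translation_continuous (indicator A)"
proof (rule translation_continuous_approx)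
  show intA: "integrable lborel (indicator A :: 'a \<Rightarrow> real)" using A by auto
  fix \<epsilon> :: real assume "\<epsilon> > 0"
  then obtain U where U: "open U" "A \<subseteq> U" "emeasure lborel (U - A) < \<epsilon>"
    using outer_regular_lborel[of A \<epsilon>] A by auto
  have "emeasure lborel U = emeasure lborel A + emeasure lborel (U - A)"
    using plus_emeasure[of A lborel "U - A"] A U by (simp add: Un_absorb1 Int_Diff)
  also have "\<dots> < \<infinity>" using A U(3) by (auto simp: less_top intro: order.strict_trans)
  finally have fin: "emeasure lborel U < \<infinity>" .
  have intU: "integrable lborel (indicator U :: 'a \<Rightarrow> real)" using U fin by auto
  have "(LINT x|lborel. \<bar>indicator A x - indicator U x :: real\<bar>) = (LINT x|lborel. indicator (U - A) x)"
    using U(2) by (intro Bochner_Integration.integral_cong) (auto simp: indicator_def)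
  also have "\<dots> = measure lborel (U - A)" using A U(1) by simp
  also have "\<dots> < \<epsilon>"
  proof -
    have "emeasure lborel (U - A) = ennreal (measure lborel (U - A))"
      using U(3) by (intro emeasure_eq_ennreal_measure) (auto dest: order.strict_trans2)
    then show ?thesis using U(3) by (simp add: ennreal_less_iff)
  qed
  finally show "\<exists>g. integrable lborel g \<and> translation_continuous g \<and> (LINT x|lborel. \<bar>indicator A x - g x\<bar>) < \<epsilon>"
    using intU translation_continuous_open[OF U(1) fin] by blast
qed

lemma integrable_translation_continuous:
  fixes f :: "'a::euclidean_space \<Rightarrow> real"
  assumes "integrable lborel f"
  shows "translation_continuous f"
  using assms
proof (induction rule: integrable_induct)
  case (base A c)
  then have "integrable lborel (indicator A :: 'a \<Rightarrow> real)" by auto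
  then show ?case
    using translation_continuous_lincomb[of "indicator A" "indicator A" c 0] translation_continuous_indicator[OF base]
    by (simp add: mult.commute)
next
  case (add f g)
  then show ?case using translation_continuous_lincomb[of f g 1 1] by simp
next
  case (lim f s)
  show ?case
  proof (rule translation_continuous_approx[OF lim.hyps(4)])
    fix \<epsilon> :: real assume "\<epsilon> > 0"
    have [measurable]: "f \<in> borel_measurable lborel" using lim.hyps(4) by auto
    have "\<And>i. s i \<in> borel_measurable lborel" using lim.hyps(1) by auto
    note [measurable] = this
    have "(\<lambda>i. LINT x|lborel. \<bar>f x - s i x\<bar>) \<longlonglongrightarrow> (LINT x::'a|lborel. 0)"
    proof (rule integral_dominated_convergence[where w="\<lambda>x. 3 * norm (f x)"])
      show "AE x in lborel. (\<lambda>i. \<bar>f x - s i x\<bar>) \<longlonglongrightarrow> 0"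
      proof (rule AE_I2)
        fix x
        have "(\<lambda>i. \<bar>f x - s i x\<bar>) \<longlonglongrightarrow> \<bar>f x - f x\<bar>"
          by (intro tendsto_intros lim.hyps(2)) auto
        then show "(\<lambda>i. \<bar>f x - s i x\<bar>) \<longlonglongrightarrow> 0" by simp
      qed
      show "AE x in lborel. norm \<bar>f x - s i x\<bar> \<le> 3 * norm (f x)" for i
      proof (rule AE_I2)
        fix x show "norm \<bar>f x - s i x\<bar> \<le> 3 * norm (f x)" using lim.hyps(3)[of x i] abs_triangle_ineq4[of "f x" "s i x"] by simp
      qed
    qed (use lim.hyps(4) in auto)
    then have "(\<lambda>i. LINT x|lborel. \<bar>f x - s i x\<bar>) \<longlonglongrightarrow> 0" by simp
    from order_tendstoD(2)[OF this \<open>\<epsilon> > 0\<close>] obtain i where "(LINT x|lborel. \<bar>f x - s i x\<bar>) < \<epsilon>"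
      by (auto simp: eventually_sequentially)
    then show "\<exists>g. integrable lborel g \<and> translation_continuous g \<and> (LINT x|lborel. \<bar>f x - g x\<bar>) < \<epsilon>"
      using lim.hyps(1) lim.IH by blast
  qed
qed

lemma square_diff_le_signed_squares: "(a - b)\<^sup>2 \<le> 2 * \<bar>a * \<bar>a\<bar> - b * \<bar>b\<bar>\<bar>" for a b :: real
proof -
  have *: "(a - b)\<^sup>2 \<le> 2 * \<bar>a * \<bar>a\<bar> - b * \<bar>b\<bar>\<bar>" if "a \<ge> b" for a b :: real
  proof -
    consider "b \<ge> 0" | "a \<le> 0" | "a > 0" "b < 0" by linarith
    then show ?thesis
    proof cases
      case 1
      have "(a - b) * (a - b) \<le> (a - b) * (a + b)" by (rule mult_left_mono) (use 1 that in auto)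
      then show ?thesis using 1 that mult_mono[of b a b a]
        by (simp add: power2_eq_square algebra_simps)
    next
      case 2
      have "(a - b) * (a - b) \<le> (a - b) * (- a - b)" by (rule mult_left_mono) (use 2 that in auto)
      then show ?thesis using 2 that mult_mono[of "-a" "-b" "-a" "-b"]
        by (simp add: power2_eq_square algebra_simps)
    next
      case 3
      have "0 \<le> (a + b)\<^sup>2" by simp
      then show ?thesis using 3 by (simp add: power2_eq_square algebra_simps)
    qed
  qed
  show ?thesis
  proof (cases "a \<ge> b")
    case False
    then show ?thesis
      using *[of a b] False unfolding power2_commute[of a b] abs_minus_commute[of "a * \<bar>a\<bar>"] by linarith
  qed (rule *)
qed

text \<open>The function \<open>V |V|\<close> is integrable, and its increments dominate the squared increments of \<open>V\<close>.\<close>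

lemma L2_translation_continuous:
  fixes V :: "'a::euclidean_space \<Rightarrow> real"
  assumes V: "V \<in> L2 lborel" and "\<epsilon> > 0"
  obtains \<delta> where "\<delta> > 0" "\<And>z. norm z < \<delta> \<Longrightarrow> (\<integral>\<^sup>+x. ennreal ((V (x + z) - V x)\<^sup>2) \<partial>lborel) \<le> ennreal \<epsilon>"
proof -
  have [measurable]: "V \<in> borel_measurable borel" using V by (auto simp: L2_def)
  let ?W = "\<lambda>x. V x * \<bar>V x\<bar>"
  have W: "integrable lborel ?W"
    by (rule Bochner_Integration.integrable_bound[OF L2_integrable[OF V]])
      (auto simp: power2_eq_square abs_mult)
  have "((\<lambda>z. LINT x|lborel. \<bar>?W (x + z) - ?W x\<bar>) \<longlongrightarrow> 0) (at 0)"
    using integrable_translation_continuous[OF W] by (simp add: translation_continuous_def)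
  then have "\<forall>\<^sub>F z in at 0. (LINT x|lborel. \<bar>?W (x + z) - ?W x\<bar>) < \<epsilon>/2"
    using \<open>\<epsilon> > 0\<close> by (intro order_tendstoD) auto
  then obtain \<delta> where \<delta>: "\<delta> > 0" "\<And>z. z \<noteq> 0 \<Longrightarrow> norm z < \<delta> \<Longrightarrow> (LINT x|lborel. \<bar>?W (x + z) - ?W x\<bar>) < \<epsilon>/2"
    by (auto simp: eventually_at dist_norm)
  have "(\<integral>\<^sup>+x. ennreal ((V (x + z) - V x)\<^sup>2) \<partial>lborel) \<le> ennreal \<epsilon>" if "norm z < \<delta>" for z
  proof (cases "z = 0")
    case False
    have int: "integrable lborel (\<lambda>x. 2 * \<bar>?W (x + z) - ?W x\<bar>)"
      using W integral_lborel_shift(1)[OF W, of z] by auto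
    have "(\<integral>\<^sup>+x. ennreal ((V (x + z) - V x)\<^sup>2) \<partial>lborel) \<le> (\<integral>\<^sup>+x. ennreal (2 * \<bar>?W (x + z) - ?W x\<bar>) \<partial>lborel)"
      by (intro nn_integral_mono ennreal_leI square_diff_le_signed_squares)
    also have "\<dots> = ennreal (LINT x|lborel. 2 * \<bar>?W (x + z) - ?W x\<bar>)"
      by (rule nn_integral_eq_integral[OF int]) auto
    also have "\<dots> \<le> ennreal \<epsilon>"
      using \<delta>(2)[OF False that] by (intro ennreal_leI) simp
    finally show ?thesis .
  qed simp
  with \<delta>(1) that show ?thesis by blast
qed

text \<open>The sign of the argument of \<open>k\<close> is such that a kernel with support near \<open>c\<close> averages \<open>V\<close> near
  \<open>x + c\<close>.\<close>

definition conv :: "('a::euclidean_space \<Rightarrow> real) \<Rightarrow> ('a \<Rightarrow> real) \<Rightarrow> 'a \<Rightarrow> real"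
  where "conv k V x = (LINT y|lborel. k (y - x) * V y)"

lemma conv_alt:
  assumes [measurable]: "k \<in> borel_measurable borel" "V \<in> borel_measurable borel"
  shows "conv k V x = (LINT z|lborel. k z * V (x + z))"
proof -
  have "(LINT y|lborel. k (y - x) * V y) = (LINT y|distr lborel borel ((+) x). k (y - x) * V y)"
    by (simp add: lborel_distr_plus)
  also have "\<dots> = (LINT z|lborel. k (x + z - x) * V (x + z))"
    by (rule integral_distr) auto
  finally show ?thesis by (simp add: conv_def)
qed

lemma conv_measurable [measurable]:
  assumes [measurable]: "k \<in> borel_measurable borel" "V \<in> borel_measurable borel"
  shows "conv k V \<in> borel_measurable borel"
  unfolding conv_def[abs_def] by measurable

text \<open>By the Cauchy-Schwarz inequality, the mean value of \<open>V\<close> with respect to the probability density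
  \<open>k\<close> deviates from \<open>V\<close> in the square mean no more than the translates of \<open>V\<close> along the support of
  \<open>k\<close> do.\<close>

lemma conv_approximates:
  assumes V: "V \<in> L2 lborel" and k: "k \<in> L2 lborel" "\<And>z. k z \<ge> 0" "(\<integral>\<^sup>+z. ennreal (k z) \<partial>lborel) = 1"
    and close: "\<And>z. k z \<noteq> 0 \<Longrightarrow> (\<integral>\<^sup>+x. ennreal ((V (x + z) - V x)\<^sup>2) \<partial>lborel) \<le> \<epsilon>"
  shows "(\<integral>\<^sup>+x. ennreal ((conv k V x - V x)\<^sup>2) \<partial>lborel) \<le> \<epsilon>"
proof -
  have Vm [measurable]: "V \<in> borel_measurable borel" using V by (auto simp: L2_def)
  have km [measurable]: "k \<in> borel_measurable borel" using k by (auto simp: L2_def)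
  have intk: "integrable lborel k" "(LINT z|lborel. k z) = 1"
  proof -
    show "integrable lborel k" using k by (intro integrableI_nonneg) auto
    show "(LINT z|lborel. k z) = 1" using k by (simp add: integral_eq_nn_integral)
  qed
  have pt: "ennreal ((conv k V x - V x)\<^sup>2) \<le> (\<integral>\<^sup>+z. ennreal (k z * (V (x + z) - V x)\<^sup>2) \<partial>lborel)" for x
  proof -
    have "(\<lambda>z. V (x + z)) \<in> L2 lborel"
    proof -
      have "integrable lborel (\<lambda>z. (norm (V (z + x)))\<^sup>2)"
        using integral_lborel_shift(1)[OF L2_integrable[OF V], of x] .
      then show ?thesis by (simp add: L2_def add.commute)
    qed
    then have i1: "integrable lborel (\<lambda>z. k z * V (x + z))"
      using L2_mult_integrable k(1) by blast
    have i2: "integrable lborel (\<lambda>z. k z * (V (x + z) - V x))"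
      using i1 intk(1) by (simp add: right_diff_distrib)
    have "conv k V x - V x = (LINT z|lborel. k z * (V (x + z) - V x))"
      using i1 intk by (simp add: conv_alt right_diff_distrib)
    then have "ennreal \<bar>conv k V x - V x\<bar> \<le> (\<integral>\<^sup>+z. ennreal (norm (k z * (V (x + z) - V x))) \<partial>lborel)"
      using integral_norm_bound_ennreal[OF i2] by simp
    also have "\<dots> = (\<integral>\<^sup>+z. ennreal (sqrt (k z)) * ennreal (sqrt (k z) * \<bar>V (x + z) - V x\<bar>) \<partial>lborel)"
      using k(2) by (intro nn_integral_cong) (simp add: ennreal_mult[symmetric] abs_mult mult.assoc[symmetric])
    finally have "(ennreal \<bar>conv k V x - V x\<bar>)\<^sup>2 \<le> \<dots>\<^sup>2" by (intro power_mono) auto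
    also have "\<dots> \<le> (\<integral>\<^sup>+z. (ennreal (sqrt (k z)))\<^sup>2 \<partial>lborel) * (\<integral>\<^sup>+z. (ennreal (sqrt (k z) * \<bar>V (x + z) - V x\<bar>))\<^sup>2 \<partial>lborel)"
      by (rule Cauchy_Schwarz_nn_integral) measurable
    also have "\<dots> = (\<integral>\<^sup>+z. ennreal (k z * (V (x + z) - V x)\<^sup>2) \<partial>lborel)"
      using k by (simp add: ennreal_power power_mult_distrib)
    finally show ?thesis by (simp add: ennreal_power)
  qed
  have "(\<integral>\<^sup>+x. ennreal ((conv k V x - V x)\<^sup>2) \<partial>lborel)
      \<le> (\<integral>\<^sup>+x. \<integral>\<^sup>+z. ennreal (k z * (V (x + z) - V x)\<^sup>2) \<partial>lborel \<partial>lborel)"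
    by (intro nn_integral_mono pt)
  also have "\<dots> = (\<integral>\<^sup>+z. \<integral>\<^sup>+x. ennreal (k z * (V (x + z) - V x)\<^sup>2) \<partial>lborel \<partial>lborel)"
    by (rule lborel_pair.Fubini') measurable
  also have "\<dots> = (\<integral>\<^sup>+z. ennreal (k z) * (\<integral>\<^sup>+x. ennreal ((V (x + z) - V x)\<^sup>2) \<partial>lborel) \<partial>lborel)"
    using k(2) by (simp add: ennreal_mult nn_integral_cmult)
  also have "\<dots> \<le> (\<integral>\<^sup>+z. ennreal (k z) * \<epsilon> \<partial>lborel)"
  proof (rule nn_integral_mono)
    fix z show "ennreal (k z) * (\<integral>\<^sup>+x. ennreal ((V (x + z) - V x)\<^sup>2) \<partial>lborel) \<le> ennreal (k z) * \<epsilon>"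
      using close[of z] by (cases "k z = 0") (auto intro: mult_left_mono)
  qed
  also have "\<dots> = \<epsilon>" using k(3) by (simp add: nn_integral_multc)
  finally show ?thesis .
qed

lemma test_function_D:
  assumes "\<phi> \<in> test_functions \<Omega>"
  shows "smooth \<phi>" "\<phi> \<in> test_functions UNIV" "x \<notin> \<Omega> \<Longrightarrow> \<phi> x = 0"
proof -
  show "smooth \<phi>" "\<phi> \<in> test_functions UNIV" using assms by (auto simp: test_functions_def)
  show "\<phi> x = 0" if "x \<notin> \<Omega>"
    using assms that closure_subset[of "{x. \<phi> x \<noteq> 0}"] by (auto simp: test_functions_def)
qed

lemma test_functions_smaller_support:
  assumes "\<phi> \<in> test_functions \<Omega>" "smooth \<psi>" "\<And>x. x \<notin> closure {x. \<phi> x \<noteq> 0} \<Longrightarrow> \<psi> x = 0"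
  shows "\<psi> \<in> test_functions \<Omega>"
proof -
  have sub: "closure {x. \<psi> x \<noteq> 0} \<subseteq> closure {x. \<phi> x \<noteq> 0}"
    using assms(3) by (intro closure_minimal) auto
  have "compact (closure {x. \<psi> x \<noteq> 0})"
    using compact_Int_closed[of "closure {x. \<phi> x \<noteq> 0}" "closure {x. \<psi> x \<noteq> 0}"] assms(1) sub
    by (simp add: test_functions_def Int_absorb1)
  then show ?thesis using assms(1,2) sub by (auto simp: test_functions_def)
qed

lemma test_functions_partial:
  assumes "\<phi> \<in> test_functions \<Omega>" "i \<in> Basis" shows "partial \<phi> i \<in> test_functions \<Omega>"
  using test_functions_smaller_support[OF assms(1) smooth_partial[OF test_function_D(1)[OF assms(1)] assms(2)]]
    partial_zero_outside by blast

lemma test_functions_mult: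
  assumes "\<phi> \<in> test_functions \<Omega>" "smooth \<beta>" shows "(\<lambda>x. \<beta> x * \<phi> x) \<in> test_functions \<Omega>"
proof (rule test_functions_smaller_support[OF assms(1)])
  show "smooth (\<lambda>x. \<beta> x * \<phi> x)" using assms test_function_D by (intro smooth_mult) auto
  show "\<beta> x * \<phi> x = 0" if "x \<notin> closure {x. \<phi> x \<noteq> 0}" for x
    using that closure_subset[of "{x. \<phi> x \<noteq> 0}"] by auto
qed

lemma smooth_measurable: "smooth \<phi> \<Longrightarrow> \<phi> \<in> borel_measurable borel"
  by (intro borel_measurable_continuous_onI smooth_continuous)

lemma test_function_support_bounded:
  assumes "\<phi> \<in> test_functions \<Omega>"
  obtains R where "R > 0" "\<And>x. norm x \<ge> R \<Longrightarrow> \<phi> x = 0"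
proof -
  have "bounded (closure {x. \<phi> x \<noteq> 0})"
    using assms by (auto simp: test_functions_def compact_imp_bounded)
  then obtain R where R: "\<And>x. x \<in> closure {x. \<phi> x \<noteq> 0} \<Longrightarrow> norm x \<le> R"
    by (auto simp: bounded_iff)
  have "\<phi> x = 0" if "norm x \<ge> \<bar>R\<bar> + 1" for x
    using R[of x] that closure_subset[of "{x. \<phi> x \<noteq> 0}"] by force
  then show ?thesis using that[of "\<bar>R\<bar> + 1"] by auto
qed

lemma test_function_bounded:
  assumes "\<phi> \<in> test_functions \<Omega>"
  obtains C where "C > 0" "\<And>x. \<bar>\<phi> x\<bar> \<le> C"
proof -
  obtain R where R: "\<And>x. norm x \<ge> R \<Longrightarrow> \<phi> x = 0" using test_function_support_bounded[OF assms] by auto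
  have "bounded (\<phi> ` cball 0 R)"
    by (intro compact_imp_bounded compact_continuous_image smooth_continuous test_function_D(1)[OF assms] compact_cball)
  then obtain C where C: "C > 0" "\<And>x. x \<in> cball 0 R \<Longrightarrow> \<bar>\<phi> x\<bar> \<le> C"
    unfolding bounded_pos by auto
  have "\<bar>\<phi> x\<bar> \<le> C" for x
    using C R[of x] by (cases "norm x \<le> R") auto
  with C(1) that show ?thesis by blast
qed

lemma test_function_cgrad_bounded:
  assumes "\<phi> \<in> test_functions \<Omega>"
  obtains C where "C > 0" "\<And>x. norm (cgrad \<phi> x) \<le> C"
proof -
  obtain R where R: "\<And>x. norm x \<ge> R \<Longrightarrow> \<phi> x = 0" using test_function_support_bounded[OF assms] by auto
  have sm: "smooth \<phi>" using test_function_D[OF assms] by auto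
  have "bounded (cgrad \<phi> ` cball 0 R)"
    by (intro compact_imp_bounded compact_continuous_image cgrad_continuous sm compact_cball)
  then obtain C where C: "C > 0" "\<And>x. x \<in> cball 0 R \<Longrightarrow> norm (cgrad \<phi> x) \<le> C"
    unfolding bounded_pos by auto
  have "norm (cgrad \<phi> x) \<le> C" for x
  proof (cases "norm x \<le> R")
    case False
    have "closure {x. \<phi> x \<noteq> 0} \<subseteq> cball 0 R"
      using R by (intro closure_minimal) (auto simp: not_le[symmetric] intro: ccontr)
    then have "x \<notin> closure {x. \<phi> x \<noteq> 0}" using False by auto
    then show ?thesis using C(1) by (simp add: cgrad_def partial_zero_outside)
  qed (use C in auto)
  with C(1) that show ?thesis by blast
qed

lemma test_function_lipschitz:
  assumes "\<phi> \<in> test_functions \<Omega>"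
  obtains L where "L > 0" "\<And>x. norm (cgrad \<phi> x) \<le> L" "\<And>x y. \<bar>\<phi> x - \<phi> y\<bar> \<le> L * norm (x - y)"
proof -
  obtain L where L: "L > 0" "\<And>x. norm (cgrad \<phi> x) \<le> L" using test_function_cgrad_bounded[OF assms] by auto
  have "norm (\<phi> x - \<phi> y) \<le> L * norm (x - y)" for x y
  proof (rule differentiable_bound[of UNIV])
    show "(\<phi> has_derivative (\<lambda>h. cgrad \<phi> x \<bullet> h)) (at x within UNIV)" for x
      using smooth_has_derivative_cgrad[OF test_function_D(1)[OF assms]] by simp
    show "onorm (\<lambda>h. cgrad \<phi> x \<bullet> h) \<le> L" for x
    proof (rule onorm_bound)
      show "norm (cgrad \<phi> x \<bullet> h) \<le> L * norm h" for h
        using Cauchy_Schwarz_ineq2[of "cgrad \<phi> x" h] mult_right_mono[OF L(2)[of x], of "norm h"] by simp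
    qed (use L in simp)
  qed auto
  with L that show ?thesis by auto
qed

lemma test_function_conv_integrable:
  assumes "k \<in> test_functions \<Omega>" "integrable lborel V"
  shows "integrable lborel (\<lambda>y. k (y - x) * V y)"
proof -
  obtain C where C: "\<And>x. \<bar>k x\<bar> \<le> C" using test_function_bounded[OF assms(1)] by auto
  have [measurable]: "k \<in> borel_measurable borel" using assms test_function_D smooth_measurable by blast
  have [measurable]: "V \<in> borel_measurable borel" using assms by auto
  show ?thesis
    by (rule Bochner_Integration.integrable_bound[of _ "\<lambda>y. C * \<bar>V y\<bar>"])
      (use assms C in \<open>auto simp: abs_mult intro!: mult_right_mono order_trans[OF _ mult_right_mono[OF abs_ge_self]]\<close>)
qed

text \<open>Differentiation under the integral: the difference quotients of \<open>k\<close> are bounded by its Lipschitz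
  constant, so \<open>V\<close> dominates the integrands.\<close>

lemma conv_has_derivative:
  assumes k: "k \<in> test_functions \<Omega>" and V: "integrable lborel V"
  shows "(conv k V has_derivative (\<lambda>h. - (\<Sum>i\<in>Basis. (h \<bullet> i) * conv (partial k i) V x))) (at x)"
proof -
  let ?D = "\<lambda>h. - (\<Sum>i\<in>Basis. (h \<bullet> i) * conv (partial k i) V x)"
  obtain L where L: "L > 0" "\<And>x. norm (cgrad k x) \<le> L" "\<And>x y. \<bar>k x - k y\<bar> \<le> L * norm (x - y)"
    using test_function_lipschitz[OF k] by auto
  have [measurable]: "k \<in> borel_measurable borel" using k test_function_D smooth_measurable by blast
  have [measurable]: "cgrad k \<in> borel_measurable borel"
    using test_function_D(1)[OF k] by (intro borel_measurable_continuous_onI cgrad_continuous)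
  have [measurable]: "V \<in> borel_measurable borel" using V by auto
  note int = test_function_conv_integrable[OF _ V]
  define Q where "Q h y = k (y - (x + h)) - k (y - x) + cgrad k (y - x) \<bullet> h" for h y
  have D_eq: "?D h = - (LINT y|lborel. (cgrad k (y - x) \<bullet> h) * V y)"
    and D_int: "integrable lborel (\<lambda>y. (cgrad k (y - x) \<bullet> h) * V y)" for h
  proof -
    have *: "(cgrad k (y - x) \<bullet> h) * V y = (\<Sum>i\<in>Basis. (h \<bullet> i) * (partial k i (y - x) * V y))" for y
      by (simp add: cgrad_def inner_sum_left sum_distrib_left inner_commute[of h] mult_ac)
    show "integrable lborel (\<lambda>y. (cgrad k (y - x) \<bullet> h) * V y)"
      unfolding * by (intro Bochner_Integration.integrable_sum integrable_mult_right int[OF test_functions_partial[OF k]])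
    show "?D h = - (LINT y|lborel. (cgrad k (y - x) \<bullet> h) * V y)"
      unfolding * conv_def
      by (subst Bochner_Integration.integral_sum)
        (simp_all add: int[OF test_functions_partial[OF k]])
  qed
  have diff: "conv k V (x + h) - conv k V x - ?D h = (LINT y|lborel. Q h y * V y)" for h
  proof -
    have "(LINT y|lborel. Q h y * V y) = (LINT y|lborel. k (y - (x + h)) * V y - k (y - x) * V y + (cgrad k (y - x) \<bullet> h) * V y)"
      by (simp add: Q_def algebra_simps)
    also have "\<dots> = conv k V (x + h) - conv k V x + (LINT y|lborel. (cgrad k (y - x) \<bullet> h) * V y)"
      using int[OF k] D_int by (simp add: conv_def)
    finally show ?thesis unfolding D_eq by simp
  qed
  have "((\<lambda>h. norm (conv k V (x + h) - conv k V x - ?D h) / norm h) \<longlongrightarrow> 0) (at 0)"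
  proof (subst tendsto_at_iff_sequentially, intro allI impI, unfold o_def)
    fix h :: "nat \<Rightarrow> 'a" assume "\<forall>i. h i \<in> UNIV - {0}" and h: "h \<longlonglongrightarrow> 0"
    then have h0: "h n \<noteq> 0" for n by auto
    have Qb: "\<bar>Q (h n) y\<bar> \<le> 2 * L * norm (h n)" for n y
    proof -
      have "\<bar>k (y - (x + h n)) - k (y - x)\<bar> \<le> L * norm (h n)"
        using L(3)[of "y - (x + h n)" "y - x"] by (simp add: algebra_simps)
      moreover have "\<bar>cgrad k (y - x) \<bullet> h n\<bar> \<le> L * norm (h n)"
        using Cauchy_Schwarz_ineq2[of "cgrad k (y - x)" "h n"] mult_right_mono[OF L(2)[of "y - x"], of "norm (h n)"] by simp
      ultimately show ?thesis unfolding Q_def by linarith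
    qed
    have "(\<lambda>n. LINT y|lborel. Q (h n) y / norm (h n) * V y) \<longlonglongrightarrow> (LINT y::'a|lborel. 0)"
    proof (rule integral_dominated_convergence[where w="\<lambda>y. 2 * L * \<bar>V y\<bar>"])
      show "AE y in lborel. (\<lambda>n. Q (h n) y / norm (h n) * V y) \<longlonglongrightarrow> 0"
      proof (rule AE_I2)
        fix y
        have lim: "((\<lambda>e. norm (k (y - x + e) - k (y - x) - cgrad k (y - x) \<bullet> e) / norm e) \<longlongrightarrow> 0) (at 0)"
          using smooth_has_derivative_cgrad[OF test_function_D(1)[OF k], of "y - x"] by (simp add: has_derivative_at)
        have "(\<lambda>n. - h n) \<longlonglongrightarrow> 0" using tendsto_minus[OF h] by simp
        then have "filterlim (\<lambda>n. - h n) (at 0) sequentially"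
          using h0 by (auto simp: filterlim_at)
        from filterlim_compose[OF lim this]
        have "(\<lambda>n. \<bar>Q (h n) y\<bar> / norm (h n)) \<longlonglongrightarrow> 0"
          by (simp add: Q_def algebra_simps)
        then have "(\<lambda>n. \<bar>Q (h n) y / norm (h n)\<bar>) \<longlonglongrightarrow> 0" by (simp add: abs_divide)
        then have "(\<lambda>n. Q (h n) y / norm (h n)) \<longlonglongrightarrow> 0" by (rule tendsto_rabs_zero_cancel)
        from tendsto_mult_left_zero[OF this]
        show "(\<lambda>n. Q (h n) y / norm (h n) * V y) \<longlonglongrightarrow> 0" .
      qed
      show "AE y in lborel. norm (Q (h n) y / norm (h n) * V y) \<le> 2 * L * \<bar>V y\<bar>" for n
      proof (rule AE_I2)
        fix y
        have "\<bar>Q (h n) y\<bar> / norm (h n) \<le> 2 * L" using Qb[of n y] h0[of n] by (simp add: field_simps)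
        then show "norm (Q (h n) y / norm (h n) * V y) \<le> 2 * L * \<bar>V y\<bar>"
          using mult_right_mono[of "\<bar>Q (h n) y\<bar> / norm (h n)" "2 * L" "\<bar>V y\<bar>"] by (simp add: abs_mult)
      qed
    qed (use V in \<open>auto simp: Q_def\<close>)
    moreover have "(LINT y|lborel. Q (h n) y / norm (h n) * V y) = (LINT y|lborel. Q (h n) y * V y) / norm (h n)" for n
      by (subst integral_divide_zero[symmetric]) (simp add: mult.commute)
    ultimately have "(\<lambda>n. (LINT y|lborel. Q (h n) y * V y) / norm (h n)) \<longlonglongrightarrow> 0"
      by simp
    from tendsto_rabs_zero[OF this]
    show "(\<lambda>n. norm (conv k V (x + h n) - conv k V x - ?D (h n)) / norm (h n)) \<longlonglongrightarrow> 0"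
      unfolding diff by (simp add: abs_divide)
  qed
  moreover have "bounded_linear ?D"
    by (intro bounded_linear_minus bounded_linear_sum bounded_linear_mult_const bounded_linear_inner_left)
  ultimately show ?thesis by (simp add: has_derivative_at)
qed

lemma conv_partial:
  assumes "k \<in> test_functions \<Omega>" "integrable lborel V" "i \<in> Basis"
  shows "partial (conv k V) i x = - conv (partial k i) V x"
  using partial_eq[OF conv_has_derivative[OF assms(1,2)], of i x] assms(3)
  by (simp add: inner_Basis if_distrib[of "\<lambda>c. c * _"] sum.delta cong: if_cong)

lemma smooth_conv:
  assumes "k \<in> test_functions \<Omega>" "integrable lborel V"
  shows "smooth (conv k V)"
proof -
  have "Ck n (conv k V)" for n
    using assms(1)
  proof (induction n arbitrary: k)
    case 0
    then show ?case
      using has_derivative_continuous[OF conv_has_derivative[OF _ assms(2)]]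
      by (auto simp: continuous_on_eq_continuous_at)
  next
    case (Suc n)
    have "Ck n (\<lambda>x. (-1) * conv (partial k i) V x)" if "i \<in> Basis" for i
      by (intro Ck_mult Ck_const Suc.IH test_functions_partial Suc.prems that)
    moreover have "partial (conv k V) i = (\<lambda>x. (-1) * conv (partial k i) V x)" if "i \<in> Basis" for i
      using conv_partial[OF Suc.prems assms(2) that] by auto
    ultimately show ?case
      using conv_has_derivative[OF Suc.prems assms(2)] by (auto simp: differentiable_def)
  qed
  then show ?thesis by (simp add: smooth_def)
qed

text \<open>The integral of \<open>\<phi>\<close> over a large ball does not change under small translations of \<open>\<phi>\<close>, so the
  derivative of \<open>conv \<phi> V\<close>, with \<open>V\<close> the indicator of that ball, vanishes at the origin.\<close>

lemma integral_partial_eq_0: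
  assumes \<phi>: "\<phi> \<in> test_functions \<Omega>" and i: "i \<in> Basis"
  shows "(LINT x|lborel. partial \<phi> i x) = 0"
proof -
  obtain R where R: "R > 0" "\<And>x. norm x \<ge> R \<Longrightarrow> \<phi> x = 0" using test_function_support_bounded[OF \<phi>] by auto
  obtain R' where R': "R' > 0" "\<And>x. norm x \<ge> R' \<Longrightarrow> partial \<phi> i x = 0"
    using test_function_support_bounded[OF test_functions_partial[OF \<phi> i]] by auto
  define V :: "'a \<Rightarrow> real" where "V = indicator (ball 0 (max (R + 1) R'))"
  have V: "integrable lborel V" unfolding V_def
    by (intro integrable_real_indicator) (auto simp: emeasure_lborel_ball_finite[unfolded infinity_ennreal_def])
  have [measurable]: "\<phi> \<in> borel_measurable borel" using \<phi> test_function_D smooth_measurable by blast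
  have const: "conv \<phi> V x = (LINT z|lborel. \<phi> z)" if "norm x < 1" for x
  proof -
    have "conv \<phi> V x = (LINT z|lborel. \<phi> z * V (x + z))"
      using V by (intro conv_alt) auto
    also have "\<dots> = (LINT z|lborel. \<phi> z)"
    proof (rule Bochner_Integration.integral_cong)
      fix z show "\<phi> z * V (x + z) = \<phi> z"
      proof (cases "norm z < R")
        case True
        then have "norm (x + z) < R + 1" using that norm_triangle_ineq[of x z] by linarith
        then show ?thesis by (simp add: V_def)
      qed (use R(2)[of z] in auto)
    qed simp
    finally show ?thesis .
  qed
  have "(conv \<phi> V has_derivative (\<lambda>h. 0)) (at 0)"
    by (rule has_derivative_transform_within_open[of "\<lambda>x. LINT z|lborel. \<phi> z" _ _ _ "ball 0 1"])
      (auto simp: const)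
  then have "conv (partial \<phi> i) V 0 = 0"
    using conv_partial[OF \<phi> V i, of 0] partial_eq by fastforce
  moreover have "conv (partial \<phi> i) V 0 = (LINT x|lborel. partial \<phi> i x)"
    unfolding conv_def
  proof (rule Bochner_Integration.integral_cong)
    fix y show "partial \<phi> i (y - 0) * V y = partial \<phi> i y"
      using R'(2)[of y] by (cases "norm y < R'") (auto simp: V_def)
  qed simp
  ultimately show ?thesis by simp
qed

text \<open>A normalised bump. Its centre is arbitrary since near the boundary of a domain the mollifier has to
  look into the domain.\<close>

lemma mollifier_exists:
  assumes "(r::real) > 0"
  obtains k :: "'a::euclidean_space \<Rightarrow> real" where "smooth k" "k \<in> test_functions UNIV"
    "closure {x. k x \<noteq> 0} \<subseteq> cball c r" "\<And>z. k z \<noteq> 0 \<Longrightarrow> z \<in> ball c r"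
    "\<And>z. k z \<ge> 0" "(\<integral>\<^sup>+z. ennreal (k z) \<partial>lborel) = 1" "k \<in> L2 lborel"
proof -
  have supp: "closure {x. bump c r x \<noteq> 0} \<subseteq> cball c r"
    using bump_nonzero_iff[OF assms, of c] by (intro closure_minimal) auto
  have tf: "bump c r \<in> test_functions UNIV"
  proof -
    have "compact (closure {x. bump c r x \<noteq> 0})"
      using supp bounded_subset[OF bounded_cball] by (auto simp: compact_eq_bounded_closed)
    then show ?thesis by (simp add: test_functions_def smooth_bump)
  qed
  have [measurable]: "bump c r \<in> borel_measurable borel" by (intro smooth_measurable smooth_bump)
  have ball: "integrable lborel (indicator (ball c r) :: 'a \<Rightarrow> real)"
    by (intro integrable_real_indicator) (auto simp: emeasure_lborel_ball_finite[unfolded infinity_ennreal_def])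
  have int: "integrable lborel (bump c r)" and L2: "bump c r \<in> L2 lborel"
  proof -
    obtain C where C: "C > 0" "\<And>x. \<bar>bump c r x\<bar> \<le> C" using test_function_bounded[OF tf] by auto
    have le: "\<bar>bump c r x\<bar> \<le> C * indicator (ball c r) x" for x
      using C bump_nonzero_iff[OF assms, of c x] by (auto simp: indicator_def)
    show "integrable lborel (bump c r)"
      by (rule Bochner_Integration.integrable_bound[of _ "\<lambda>x. C * indicator (ball c r) x"])
        (use ball le C in \<open>auto intro: order_trans\<close>)
    show "bump c r \<in> L2 lborel"
    proof (rule L2_bound)
      show "integrable lborel (\<lambda>x. C\<^sup>2 * indicator (ball c r) x)" using ball by simp
      show "AE x in lborel. (norm (bump c r x))\<^sup>2 \<le> C\<^sup>2 * indicator (ball c r) x"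
      proof (rule AE_I2)
        fix x
        have "(\<bar>bump c r x\<bar>)\<^sup>2 \<le> (C * indicator (ball c r) x)\<^sup>2" by (intro power_mono le) auto
        then show "(norm (bump c r x))\<^sup>2 \<le> C\<^sup>2 * indicator (ball c r) x"
          by (auto simp: indicator_def)
      qed
    qed simp
  qed
  define I where "I = (LINT z|lborel. bump c r z)"
  have nnI: "(\<integral>\<^sup>+z. ennreal (bump c r z) \<partial>lborel) = ennreal I"
    unfolding I_def by (rule nn_integral_eq_integral[OF int]) (simp add: bump_nonneg)
  have "I \<noteq> 0"
  proof
    assume "I = 0"
    then have "AE z in lborel. bump c r z = 0"
      using integral_nonneg_eq_0_iff_AE[OF int] by (simp add: I_def bump_nonneg)
    then have "AE z in lborel. z \<notin> ball c r"
      by eventually_elim (use bump_nonzero_iff[OF assms, of c] in blast)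
    then have "ball c r \<in> null_sets lborel" by (subst AE_iff_null_sets) auto
    then have "negligible (ball c r)" by (simp add: negligible_iff_null_sets null_sets_completionI)
    then show False using assms open_not_negligible[of "ball c r"] by auto
  qed
  moreover have "I \<ge> 0" unfolding I_def by (simp add: bump_nonneg)
  ultimately have I: "I > 0" by simp
  let ?k = "\<lambda>z. inverse I * bump c r z"
  show ?thesis
  proof
    show "smooth ?k" by (intro smooth_mult smooth_const smooth_bump)
    show "?k \<in> test_functions UNIV" by (intro test_functions_mult tf smooth_const)
    show "closure {x. ?k x \<noteq> 0} \<subseteq> cball c r" using supp I by simp
    show "z \<in> ball c r" if "?k z \<noteq> 0" for z using that bump_nonzero_iff[OF assms, of c z] by simp
    show "0 \<le> ?k z" for z using I by (simp add: bump_nonneg)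
    show "(\<integral>\<^sup>+z. ennreal (?k z) \<partial>lborel) = 1"
    proof -
      have "(\<integral>\<^sup>+z. ennreal (?k z) \<partial>lborel) = ennreal (inverse I) * ennreal I"
        using I by (simp add: ennreal_mult bump_nonneg nn_integral_cmult nnI)
      also have "\<dots> = 1" using I by (simp add: ennreal_mult[symmetric])
      finally show ?thesis .
    qed
    show "?k \<in> L2 lborel" using L2_scaleR[OF L2, of "inverse I"] by simp
  qed
qed

section \<open>Weak gradients\<close>

lemma open_sets_lebesgue [simp]: "open \<Omega> \<Longrightarrow> \<Omega> \<in> sets lebesgue"
  by (simp add: borel_open sets_completionI_sets)

lemma borel_measurable_lebesgue_on: "f \<in> borel_measurable borel \<Longrightarrow> f \<in> borel_measurable (lebesgue_on \<Omega>)"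
  by (intro measurable_restrict_space1 measurable_completion) simp

lemma AE_lebesgue_on: "open \<Omega> \<Longrightarrow> (AE x in lebesgue_on \<Omega>. P x) \<longleftrightarrow> (AE x in lborel. x \<in> \<Omega> \<longrightarrow> P x)"
  by (simp add: AE_restrict_space_iff AE_completion_iff)

lemma lebesgue_on_lborel_integral:
  fixes F :: "'a::euclidean_space \<Rightarrow> real"
  assumes "open \<Omega>" "F \<in> borel_measurable borel" "\<And>x. x \<notin> \<Omega> \<Longrightarrow> F x = 0"
  shows "(LINT x|lebesgue_on \<Omega>. F x) = (LINT x|lborel. F x)"
proof -
  have "(LINT x|lebesgue_on \<Omega>. F x) = (LINT x|lebesgue. indicator \<Omega> x *\<^sub>R F x)"
    using assms(1) by (subst integral_restrict_space) auto
  also have "(\<lambda>x. indicator \<Omega> x *\<^sub>R F x) = F"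
  proof
    fix x show "indicator \<Omega> x *\<^sub>R F x = F x" using assms(3)[of x] by (auto simp: indicator_def)
  qed
  also have "(LINT x|lebesgue. F x) = (LINT x|lborel. F x)"
    using assms(2) by (intro integral_completion) auto
  finally show ?thesis .
qed

text \<open>Extension by zero to a Borel function on the whole space, where translations and Fubini's theorem are
  available.\<close>

lemma L2_extension:
  fixes u :: "'a::euclidean_space \<Rightarrow> real"
  assumes \<Omega>: "open \<Omega>" and u: "u \<in> L2 (lebesgue_on \<Omega>)"
  obtains V where "V \<in> L2 lborel" "\<And>x. x \<notin> \<Omega> \<Longrightarrow> V x = 0" "AE x in lebesgue_on \<Omega>. u x = V x"
    "\<And>\<phi>. \<phi> \<in> borel_measurable borel \<Longrightarrow>
       (LINT x|lebesgue_on \<Omega>. u x * \<phi> x) = (LINT x|lborel. \<phi> x * V x)"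
proof -
  have "(\<lambda>x. indicator \<Omega> x *\<^sub>R u x) \<in> borel_measurable lebesgue"
    using L2_measurable[OF u] \<Omega> by (subst borel_measurable_restrict_space_iff[symmetric]) auto
  from completion_ex_borel_measurable_real[OF this]
  obtain W where W: "W \<in> borel_measurable lborel" "AE x in lborel. indicator \<Omega> x *\<^sub>R u x = W x" by blast
  have [measurable]: "W \<in> borel_measurable borel" "\<Omega> \<in> sets borel" using W(1) \<Omega> by auto
  define V where "V x = indicator \<Omega> x * W x" for x
  have [measurable]: "V \<in> borel_measurable borel" unfolding V_def[abs_def] by measurable
  have zero: "V x = 0" if "x \<notin> \<Omega>" for x using that by (simp add: V_def)
  have AE: "AE x in lebesgue_on \<Omega>. u x = V x"
    unfolding AE_lebesgue_on[OF \<Omega>] using W(2) by eventually_elim (auto simp: V_def)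
  have V_on: "V \<in> borel_measurable (lebesgue_on \<Omega>)" by (rule borel_measurable_lebesgue_on) measurable
  have "V \<in> L2 (lebesgue_on \<Omega>)" using L2_AE_cong[OF u V_on AE] .
  then have "integrable lebesgue (\<lambda>x. indicator \<Omega> x *\<^sub>R (norm (V x))\<^sup>2)"
    using \<Omega> integrable_restrict_space[of \<Omega> lebesgue "\<lambda>x. (norm (V x))\<^sup>2"] by (simp add: L2_def)
  also have "(\<lambda>x. indicator \<Omega> x *\<^sub>R (norm (V x))\<^sup>2) = (\<lambda>x. (norm (V x))\<^sup>2)"
    using zero by (auto simp: fun_eq_iff indicator_def)
  finally have "V \<in> L2 lborel"
    by (simp add: L2_def integrable_completion)
  moreover have "(LINT x|lebesgue_on \<Omega>. u x * \<phi> x) = (LINT x|lborel. \<phi> x * V x)"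
    if [measurable]: "\<phi> \<in> borel_measurable borel" for \<phi>
  proof -
    have "(LINT x|lebesgue_on \<Omega>. u x * \<phi> x) = (LINT x|lebesgue_on \<Omega>. \<phi> x * V x)"
    proof (rule integral_cong_AE)
      show "(\<lambda>x. u x * \<phi> x) \<in> borel_measurable (lebesgue_on \<Omega>)"
        using L2_measurable[OF u] borel_measurable_lebesgue_on[OF that] by measurable
      show "(\<lambda>x. \<phi> x * V x) \<in> borel_measurable (lebesgue_on \<Omega>)"
        by (rule borel_measurable_lebesgue_on) measurable
      show "AE x in lebesgue_on \<Omega>. u x * \<phi> x = \<phi> x * V x"
        using AE by eventually_elim simp
    qed
    also have "\<dots> = (LINT x|lborel. \<phi> x * V x)" by (rule lebesgue_on_lborel_integral[OF \<Omega>]) (auto simp: zero)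
    finally show ?thesis .
  qed
  ultimately show ?thesis using that[of V] zero AE by blast
qed

text \<open>Mollifying at a scale below the distance to the boundary tests \<open>u\<close> against translates of the
  mollifier, so the mollified function vanishes. It approximates \<open>u\<close>.\<close>

lemma fundamental_lemma_of_variations:
  fixes u :: "'a::euclidean_space \<Rightarrow> real"
  assumes \<Omega>: "open \<Omega>" and u: "u \<in> L2 (lebesgue_on \<Omega>)"
    and test: "\<And>\<phi>. \<phi> \<in> test_functions \<Omega> \<Longrightarrow> (LINT x|lebesgue_on \<Omega>. u x * \<phi> x) = 0"
  shows "AE x in lebesgue_on \<Omega>. u x = 0"
proof -
  obtain V where V: "V \<in> L2 lborel" "\<And>x. x \<notin> \<Omega> \<Longrightarrow> V x = 0" "AE x in lebesgue_on \<Omega>. u x = V x"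
    "\<And>\<phi>. \<phi> \<in> borel_measurable borel \<Longrightarrow> (LINT x|lebesgue_on \<Omega>. u x * \<phi> x) = (LINT x|lborel. \<phi> x * V x)"
    using L2_extension[OF \<Omega> u] by metis
  have [measurable]: "V \<in> borel_measurable borel" using V(1) by (auto simp: L2_def)
  \<comment> \<open>The points at distance at least \<open>1 / (m + 1)\<close> from the complement of \<open>\<Omega>\<close>.\<close>
  define S where "S m = - (\<Union>y\<in>-\<Omega>. ball y (1 / real (Suc m)))" for m
  have [measurable]: "S m \<in> sets borel" for m unfolding S_def by (intro borel_comp borel_open open_UN) auto
  have S_sub: "cball x \<delta> \<subseteq> \<Omega>" if "x \<in> S m" "\<delta> < 1 / real (Suc m)" for x m \<delta>
  proof
    fix y assume "y \<in> cball x \<delta>"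
    then have "dist y x < 1 / real (Suc m)" using that(2) by (simp add: dist_commute)
    then show "y \<in> \<Omega>" using that(1) by (auto simp: S_def)
  qed
  have S_cover: "\<exists>m. x \<in> S m" if "x \<in> \<Omega>" for x
  proof -
    obtain e where e: "e > 0" "ball x e \<subseteq> \<Omega>" using openE[OF \<Omega> \<open>x \<in> \<Omega>\<close>] by blast
    obtain m where "1 / real (Suc m) < e" using e(1) nat_approx_posE by blast
    moreover have "1 / real (Suc m) \<le> dist y x" if "y \<notin> \<Omega>" for y
      using that e(2) calculation by (force simp: dist_commute)
    ultimately have "x \<in> S m" by (auto simp: S_def not_less)
    then show ?thesis ..
  qed
  have S0: "AE x in lborel. x \<in> S m \<longrightarrow> V x = 0" for m
  proof -
    have "(\<integral>\<^sup>+x. ennreal ((V x)\<^sup>2) * indicator (S m) x \<partial>lborel) \<le> ennreal \<epsilon>" if "\<epsilon> > 0" for \<epsilon>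
    proof -
      obtain \<delta> where \<delta>: "\<delta> > 0" "\<And>z. norm z < \<delta> \<Longrightarrow> (\<integral>\<^sup>+x. ennreal ((V (x + z) - V x)\<^sup>2) \<partial>lborel) \<le> ennreal \<epsilon>"
        using L2_translation_continuous[OF V(1) \<open>\<epsilon> > 0\<close>] by metis
      define r where "r = min \<delta> (1 / real (Suc m) / 2)"
      have r: "r > 0" "r \<le> \<delta>" "r < 1 / real (Suc m)" using \<delta>(1) by (auto simp: r_def min_def field_simps)
      obtain k :: "'a \<Rightarrow> real" where k: "smooth k" "k \<in> test_functions UNIV"
        "closure {x. k x \<noteq> 0} \<subseteq> cball 0 r" "\<And>z. k z \<noteq> 0 \<Longrightarrow> z \<in> ball 0 r"
        "\<And>z. k z \<ge> 0" "(\<integral>\<^sup>+z. ennreal (k z) \<partial>lborel) = 1" "k \<in> L2 lborel"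
        using mollifier_exists[OF r(1), of 0] by metis
      have conv0: "conv k V x = 0" if "x \<in> S m" for x
      proof -
        have "(\<lambda>y. k (y - x)) \<in> test_functions \<Omega>"
          using test_functions_shift[OF k(1,3)] S_sub[OF that r(3)] by simp
        then have "(LINT y|lborel. k (y - x) * V y) = 0"
          using test V(4)[of "\<lambda>y. k (y - x)"] smooth_measurable[OF smooth_shift[OF k(1)]] by metis
        then show ?thesis by (simp add: conv_def)
      qed
      have "(\<integral>\<^sup>+x. ennreal ((V x)\<^sup>2) * indicator (S m) x \<partial>lborel) \<le> (\<integral>\<^sup>+x. ennreal ((conv k V x - V x)\<^sup>2) \<partial>lborel)"
        by (intro nn_integral_mono) (auto simp: indicator_def conv0)
      also have "\<dots> \<le> ennreal \<epsilon>"
        by (rule conv_approximates[OF V(1) k(7,5,6)]) (use k(4) \<delta>(2) r(2) in force)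
      finally show ?thesis .
    qed
    then have "(\<integral>\<^sup>+x. ennreal ((V x)\<^sup>2) * indicator (S m) x \<partial>lborel) = 0"
      using ennreal_le_epsilon[of 0 "\<integral>\<^sup>+x. ennreal ((V x)\<^sup>2) * indicator (S m) x \<partial>lborel"] by simp
    then have "AE x in lborel. ennreal ((V x)\<^sup>2) * indicator (S m) x = 0"
      by (subst (asm) nn_integral_0_iff_AE) auto
    then show ?thesis by eventually_elim (auto simp: indicator_def)
  qed
  have "AE x in lborel. \<forall>m. x \<in> S m \<longrightarrow> V x = 0" by (subst AE_all_countable) (use S0 in blast)
  then have "AE x in lebesgue_on \<Omega>. V x = 0"
    unfolding AE_lebesgue_on[OF \<Omega>] by eventually_elim (use S_cover in blast)
  with V(3) show ?thesis by eventually_elim simp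
qed

lemma test_function_L2:
  assumes "open \<Omega>" "\<phi> \<in> test_functions \<Omega>" shows "\<phi> \<in> L2 (lebesgue_on \<Omega>)"
proof -
  obtain R where R: "\<And>x. norm x \<ge> R \<Longrightarrow> \<phi> x = 0" using test_function_support_bounded[OF assms(2)] by auto
  obtain C where C: "C > 0" "\<And>x. \<bar>\<phi> x\<bar> \<le> C" using test_function_bounded[OF assms(2)] by auto
  show ?thesis
  proof (rule L2_bound)
    show "\<phi> \<in> borel_measurable (lebesgue_on \<Omega>)"
      using assms test_function_D smooth_measurable borel_measurable_lebesgue_on by blast
    have "integrable lebesgue (\<lambda>x. C\<^sup>2 * indicator (ball 0 R \<inter> \<Omega>) x)"
    proof -
      have "ball 0 R \<inter> \<Omega> \<in> lmeasurable" using assms(1) by (intro lmeasurable_open) (auto simp: bounded_Int)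
      then show ?thesis by (intro integrable_mult_right integrable_real_indicator) (auto simp: fmeasurable_def)
    qed
    also have "(\<lambda>x. C\<^sup>2 * indicator (ball 0 R \<inter> \<Omega>) x) = (\<lambda>x. indicator \<Omega> x *\<^sub>R (C\<^sup>2 * indicator (ball 0 R) x))"
      by (auto simp: indicator_def)
    finally show "integrable (lebesgue_on \<Omega>) (\<lambda>x. C\<^sup>2 * indicator (ball 0 R) x)"
      using assms(1) by (subst integrable_restrict_space) auto
    have "(norm (\<phi> x))\<^sup>2 \<le> C\<^sup>2 * indicator (ball 0 R) x" for x
      using power_mono[OF C(2)[of x], of 2] R[of x] by (auto simp: indicator_def)
    then show "AE x in lebesgue_on \<Omega>. (norm (\<phi> x))\<^sup>2 \<le> C\<^sup>2 * indicator (ball 0 R) x" by simp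
  qed
qed

lemma test_integrable:
  assumes "open \<Omega>" "\<phi> \<in> test_functions \<Omega>" "u \<in> L2 (lebesgue_on \<Omega>)"
  shows "integrable (lebesgue_on \<Omega>) (\<lambda>x. u x * \<phi> x)"
  using L2_mult_integrable[OF assms(3) test_function_L2[OF assms(1,2)]] .

lemma weak_gradient_unique:
  assumes \<Omega>: "open \<Omega>" and G: "G \<in> L2 (lebesgue_on \<Omega>)" "H \<in> L2 (lebesgue_on \<Omega>)"
    and wg: "weak_gradient \<Omega> u G" "weak_gradient \<Omega> u H"
  shows "AE x in lebesgue_on \<Omega>. G x = H x"
proof -
  have "AE x in lebesgue_on \<Omega>. (G x - H x) \<bullet> i = 0" if i: "i \<in> Basis" for i
  proof (rule fundamental_lemma_of_variations[OF \<Omega>])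
    show "(\<lambda>x. (G x - H x) \<bullet> i) \<in> L2 (lebesgue_on \<Omega>)"
      by (intro L2_inner_component L2_diff G) (simp add: i)
    fix \<phi> assume \<phi>: "\<phi> \<in> test_functions \<Omega>"
    have "integrable (lebesgue_on \<Omega>) (\<lambda>x. (G x \<bullet> i) * \<phi> x)" "integrable (lebesgue_on \<Omega>) (\<lambda>x. (H x \<bullet> i) * \<phi> x)"
      using G i by (auto intro!: test_integrable[OF \<Omega> \<phi>] L2_inner_component)
    then show "(LINT x|lebesgue_on \<Omega>. (G x - H x) \<bullet> i * \<phi> x) = 0"
      using wg \<phi> i unfolding weak_gradient_def by (simp add: inner_diff_left left_diff_distrib)
  qed
  then have "AE x in lebesgue_on \<Omega>. \<forall>i\<in>Basis. (G x - H x) \<bullet> i = 0"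
    by (intro AE_finite_allI) auto
  then show ?thesis
  proof eventually_elim
    case (elim x)
    then show ?case by (intro euclidean_eqI[of "G x"]) (simp add: inner_diff_left)
  qed
qed

lemma grad:
  assumes "u \<in> H1 \<Omega>"
  shows "grad \<Omega> u \<in> L2 (lebesgue_on \<Omega>)" "weak_gradient \<Omega> u (grad \<Omega> u)"
  using someI_ex[of "\<lambda>G. G \<in> L2 (lebesgue_on \<Omega>) \<and> weak_gradient \<Omega> u G"] assms
  by (auto simp: H1_def grad_def)

lemma H1_L2: "u \<in> H1 \<Omega> \<Longrightarrow> u \<in> L2 (lebesgue_on \<Omega>)"
  by (simp add: H1_def)

lemma H1_I:
  assumes "open \<Omega>" "u \<in> L2 (lebesgue_on \<Omega>)" "G \<in> L2 (lebesgue_on \<Omega>)" "weak_gradient \<Omega> u G"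
  shows "u \<in> H1 \<Omega>" "AE x in lebesgue_on \<Omega>. grad \<Omega> u x = G x"
proof -
  show u: "u \<in> H1 \<Omega>" using assms by (auto simp: H1_def)
  show "AE x in lebesgue_on \<Omega>. grad \<Omega> u x = G x"
    using weak_gradient_unique[OF assms(1) grad(1)[OF u] assms(3) grad(2)[OF u] assms(4)] .
qed

lemma H1_lincomb:
  assumes \<Omega>: "open \<Omega>" and u: "u \<in> H1 \<Omega>" and v: "v \<in> H1 \<Omega>"
  shows "(\<lambda>x. c * u x + d * v x) \<in> H1 \<Omega>"
    "AE x in lebesgue_on \<Omega>. grad \<Omega> (\<lambda>x. c * u x + d * v x) x = c *\<^sub>R grad \<Omega> u x + d *\<^sub>R grad \<Omega> v x"
proof -
  let ?G = "\<lambda>x. c *\<^sub>R grad \<Omega> u x + d *\<^sub>R grad \<Omega> v x"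
  have L: "(\<lambda>x. c * u x + d * v x) \<in> L2 (lebesgue_on \<Omega>)" "?G \<in> L2 (lebesgue_on \<Omega>)"
    by (intro L2_lincomb_real L2_lincomb H1_L2 grad u v)+
  have "weak_gradient \<Omega> (\<lambda>x. c * u x + d * v x) ?G"
    unfolding weak_gradient_def
  proof (intro ballI)
    fix \<phi> i assume \<phi>: "\<phi> \<in> test_functions \<Omega>" and i: "i \<in> (Basis :: 'a set)"
    note p = test_functions_partial[OF \<phi> i]
    have *: "integrable (lebesgue_on \<Omega>) (\<lambda>x. u x * partial \<phi> i x)" "integrable (lebesgue_on \<Omega>) (\<lambda>x. v x * partial \<phi> i x)"
      by (intro test_integrable[OF \<Omega> p] H1_L2 u v)+
    have **: "integrable (lebesgue_on \<Omega>) (\<lambda>x. grad \<Omega> u x \<bullet> i * \<phi> x)" "integrable (lebesgue_on \<Omega>) (\<lambda>x. grad \<Omega> v x \<bullet> i * \<phi> x)"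
      using i by (auto intro!: test_integrable[OF \<Omega> \<phi>] L2_inner_component grad u v)
    have "(LINT x|lebesgue_on \<Omega>. (c * u x + d * v x) * partial \<phi> i x)
      = c * (LINT x|lebesgue_on \<Omega>. u x * partial \<phi> i x) + d * (LINT x|lebesgue_on \<Omega>. v x * partial \<phi> i x)"
      using * by (simp add: distrib_right mult.assoc)
    also have "\<dots> = - (c * (LINT x|lebesgue_on \<Omega>. grad \<Omega> u x \<bullet> i * \<phi> x) + d * (LINT x|lebesgue_on \<Omega>. grad \<Omega> v x \<bullet> i * \<phi> x))"
      using grad(2)[OF u] grad(2)[OF v] \<phi> i by (simp add: weak_gradient_def)
    also have "\<dots> = - (LINT x|lebesgue_on \<Omega>. ?G x \<bullet> i * \<phi> x)"
      using ** by (simp add: distrib_right inner_add_left mult.assoc)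
    finally show "(LINT x|lebesgue_on \<Omega>. (c * u x + d * v x) * partial \<phi> i x) = - (LINT x|lebesgue_on \<Omega>. ?G x \<bullet> i * \<phi> x)" .
  qed
  from H1_I[OF \<Omega> L this] show "(\<lambda>x. c * u x + d * v x) \<in> H1 \<Omega>"
    "AE x in lebesgue_on \<Omega>. grad \<Omega> (\<lambda>x. c * u x + d * v x) x = c *\<^sub>R grad \<Omega> u x + d *\<^sub>R grad \<Omega> v x" by auto
qed

lemma H1_diff:
  assumes \<Omega>: "open \<Omega>" and u: "u \<in> H1 \<Omega>" and v: "v \<in> H1 \<Omega>"
  shows "(\<lambda>x. u x - v x) \<in> H1 \<Omega>"
    "AE x in lebesgue_on \<Omega>. grad \<Omega> (\<lambda>x. u x - v x) x = grad \<Omega> u x - grad \<Omega> v x"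
  using H1_lincomb[OF assms, of 1 "-1"] by simp_all

lemma LINT_tendsto:
  fixes u :: "nat \<Rightarrow> 'a \<Rightarrow> real"
  assumes "\<And>n. u n \<in> L2 M" "v \<in> L2 M" "w \<in> L2 M" "(\<lambda>n. LINT x|M. (u n x - v x)\<^sup>2) \<longlonglongrightarrow> 0"
  shows "(\<lambda>n. LINT x|M. u n x * w x) \<longlonglongrightarrow> (LINT x|M. v x * w x)"
  using form_space.form_tendsto[OF L2_form_space, of u M v w] assms by (simp add: power2_eq_square)

lemma weak_gradient_closed:
  fixes u :: "nat \<Rightarrow> 'a::euclidean_space \<Rightarrow> real"
  assumes \<Omega>: "open \<Omega>"
    and L: "\<And>n. u n \<in> L2 (lebesgue_on \<Omega>)" "\<And>n. G n \<in> L2 (lebesgue_on \<Omega>)" "v \<in> L2 (lebesgue_on \<Omega>)" "H \<in> L2 (lebesgue_on \<Omega>)"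
    and wg: "\<And>n. weak_gradient \<Omega> (u n) (G n)"
    and lim: "(\<lambda>n. LINT x|lebesgue_on \<Omega>. (norm (u n x - v x))\<^sup>2) \<longlonglongrightarrow> 0"
      "(\<lambda>n. LINT x|lebesgue_on \<Omega>. (norm (G n x - H x))\<^sup>2) \<longlonglongrightarrow> 0"
  shows "weak_gradient \<Omega> v H"
  unfolding weak_gradient_def
proof (intro ballI)
  fix \<phi> i assume \<phi>: "\<phi> \<in> test_functions \<Omega>" and i: "i \<in> (Basis :: 'a set)"
  have "(\<lambda>n. LINT x|lebesgue_on \<Omega>. u n x * partial \<phi> i x) \<longlonglongrightarrow> (LINT x|lebesgue_on \<Omega>. v x * partial \<phi> i x)"
    by (intro LINT_tendsto L test_function_L2[OF \<Omega>] test_functions_partial \<phi> i) (use lim in simp)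
  moreover have "(\<lambda>n. LINT x|lebesgue_on \<Omega>. (G n x \<bullet> i) * \<phi> x) \<longlonglongrightarrow> (LINT x|lebesgue_on \<Omega>. (H x \<bullet> i) * \<phi> x)"
  proof (intro LINT_tendsto L L2_inner_component test_function_L2[OF \<Omega>] \<phi>)
    show "(\<lambda>n. LINT x|lebesgue_on \<Omega>. (G n x \<bullet> i - H x \<bullet> i)\<^sup>2) \<longlonglongrightarrow> 0"
    proof (rule Lim_null_comparison[OF _ lim(2)], intro always_eventually allI)
      fix n
      have "(LINT x|lebesgue_on \<Omega>. (G n x \<bullet> i - H x \<bullet> i)\<^sup>2) \<le> (LINT x|lebesgue_on \<Omega>. (norm (G n x - H x))\<^sup>2)"
      proof (rule integral_mono)
        show "integrable (lebesgue_on \<Omega>) (\<lambda>x. (G n x \<bullet> i - H x \<bullet> i)\<^sup>2)"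
          using L2_integrable[OF L2_inner_component[OF L2_diff[OF L(2)[of n] L(4)], of i]] i by (simp add: inner_diff_left)
        show "integrable (lebesgue_on \<Omega>) (\<lambda>x. (norm (G n x - H x))\<^sup>2)"
          by (intro L2_integrable L2_diff L)
        fix x
        have "\<bar>(G n x - H x) \<bullet> i\<bar> \<le> norm (G n x - H x)" by (rule Basis_le_norm[OF i])
        from power_mono[OF this, of 2] show "(G n x \<bullet> i - H x \<bullet> i)\<^sup>2 \<le> (norm (G n x - H x))\<^sup>2"
          by (simp add: inner_diff_left)
      qed
      then show "norm (LINT x|lebesgue_on \<Omega>. (G n x \<bullet> i - H x \<bullet> i)\<^sup>2) \<le> (LINT x|lebesgue_on \<Omega>. (norm (G n x - H x))\<^sup>2)"
        by simp
    qed
  qed (use i in auto)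
  moreover have "(LINT x|lebesgue_on \<Omega>. u n x * partial \<phi> i x) = - (LINT x|lebesgue_on \<Omega>. (G n x \<bullet> i) * \<phi> x)" for n
    using wg \<phi> i by (simp add: weak_gradient_def)
  ultimately have "(\<lambda>n. - (LINT x|lebesgue_on \<Omega>. u n x * partial \<phi> i x)) \<longlonglongrightarrow> (LINT x|lebesgue_on \<Omega>. (H x \<bullet> i) * \<phi> x)"
    and "(\<lambda>n. LINT x|lebesgue_on \<Omega>. u n x * partial \<phi> i x) \<longlonglongrightarrow> (LINT x|lebesgue_on \<Omega>. v x * partial \<phi> i x)"
    by simp_all
  from LIMSEQ_unique[OF this(2) tendsto_minus[OF this(1), simplified]]
  show "(LINT x|lebesgue_on \<Omega>. v x * partial \<phi> i x) = - (LINT x|lebesgue_on \<Omega>. (H x \<bullet> i) * \<phi> x)" .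
qed

lemma continuous_bounded_on:
  assumes "bounded \<Omega>" and "continuous_on UNIV (f :: 'a::euclidean_space \<Rightarrow> 'b::euclidean_space)"
  obtains C where "C \<ge> 0" "\<And>x. x \<in> closure \<Omega> \<Longrightarrow> norm (f x) \<le> C"
proof -
  have "bounded (f ` closure \<Omega>)"
    using assms by (intro compact_imp_bounded compact_continuous_image continuous_on_subset[OF assms(2)]) auto
  then obtain C where C: "C > 0" "\<And>x. x \<in> closure \<Omega> \<Longrightarrow> norm (f x) \<le> C" unfolding bounded_pos by auto
  then show ?thesis using that[of C] by auto
qed

lemma continuous_L2:
  assumes "open \<Omega>" "bounded \<Omega>" and f: "continuous_on UNIV (f :: 'a::euclidean_space \<Rightarrow> 'b::euclidean_space)"
  shows "f \<in> L2 (lebesgue_on \<Omega>)"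
proof -
  obtain C where C: "\<And>x. x \<in> closure \<Omega> \<Longrightarrow> norm (f x) \<le> C"
    using continuous_bounded_on[OF assms(2) f] by auto
  have fin: "\<Omega> \<in> lmeasurable" using assms by (intro lmeasurable_open)
  show ?thesis
  proof (rule L2_bound)
    show "integrable (lebesgue_on \<Omega>) (\<lambda>x. C\<^sup>2)"
    proof -
      have "integrable lebesgue (\<lambda>x. indicator \<Omega> x *\<^sub>R C\<^sup>2)"
        using fin by (intro integrable_scaleR_left integrable_real_indicator) (auto simp: fmeasurable_def)
      then show ?thesis using assms(1) by (subst integrable_restrict_space) auto
    qed
    show "f \<in> borel_measurable (lebesgue_on \<Omega>)"
      by (intro borel_measurable_lebesgue_on borel_measurable_continuous_onI f)
    have "(norm (f x))\<^sup>2 \<le> C\<^sup>2" if "x \<in> \<Omega>" for x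
      using power_mono[OF C[of x], of 2] that closure_subset[of \<Omega>] by auto
    then show "AE x in lebesgue_on \<Omega>. (norm (f x))\<^sup>2 \<le> C\<^sup>2" by (intro AE_I2) auto
  qed
qed

text \<open>For a test function \<open>\<phi>\<close> also \<open>f \<phi>\<close> is a test function, and its partial derivatives integrate to zero.\<close>

lemma smooth_H1:
  assumes \<Omega>: "open \<Omega>" "bounded \<Omega>" and f: "smooth f"
  shows "f \<in> H1 \<Omega>" "AE x in lebesgue_on \<Omega>. grad \<Omega> f x = cgrad f x"
proof -
  have L: "f \<in> L2 (lebesgue_on \<Omega>)" "cgrad f \<in> L2 (lebesgue_on \<Omega>)"
    by (intro continuous_L2 \<Omega> smooth_continuous f cgrad_continuous)+
  have "weak_gradient \<Omega> f (cgrad f)"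
    unfolding weak_gradient_def
  proof (intro ballI)
    fix \<phi> i assume \<phi>: "\<phi> \<in> test_functions \<Omega>" and i: "i \<in> (Basis :: 'a set)"
    have sm: "smooth \<phi>" by (rule test_function_D[OF \<phi>])
    have int: "integrable (lebesgue_on \<Omega>) (\<lambda>x. f x * partial \<phi> i x)" "integrable (lebesgue_on \<Omega>) (\<lambda>x. partial f i x * \<phi> x)"
      using i by (auto intro!: test_integrable \<Omega> \<phi> L test_functions_partial continuous_L2 smooth_continuous smooth_partial f)
    have tf: "(\<lambda>x. f x * \<phi> x) \<in> test_functions \<Omega>" by (intro test_functions_mult \<phi> f)
    have "(LINT x|lebesgue_on \<Omega>. f x * partial \<phi> i x) + (LINT x|lebesgue_on \<Omega>. partial f i x * \<phi> x)
      = (LINT x|lebesgue_on \<Omega>. partial (\<lambda>x. f x * \<phi> x) i x)"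
      using int by (simp add: partial_mult[OF f sm])
    also have "\<dots> = (LINT x|lborel. partial (\<lambda>x. f x * \<phi> x) i x)"
      using test_function_D[OF test_functions_partial[OF tf i]]
      by (intro lebesgue_on_lborel_integral \<Omega> smooth_measurable) auto
    also have "\<dots> = 0" by (rule integral_partial_eq_0[OF tf i])
    finally show "(LINT x|lebesgue_on \<Omega>. f x * partial \<phi> i x) = - (LINT x|lebesgue_on \<Omega>. cgrad f x \<bullet> i * \<phi> x)"
      using i by (simp add: cgrad_inner)
  qed
  from H1_I[OF \<Omega>(1) L this] show "f \<in> H1 \<Omega>" "AE x in lebesgue_on \<Omega>. grad \<Omega> f x = cgrad f x" by auto
qed

lemma continuous_mult_L2:
  assumes \<Omega>: "bounded \<Omega>" and f: "continuous_on UNIV (f :: 'a::euclidean_space \<Rightarrow> real)"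
    and u: "u \<in> L2 (lebesgue_on \<Omega>)"
  shows "(\<lambda>x. f x *\<^sub>R u x) \<in> L2 (lebesgue_on \<Omega>)"
proof -
  obtain C where "\<And>x. x \<in> closure \<Omega> \<Longrightarrow> norm (f x) \<le> C" using continuous_bounded_on[OF \<Omega> f] by auto
  then have "AE x in lebesgue_on \<Omega>. \<bar>f x\<bar> \<le> C" using closure_subset[of \<Omega>] by (intro AE_I2) auto
  then show ?thesis
    by (intro L2_bounded_mult[OF u, of _ C] borel_measurable_lebesgue_on borel_measurable_continuous_onI f)
qed

text \<open>The product of \<open>f\<close> and a test function is again a test function, to which the weak gradient of \<open>u\<close>
  applies.\<close>

lemma smooth_mult_H1:
  assumes \<Omega>: "open \<Omega>" "bounded \<Omega>" and f: "smooth f" and u: "u \<in> H1 \<Omega>"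
  shows "(\<lambda>x. f x * u x) \<in> H1 \<Omega>"
    "AE x in lebesgue_on \<Omega>. grad \<Omega> (\<lambda>x. f x * u x) x = f x *\<^sub>R grad \<Omega> u x + u x *\<^sub>R cgrad f x"
proof -
  let ?G = "\<lambda>x. f x *\<^sub>R grad \<Omega> u x + u x *\<^sub>R cgrad f x"
  have uL: "u \<in> L2 (lebesgue_on \<Omega>)" by (rule H1_L2[OF u])
  have L: "(\<lambda>x. f x * u x) \<in> L2 (lebesgue_on \<Omega>)"
    using continuous_mult_L2[OF \<Omega>(2) smooth_continuous[OF f] uL] by simp
  have pL: "(\<lambda>x. partial f i x * u x) \<in> L2 (lebesgue_on \<Omega>)" if "i \<in> Basis" for i
    using continuous_mult_L2[OF \<Omega>(2) smooth_continuous[OF smooth_partial[OF f that]] uL] by simp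
  have LG: "?G \<in> L2 (lebesgue_on \<Omega>)"
  proof (rule L2_add)
    show "(\<lambda>x. f x *\<^sub>R grad \<Omega> u x) \<in> L2 (lebesgue_on \<Omega>)"
      by (intro continuous_mult_L2 \<Omega> smooth_continuous f grad u)
    obtain C where C: "\<And>x. x \<in> closure \<Omega> \<Longrightarrow> norm (cgrad f x) \<le> C"
      using continuous_bounded_on[OF \<Omega>(2) cgrad_continuous[OF f]] by auto
    have cm: "cgrad f \<in> borel_measurable (lebesgue_on \<Omega>)"
      by (intro borel_measurable_lebesgue_on borel_measurable_continuous_onI cgrad_continuous f)
    show "(\<lambda>x. u x *\<^sub>R cgrad f x) \<in> L2 (lebesgue_on \<Omega>)"
    proof (rule L2_bound)
      show "integrable (lebesgue_on \<Omega>) (\<lambda>x. C\<^sup>2 * (norm (u x))\<^sup>2)"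
        using L2_integrable[OF uL] by simp
      show "(\<lambda>x. u x *\<^sub>R cgrad f x) \<in> borel_measurable (lebesgue_on \<Omega>)"
        using cm L2_measurable[OF uL] by measurable
      have "(norm (u x *\<^sub>R cgrad f x))\<^sup>2 \<le> C\<^sup>2 * (norm (u x))\<^sup>2" if "x \<in> \<Omega>" for x
        using power_mono[OF C[of x] norm_ge_zero, of 2] that closure_subset[of \<Omega>]
          mult_right_mono[of "(norm (cgrad f x))\<^sup>2" "C\<^sup>2" "(u x)\<^sup>2"]
        by (auto simp: power_mult_distrib mult.commute)
      then show "AE x in lebesgue_on \<Omega>. (norm (u x *\<^sub>R cgrad f x))\<^sup>2 \<le> C\<^sup>2 * (norm (u x))\<^sup>2"
        by (intro AE_I2) auto
    qed
  qed
  have "weak_gradient \<Omega> (\<lambda>x. f x * u x) ?G"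
    unfolding weak_gradient_def
  proof (intro ballI)
    fix \<phi> i assume \<phi>: "\<phi> \<in> test_functions \<Omega>" and i: "i \<in> (Basis :: 'a set)"
    have sm: "smooth \<phi>" by (rule test_function_D[OF \<phi>])
    have tf: "(\<lambda>x. f x * \<phi> x) \<in> test_functions \<Omega>" by (intro test_functions_mult \<phi> f)
    have int: "integrable (lebesgue_on \<Omega>) (\<lambda>x. u x * partial (\<lambda>x. f x * \<phi> x) i x)"
       "integrable (lebesgue_on \<Omega>) (\<lambda>x. partial f i x * u x * \<phi> x)"
       "integrable (lebesgue_on \<Omega>) (\<lambda>x. grad \<Omega> u x \<bullet> i * (f x * \<phi> x))"
      using i by (auto intro!: test_integrable \<Omega> \<phi> uL tf test_functions_partial pL L2_inner_component grad u)
    have "(LINT x|lebesgue_on \<Omega>. f x * u x * partial \<phi> i x)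
      = (LINT x|lebesgue_on \<Omega>. u x * partial (\<lambda>x. f x * \<phi> x) i x - partial f i x * u x * \<phi> x)"
      unfolding partial_mult[OF f sm] by (simp add: algebra_simps)
    also have "\<dots> = (LINT x|lebesgue_on \<Omega>. u x * partial (\<lambda>x. f x * \<phi> x) i x) - (LINT x|lebesgue_on \<Omega>. partial f i x * u x * \<phi> x)"
      using int by simp
    also have "(LINT x|lebesgue_on \<Omega>. u x * partial (\<lambda>x. f x * \<phi> x) i x) = - (LINT x|lebesgue_on \<Omega>. grad \<Omega> u x \<bullet> i * (f x * \<phi> x))"
      using grad(2)[OF u] tf i by (simp add: weak_gradient_def)
    also have "\<dots> - (LINT x|lebesgue_on \<Omega>. partial f i x * u x * \<phi> x)
      = - (LINT x|lebesgue_on \<Omega>. grad \<Omega> u x \<bullet> i * (f x * \<phi> x) + partial f i x * u x * \<phi> x)"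
      using int by simp
    also have "(\<lambda>x. grad \<Omega> u x \<bullet> i * (f x * \<phi> x) + partial f i x * u x * \<phi> x) = (\<lambda>x. ?G x \<bullet> i * \<phi> x)"
      using i by (simp add: inner_add_left cgrad_inner algebra_simps)
    finally show "(LINT x|lebesgue_on \<Omega>. f x * u x * partial \<phi> i x) = - (LINT x|lebesgue_on \<Omega>. ?G x \<bullet> i * \<phi> x)" .
  qed
  from H1_I[OF \<Omega>(1) L LG this] show "(\<lambda>x. f x * u x) \<in> H1 \<Omega>"
    "AE x in lebesgue_on \<Omega>. grad \<Omega> (\<lambda>x. f x * u x) x = f x *\<^sub>R grad \<Omega> u x + u x *\<^sub>R cgrad f x" by auto
qed

lemma H1_norm_square:
  assumes "u \<in> H1 \<Omega>"
  shows "(H1_norm \<Omega> u)\<^sup>2 = (LINT x|lebesgue_on \<Omega>. (u x)\<^sup>2) + (LINT x|lebesgue_on \<Omega>. (norm (grad \<Omega> u x))\<^sup>2)"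
proof -
  have "0 \<le> (LINT x|lebesgue_on \<Omega>. (u x)\<^sup>2 + (norm (grad \<Omega> u x))\<^sup>2)" by (rule Bochner_Integration.integral_nonneg) simp
  then show ?thesis
    using L2_integrable[OF H1_L2[OF assms]] L2_integrable[OF grad(1)[OF assms]] by (simp add: H1_norm_def)
qed

lemma H1_norm_nonneg: "0 \<le> H1_norm \<Omega> u"
  unfolding H1_norm_def by (intro real_sqrt_ge_zero Bochner_Integration.integral_nonneg) simp

lemma H1_AE_cong:
  assumes "open \<Omega>" "u \<in> H1 \<Omega>" "v \<in> L2 (lebesgue_on \<Omega>)" "AE x in lebesgue_on \<Omega>. u x = v x"
  shows "v \<in> H1 \<Omega>" "AE x in lebesgue_on \<Omega>. grad \<Omega> v x = grad \<Omega> u x"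
proof -
  have "weak_gradient \<Omega> v (grad \<Omega> u)"
    unfolding weak_gradient_def
  proof (intro ballI)
    fix \<phi> i assume \<phi>: "\<phi> \<in> test_functions \<Omega>" and i: "i \<in> (Basis :: 'a set)"
    have pm: "partial \<phi> i \<in> borel_measurable (lebesgue_on \<Omega>)"
      using test_function_L2[OF assms(1) test_functions_partial[OF \<phi> i]] L2_measurable by blast
    have "(LINT x|lebesgue_on \<Omega>. v x * partial \<phi> i x) = (LINT x|lebesgue_on \<Omega>. u x * partial \<phi> i x)"
      by (rule integral_cong_AE)
        (use pm L2_measurable[OF assms(3)] L2_measurable[OF H1_L2[OF assms(2)]] assms(4) in \<open>auto elim!: eventually_mono\<close>)
    then show "(LINT x|lebesgue_on \<Omega>. v x * partial \<phi> i x) = - (LINT x|lebesgue_on \<Omega>. grad \<Omega> u x \<bullet> i * \<phi> x)"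
      using grad(2)[OF assms(2)] \<phi> i by (simp add: weak_gradient_def)
  qed
  from H1_I[OF assms(1,3) grad(1)[OF assms(2)] this]
  show "v \<in> H1 \<Omega>" "AE x in lebesgue_on \<Omega>. grad \<Omega> v x = grad \<Omega> u x" by auto
qed

section \<open>Density of smooth functions\<close>

text \<open>Membership in the \<open>H1\<close> closure of the smooth functions, where the weak gradient of the smooth function
  is replaced by its classical gradient.\<close>

definition approximable :: "'a::euclidean_space set \<Rightarrow> ('a \<Rightarrow> real) \<Rightarrow> bool"
  where "approximable \<Omega> u \<longleftrightarrow> (\<forall>\<epsilon>>0. \<exists>\<phi>. smooth \<phi> \<and>
    (LINT x|lebesgue_on \<Omega>. (norm (\<phi> x - u x))\<^sup>2) + (LINT x|lebesgue_on \<Omega>. (norm (cgrad \<phi> x - grad \<Omega> u x))\<^sup>2) < \<epsilon>)"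

lemma cgrad_add: "smooth f \<Longrightarrow> smooth g \<Longrightarrow> cgrad (\<lambda>x. f x + g x) x = cgrad f x + cgrad g x"
  by (simp add: cgrad_def partial_add scaleR_add_left sum.distrib)

lemma LINT_norm_add_square:
  assumes "f \<in> L2 M" "g \<in> L2 M"
  shows "(LINT x|M. (norm (f x + g x))\<^sup>2) \<le> 2 * (LINT x|M. (norm (f x))\<^sup>2) + 2 * (LINT x|M. (norm (g x))\<^sup>2)"
proof -
  have "(LINT x|M. (norm (f x + g x))\<^sup>2) \<le> (LINT x|M. 2 * (norm (f x))\<^sup>2 + 2 * (norm (g x))\<^sup>2)"
    using L2_integrable[OF L2_add[OF assms]] L2_integrable[OF assms(1)] L2_integrable[OF assms(2)]
    by (intro integral_mono norm_add_square) auto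
  also have "\<dots> = 2 * (LINT x|M. (norm (f x))\<^sup>2) + 2 * (LINT x|M. (norm (g x))\<^sup>2)"
    using L2_integrable[OF assms(1)] L2_integrable[OF assms(2)] by simp
  finally show ?thesis .
qed

lemma LINT_norm_square_cong_AE:
  fixes f g :: "'a \<Rightarrow> 'b::euclidean_space"
  assumes "f \<in> borel_measurable M" "g \<in> borel_measurable M" "AE x in M. f x = g x"
  shows "(LINT x|M. (norm (f x))\<^sup>2) = (LINT x|M. (norm (g x))\<^sup>2)"
  using assms by (intro integral_cong_AE) (auto elim!: eventually_mono)

lemma approximable_add:
  assumes \<Omega>: "open \<Omega>" "bounded \<Omega>" and H: "u \<in> H1 \<Omega>" "v \<in> H1 \<Omega>" "approximable \<Omega> u" "approximable \<Omega> v"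
  shows "approximable \<Omega> (\<lambda>x. u x + v x)"
  unfolding approximable_def
proof (intro allI impI)
  fix \<epsilon> :: real assume "\<epsilon> > 0"
  then have e4: "\<epsilon>/4 > 0" by simp
  obtain \<phi> where \<phi>: "smooth \<phi>" "(LINT x|lebesgue_on \<Omega>. (norm (\<phi> x - u x))\<^sup>2) + (LINT x|lebesgue_on \<Omega>. (norm (cgrad \<phi> x - grad \<Omega> u x))\<^sup>2) < \<epsilon>/4"
    using H(3) e4 unfolding approximable_def by blast
  obtain \<psi> where \<psi>: "smooth \<psi>" "(LINT x|lebesgue_on \<Omega>. (norm (\<psi> x - v x))\<^sup>2) + (LINT x|lebesgue_on \<Omega>. (norm (cgrad \<psi> x - grad \<Omega> v x))\<^sup>2) < \<epsilon>/4"
    using H(4) e4 unfolding approximable_def by blast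
  note sm = smooth_add[OF \<phi>(1) \<psi>(1)]
  have L: "\<phi> \<in> L2 (lebesgue_on \<Omega>)" "\<psi> \<in> L2 (lebesgue_on \<Omega>)" "cgrad \<phi> \<in> L2 (lebesgue_on \<Omega>)" "cgrad \<psi> \<in> L2 (lebesgue_on \<Omega>)"
    by (intro continuous_L2 \<Omega> smooth_continuous cgrad_continuous \<phi> \<psi>)+
  note L' = H1_L2[OF H(1)] H1_L2[OF H(2)] grad(1)[OF H(1)] grad(1)[OF H(2)]
  have 1: "(LINT x|lebesgue_on \<Omega>. (norm (\<phi> x + \<psi> x - (u x + v x)))\<^sup>2)
      \<le> 2 * (LINT x|lebesgue_on \<Omega>. (norm (\<phi> x - u x))\<^sup>2) + 2 * (LINT x|lebesgue_on \<Omega>. (norm (\<psi> x - v x))\<^sup>2)"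
    using LINT_norm_add_square[OF L2_diff[OF L(1) L'(1)] L2_diff[OF L(2) L'(2)]] by (simp add: algebra_simps)
  have AE: "AE x in lebesgue_on \<Omega>. grad \<Omega> (\<lambda>x. u x + v x) x = grad \<Omega> u x + grad \<Omega> v x"
    and uv: "(\<lambda>x. u x + v x) \<in> H1 \<Omega>"
    using H1_lincomb[OF \<Omega>(1) H(1,2), of 1 1] by simp_all
  have "(LINT x|lebesgue_on \<Omega>. (norm (cgrad (\<lambda>x. \<phi> x + \<psi> x) x - grad \<Omega> (\<lambda>x. u x + v x) x))\<^sup>2)
    = (LINT x|lebesgue_on \<Omega>. (norm ((cgrad \<phi> x - grad \<Omega> u x) + (cgrad \<psi> x - grad \<Omega> v x)))\<^sup>2)"
  proof (rule LINT_norm_square_cong_AE)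
    show "(\<lambda>x. cgrad (\<lambda>x. \<phi> x + \<psi> x) x - grad \<Omega> (\<lambda>x. u x + v x) x) \<in> borel_measurable (lebesgue_on \<Omega>)"
      by (intro L2_measurable[OF L2_diff] continuous_L2 \<Omega> cgrad_continuous sm grad uv)
    show "(\<lambda>x. cgrad \<phi> x - grad \<Omega> u x + (cgrad \<psi> x - grad \<Omega> v x)) \<in> borel_measurable (lebesgue_on \<Omega>)"
      by (intro L2_measurable L2_add L2_diff L L')
    show "AE x in lebesgue_on \<Omega>. cgrad (\<lambda>x. \<phi> x + \<psi> x) x - grad \<Omega> (\<lambda>x. u x + v x) x = cgrad \<phi> x - grad \<Omega> u x + (cgrad \<psi> x - grad \<Omega> v x)"
      using AE by eventually_elim (simp add: cgrad_add \<phi> \<psi>)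
  qed
  also have "\<dots> \<le> 2 * (LINT x|lebesgue_on \<Omega>. (norm (cgrad \<phi> x - grad \<Omega> u x))\<^sup>2) + 2 * (LINT x|lebesgue_on \<Omega>. (norm (cgrad \<psi> x - grad \<Omega> v x))\<^sup>2)"
    by (intro LINT_norm_add_square L2_diff L L')
  finally show "\<exists>\<phi>. smooth \<phi> \<and> (LINT x|lebesgue_on \<Omega>. (norm (\<phi> x - (u x + v x)))\<^sup>2)
     + (LINT x|lebesgue_on \<Omega>. (norm (cgrad \<phi> x - grad \<Omega> (\<lambda>x. u x + v x) x))\<^sup>2) < \<epsilon>"
    using 1 \<phi>(2) \<psi>(2) sm by (intro exI[of _ "\<lambda>x. \<phi> x + \<psi> x"]) simp
qed

lemma approximable_zero:
  assumes \<Omega>: "open \<Omega>" "bounded \<Omega>" and u: "u \<in> H1 \<Omega>" "\<And>x. x \<in> \<Omega> \<Longrightarrow> u x = 0"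
  shows "approximable \<Omega> u"
  unfolding approximable_def
proof (intro allI impI exI[of _ "\<lambda>x. 0"] conjI smooth_const)
  fix \<epsilon> :: real assume "\<epsilon> > 0"
  have AEu: "AE x in lebesgue_on \<Omega>. 0 = u x" using u(2) by (intro AE_I2) simp
  have c: "cgrad (\<lambda>x::'a. 0) x = 0" for x
  proof -
    have "partial (\<lambda>x::'a. 0) i x = 0" for i by (rule partial_eq[where \<phi>'="\<lambda>_. 0"]) auto
    then show ?thesis by (simp add: cgrad_def)
  qed
  have z: "(\<lambda>x. 0) \<in> H1 \<Omega>" "AE x in lebesgue_on \<Omega>. grad \<Omega> (\<lambda>x. 0) x = cgrad (\<lambda>x. 0) x"
    by (intro smooth_H1 \<Omega> smooth_const)+
  have "AE x in lebesgue_on \<Omega>. grad \<Omega> u x = 0"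
    using H1_AE_cong(2)[OF \<Omega>(1) z(1) H1_L2[OF u(1)] AEu] z(2) by eventually_elim (simp add: c)
  then have "(LINT x|lebesgue_on \<Omega>. (norm (cgrad (\<lambda>x. 0) x - grad \<Omega> u x))\<^sup>2) = (LINT x|lebesgue_on \<Omega>. (norm (0::'a))\<^sup>2)"
    using L2_measurable[OF grad(1)[OF u(1)]] by (intro LINT_norm_square_cong_AE) (auto simp: c elim!: eventually_mono)
  moreover have "(LINT x|lebesgue_on \<Omega>. (norm (0 - u x))\<^sup>2) = (LINT x|lebesgue_on \<Omega>. (norm (0::real))\<^sup>2)"
    using AEu L2_measurable[OF H1_L2[OF u(1)]] by (intro LINT_norm_square_cong_AE) (auto elim!: eventually_mono)
  ultimately show "(LINT x|lebesgue_on \<Omega>. (norm (0 - u x))\<^sup>2) + (LINT x|lebesgue_on \<Omega>. (norm (cgrad (\<lambda>x. 0) x - grad \<Omega> u x))\<^sup>2) < \<epsilon>"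
    using \<open>\<epsilon> > 0\<close> by simp
qed

lemma LINT_square_diff_le_extension:
  fixes v :: "'a::euclidean_space \<Rightarrow> real"
  assumes \<Omega>: "open \<Omega>" and "AE x in lebesgue_on \<Omega>. v x = V x" "\<epsilon> \<ge> 0"
    and "(\<integral>\<^sup>+x. ennreal ((f x - V x)\<^sup>2) \<partial>lborel) \<le> ennreal \<epsilon>"
  shows "(LINT x|lebesgue_on \<Omega>. (f x - v x)\<^sup>2) \<le> \<epsilon>"
proof (rule integral_real_bounded[OF \<open>\<epsilon> \<ge> 0\<close>])
  have "(\<integral>\<^sup>+x. ennreal ((f x - v x)\<^sup>2) \<partial>lebesgue_on \<Omega>) = (\<integral>\<^sup>+x. ennreal ((f x - V x)\<^sup>2) \<partial>lebesgue_on \<Omega>)"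
    by (rule nn_integral_cong_AE) (use assms(2) in \<open>auto elim!: eventually_mono\<close>)
  also have "\<dots> = (\<integral>\<^sup>+x. ennreal ((f x - V x)\<^sup>2) * indicator \<Omega> x \<partial>lebesgue)"
    using \<Omega> by (subst nn_integral_restrict_space) auto
  also have "\<dots> \<le> (\<integral>\<^sup>+x. ennreal ((f x - V x)\<^sup>2) \<partial>lebesgue)"
    by (intro nn_integral_mono) (auto simp: indicator_def)
  also have "\<dots> \<le> ennreal \<epsilon>" using assms(4) by (simp add: nn_integral_completion)
  finally show "(\<integral>\<^sup>+x. ennreal ((f x - v x)\<^sup>2) \<partial>lebesgue_on \<Omega>) \<le> ennreal \<epsilon>" .
qed

text \<open>For fixed \<open>x\<close>, the balls of radius \<open>\<rho>\<close> around \<open>x + \<rho> c\<close> sweep out a truncated cone with vertex \<open>x\<close>.\<close>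

definition inner_cone :: "'a::euclidean_space set \<Rightarrow> 'a \<Rightarrow> real \<Rightarrow> 'a \<Rightarrow> real \<Rightarrow> bool"
  where "inner_cone \<Omega> x0 r c \<rho>0 \<longleftrightarrow>
    (\<forall>x\<in>\<Omega> \<inter> ball x0 r. \<forall>\<rho>. 0 < \<rho> \<and> \<rho> < \<rho>0 \<longrightarrow> cball (x + \<rho> *\<^sub>R c) \<rho> \<subseteq> \<Omega>)"

lemma L2_bounded_support_integrable:
  fixes V :: "'a::euclidean_space \<Rightarrow> real"
  assumes "V \<in> L2 lborel" "open \<Omega>" "bounded \<Omega>" "\<And>x. x \<notin> \<Omega> \<Longrightarrow> V x = 0"
  shows "integrable lborel V"
proof (rule Bochner_Integration.integrable_bound)
  have "integrable lborel (indicator \<Omega> :: 'a \<Rightarrow> real)"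
    using assms emeasure_bounded_finite[OF assms(3)] by (intro integrable_real_indicator) (auto simp: less_top)
  then show "integrable lborel (\<lambda>x. (norm (V x))\<^sup>2 + indicator \<Omega> x)"
    using L2_integrable[OF assms(1)] by auto
  show "V \<in> borel_measurable lborel" by (rule L2_measurable[OF assms(1)])
  have "\<bar>V x\<bar> \<le> (norm (V x))\<^sup>2 + indicator \<Omega> x" for x
  proof (cases "x \<in> \<Omega>")
    case True
    have "0 \<le> (\<bar>V x\<bar> - 1/2)\<^sup>2" by simp
    then show ?thesis using True by (simp add: power2_diff power_divide)
  qed (simp add: assms(4))
  then show "AE x in lborel. norm (V x) \<le> norm ((norm (V x))\<^sup>2 + indicator \<Omega> x)" by simp
qed

text \<open>The mollifier is supported in a ball of radius \<open>\<rho>\<close> around \<open>\<rho> c\<close>. For \<open>x \<in> \<Omega>\<close> near \<open>x0\<close>, averaging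
  around \<open>x\<close> then uses values inside \<open>\<Omega>\<close> only, and the translated mollifier is a test function
  on \<open>\<Omega>\<close>. So the mollification of \<open>\<beta> u\<close>, extended by zero, has as classical gradient in \<open>\<Omega>\<close> the
  mollification of the weak gradient.\<close>

lemma approximable_local:
  assumes \<Omega>: "open \<Omega>" "bounded \<Omega>" and r: "r > 0" and \<rho>0: "\<rho>0 > 0" and cone: "inner_cone \<Omega> x0 r c \<rho>0"
    and \<beta>: "smooth \<beta>" "\<And>x. x \<notin> ball x0 (r/2) \<Longrightarrow> \<beta> x = 0" and u: "u \<in> H1 \<Omega>"
  shows "approximable \<Omega> (\<lambda>x. \<beta> x * u x)"
  unfolding approximable_def
proof (intro allI impI)
  fix \<epsilon>' :: real assume "\<epsilon>' > 0"
  define \<epsilon> where "\<epsilon> = \<epsilon>' / (2 * (1 + real DIM('a)))"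
  have \<epsilon>: "\<epsilon> > 0" using \<open>\<epsilon>' > 0\<close> by (simp add: \<epsilon>_def)
  let ?v = "\<lambda>x. \<beta> x * u x" and ?G = "\<lambda>x. \<beta> x *\<^sub>R grad \<Omega> u x + u x *\<^sub>R cgrad \<beta> x"
  note v = smooth_mult_H1[OF \<Omega> \<beta>(1) u]
  have G: "?G \<in> L2 (lebesgue_on \<Omega>)"
  proof (rule L2_AE_cong[OF grad(1)[OF v(1)] _ v(2)])
    have "cgrad \<beta> \<in> borel_measurable (lebesgue_on \<Omega>)" "\<beta> \<in> borel_measurable (lebesgue_on \<Omega>)"
      by (intro borel_measurable_lebesgue_on borel_measurable_continuous_onI cgrad_continuous smooth_continuous \<beta>)+
    then show "?G \<in> borel_measurable (lebesgue_on \<Omega>)"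
      using L2_measurable[OF grad(1)[OF u]] L2_measurable[OF H1_L2[OF u]] by measurable
  qed
  have wgG: "(LINT x|lebesgue_on \<Omega>. ?v x * partial \<phi> i x) = - (LINT x|lebesgue_on \<Omega>. (?G x \<bullet> i) * \<phi> x)"
    if \<phi>: "\<phi> \<in> test_functions \<Omega>" and i: "i \<in> Basis" for \<phi> i
  proof -
    have m: "\<phi> \<in> borel_measurable (lebesgue_on \<Omega>)" using test_function_L2[OF \<Omega>(1) \<phi>] L2_measurable by blast
    have "(LINT x|lebesgue_on \<Omega>. grad \<Omega> ?v x \<bullet> i * \<phi> x) = (LINT x|lebesgue_on \<Omega>. (?G x \<bullet> i) * \<phi> x)"
      by (rule integral_cong_AE)
        (use m L2_measurable[OF grad(1)[OF v(1)]] L2_measurable[OF G] v(2) in \<open>auto elim!: eventually_mono\<close>)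
    then show ?thesis using grad(2)[OF v(1)] \<phi> i by (simp add: weak_gradient_def)
  qed
  obtain V where V: "V \<in> L2 lborel" "\<And>x. x \<notin> \<Omega> \<Longrightarrow> V x = 0" "AE x in lebesgue_on \<Omega>. ?v x = V x"
    "\<And>\<phi>. \<phi> \<in> borel_measurable borel \<Longrightarrow> (LINT x|lebesgue_on \<Omega>. ?v x * \<phi> x) = (LINT x|lborel. \<phi> x * V x)"
    by (rule L2_extension[OF \<Omega>(1) H1_L2[OF v(1)]], rule that)
  have "\<exists>W. W \<in> L2 lborel \<and> (AE x in lebesgue_on \<Omega>. ?G x \<bullet> i = W x) \<and>
    (\<forall>\<phi>\<in>borel_measurable borel. (LINT x|lebesgue_on \<Omega>. (?G x \<bullet> i) * \<phi> x) = (LINT x|lborel. \<phi> x * W x))"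
    if "i \<in> Basis" for i
  proof -
    have "(\<lambda>x. ?G x \<bullet> i) \<in> L2 (lebesgue_on \<Omega>)" using that by (intro L2_inner_component[OF G]) simp
    then show ?thesis by (rule L2_extension[OF \<Omega>(1)]) blast
  qed
  then have "\<forall>i\<in>Basis. \<exists>W. W \<in> L2 lborel \<and> (AE x in lebesgue_on \<Omega>. ?G x \<bullet> i = W x) \<and>
    (\<forall>\<phi>\<in>borel_measurable borel. (LINT x|lebesgue_on \<Omega>. (?G x \<bullet> i) * \<phi> x) = (LINT x|lborel. \<phi> x * W x))" ..
  from bchoice[OF this] obtain W where W': "\<forall>i\<in>Basis. W i \<in> L2 lborel \<and> (AE x in lebesgue_on \<Omega>. ?G x \<bullet> i = W i x) \<and>
    (\<forall>\<phi>\<in>borel_measurable borel. (LINT x|lebesgue_on \<Omega>. (?G x \<bullet> i) * \<phi> x) = (LINT x|lborel. \<phi> x * W i x))" ..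
  note W = W'[rule_format, THEN conjunct1] W'[rule_format, THEN conjunct2, THEN conjunct1]
    W'[rule_format, THEN conjunct2, THEN conjunct2, rule_format]
  obtain \<delta>V where \<delta>V: "\<delta>V > 0" "\<And>z. norm z < \<delta>V \<Longrightarrow> (\<integral>\<^sup>+x. ennreal ((V (x + z) - V x)\<^sup>2) \<partial>lborel) \<le> ennreal \<epsilon>"
    using L2_translation_continuous[OF V(1) \<epsilon>] by metis
  have "\<exists>\<delta>>0. \<forall>z. norm z < \<delta> \<longrightarrow> (\<integral>\<^sup>+x. ennreal ((W i (x + z) - W i x)\<^sup>2) \<partial>lborel) \<le> ennreal \<epsilon>" if "i \<in> Basis" for i
    using L2_translation_continuous[OF W(1)[OF that] \<epsilon>] by metis
  then obtain \<delta>W where \<delta>W: "\<And>i. i \<in> Basis \<Longrightarrow> \<delta>W i > 0"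
    "\<And>i z. i \<in> Basis \<Longrightarrow> norm z < \<delta>W i \<Longrightarrow> (\<integral>\<^sup>+x. ennreal ((W i (x + z) - W i x)\<^sup>2) \<partial>lborel) \<le> ennreal \<epsilon>"
    by metis
  define \<delta> where "\<delta> = Min (insert (r/2) (insert \<delta>V (\<delta>W ` Basis)))"
  have "\<delta> > 0" using r \<delta>V(1) \<delta>W(1) by (simp add: \<delta>_def)
  moreover have "\<delta> \<le> r/2" "\<delta> \<le> \<delta>V" "\<And>i. i \<in> Basis \<Longrightarrow> \<delta> \<le> \<delta>W i"
    unfolding \<delta>_def by (rule Min_le; simp)+
  ultimately have \<delta>: "\<delta> > 0" "\<delta> \<le> r/2" "\<delta> \<le> \<delta>V" "\<And>i. i \<in> Basis \<Longrightarrow> \<delta> \<le> \<delta>W i" by blast+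
  define \<rho> where "\<rho> = min (\<rho>0 / 2) (\<delta> / (2 * (norm c + 1)))"
  have nc: "norm c + 1 > 0" using norm_ge_zero[of c] by linarith
  have \<rho>: "\<rho> > 0" "\<rho> < \<rho>0" using \<rho>0 \<delta>(1) nc by (auto simp: \<rho>_def)
  have "\<rho> * (norm c + 1) \<le> \<delta> / 2"
  proof -
    have "\<rho> * (norm c + 1) \<le> \<delta> / (2 * (norm c + 1)) * (norm c + 1)"
      using nc by (intro mult_right_mono) (auto simp: \<rho>_def)
    also have "\<dots> = \<delta> / 2" using nc by (simp add: divide_simps)
    finally show ?thesis .
  qed
  then have \<rho>c: "\<rho> * norm c + \<rho> < \<delta>" using \<delta>(1) by (simp add: algebra_simps)
  obtain k :: "'a \<Rightarrow> real" where k: "smooth k" "k \<in> test_functions UNIV"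
    "closure {x. k x \<noteq> 0} \<subseteq> cball (\<rho> *\<^sub>R c) \<rho>" "\<And>z. k z \<noteq> 0 \<Longrightarrow> z \<in> ball (\<rho> *\<^sub>R c) \<rho>"
    "\<And>z. k z \<ge> 0" "(\<integral>\<^sup>+z. ennreal (k z) \<partial>lborel) = 1" "k \<in> L2 lborel"
    using mollifier_exists[OF \<rho>(1), of "\<rho> *\<^sub>R c"] by metis
  have small: "norm z < \<delta>" if "z \<in> cball (\<rho> *\<^sub>R c) \<rho>" for z
  proof -
    have "norm z \<le> norm (\<rho> *\<^sub>R c) + norm (z - \<rho> *\<^sub>R c)" using norm_triangle_ineq[of "\<rho> *\<^sub>R c" "z - \<rho> *\<^sub>R c"] by simp
    also have "\<dots> \<le> \<rho> * norm c + \<rho>" using that \<rho>(1) by (simp add: dist_norm norm_minus_commute)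
    finally show ?thesis using \<rho>c by simp
  qed
  have kz: "norm z < \<delta>" if "k z \<noteq> 0" for z using small[of z] k(4)[OF that] by simp
  have pkz: "norm z < \<delta>" if "partial k i z \<noteq> 0" for z i using small[of z] partial_zero_outside[of z k i] subsetD[OF k(3), of z] that by blast
  have Vint: "integrable lborel V" by (rule L2_bounded_support_integrable[OF V(1) \<Omega> V(2)])
  let ?\<phi> = "conv k V"
  have sm: "smooth ?\<phi>" by (rule smooth_conv[OF k(2) Vint])
  have \<beta>0: "\<beta> y = 0 \<and> cgrad \<beta> y = 0" if "y \<notin> cball x0 (r/2)" for y
  proof -
    have "closure {x. \<beta> x \<noteq> 0} \<subseteq> cball x0 (r/2)" using \<beta>(2) by (intro closure_minimal) (force, simp)
    then have "y \<notin> closure {x. \<beta> x \<noteq> 0}" using that by auto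
    then have "partial \<beta> i y = 0" for i by (rule partial_zero_outside)
    then show ?thesis using \<beta>(2)[of y] that by (auto simp: cgrad_def)
  qed
  \<comment> \<open>Away from \<open>x0\<close> both sides vanish, because \<open>\<beta>\<close> is zero within reach of the mollifier.\<close>
  have part: "partial ?\<phi> i x = conv k (W i) x" if i: "i \<in> Basis" and x: "x \<in> \<Omega>" for i x
  proof -
    have "partial ?\<phi> i x = - (LINT y|lborel. partial k i (y - x) * V y)"
      using conv_partial[OF k(2) Vint i] by (simp add: conv_def)
    also have "\<dots> = - (LINT y|lebesgue_on \<Omega>. ?v y * partial k i (y - x))"
      using V(4)[of "\<lambda>y. partial k i (y - x)"] smooth_measurable[OF smooth_shift[OF smooth_partial[OF k(1) i]]] by metis
    also have "\<dots> = (LINT y|lebesgue_on \<Omega>. (?G y \<bullet> i) * k (y - x))"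
    proof (cases "x \<in> ball x0 r")
      case True
      have "cball (x + \<rho> *\<^sub>R c) \<rho> \<subseteq> \<Omega>" using cone True x \<rho> by (simp add: inner_cone_def)
      then have "(\<lambda>y. k (y - x)) \<in> test_functions \<Omega>" by (rule test_functions_shift[OF k(1,3)])
      from wgG[OF this i] show ?thesis by (simp add: partial_shift[OF k(1)])
    next
      case False
      have far: "y \<notin> cball x0 (r/2)" if "norm (y - x) < \<delta>" for y
      proof
        assume "y \<in> cball x0 (r/2)"
        then have "dist x0 x < r/2 + r/2"
          using that \<delta>(2) dist_triangle[of x0 x y] by (simp add: dist_norm)
        then show False using False by simp
      qed
      have "?v y * partial k i (y - x) = 0" for y using far[of y] \<beta>0[of y] pkz[of i "y - x"] by fastforce
      moreover have "(?G y \<bullet> i) * k (y - x) = 0" for y using far[of y] \<beta>0[of y] kz[of "y - x"] by fastforce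
      ultimately show ?thesis by (simp only: Bochner_Integration.integral_zero minus_zero)
    qed
    also have "\<dots> = conv k (W i) x"
      using W(3)[OF i, of "\<lambda>y. k (y - x)"] smooth_measurable[OF smooth_shift[OF k(1)]] by (simp add: conv_def)
    finally show ?thesis .
  qed
  have 1: "(LINT x|lebesgue_on \<Omega>. (?\<phi> x - ?v x)\<^sup>2) \<le> \<epsilon>"
  proof (rule LINT_square_diff_le_extension[OF \<Omega>(1) V(3)])
    show "(\<integral>\<^sup>+x. ennreal ((?\<phi> x - V x)\<^sup>2) \<partial>lborel) \<le> ennreal \<epsilon>"
      by (rule conv_approximates[OF V(1) k(7,5,6)]) (use kz \<delta>V(2) \<delta>(3) in fastforce)
  qed (use \<epsilon> in simp)
  have 2: "(LINT x|lebesgue_on \<Omega>. (partial ?\<phi> i x - ?G x \<bullet> i)\<^sup>2) \<le> \<epsilon>" if i: "i \<in> Basis" for i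
  proof -
    have "(LINT x|lebesgue_on \<Omega>. (partial ?\<phi> i x - ?G x \<bullet> i)\<^sup>2) = (LINT x|lebesgue_on \<Omega>. (conv k (W i) x - ?G x \<bullet> i)\<^sup>2)"
      by (rule Bochner_Integration.integral_cong) (auto simp: part[OF i])
    also have "\<dots> \<le> \<epsilon>"
    proof (rule LINT_square_diff_le_extension[OF \<Omega>(1) W(2)[OF i]])
      show "(\<integral>\<^sup>+x. ennreal ((conv k (W i) x - W i x)\<^sup>2) \<partial>lborel) \<le> ennreal \<epsilon>"
        by (rule conv_approximates[OF W(1)[OF i] k(7,5,6)]) (use kz \<delta>W(2)[OF i] \<delta>(4)[OF i] in fastforce)
    qed (use \<epsilon> in simp)
    finally show ?thesis .
  qed
  have cL: "cgrad ?\<phi> \<in> L2 (lebesgue_on \<Omega>)" by (intro continuous_L2 \<Omega> cgrad_continuous sm)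
  have "(LINT x|lebesgue_on \<Omega>. (norm (cgrad ?\<phi> x - grad \<Omega> ?v x))\<^sup>2) = (LINT x|lebesgue_on \<Omega>. (norm (cgrad ?\<phi> x - ?G x))\<^sup>2)"
    by (rule LINT_norm_square_cong_AE)
      (use L2_measurable[OF L2_diff[OF cL grad(1)[OF v(1)]]] L2_measurable[OF L2_diff[OF cL G]] v(2) in \<open>auto elim!: eventually_mono\<close>)
  also have "\<dots> = (LINT x|lebesgue_on \<Omega>. (\<Sum>i\<in>Basis. (partial ?\<phi> i x - ?G x \<bullet> i)\<^sup>2))"
  proof (rule Bochner_Integration.integral_cong)
    fix x
    have "(norm (cgrad ?\<phi> x - ?G x))\<^sup>2 = (\<Sum>i\<in>Basis. ((cgrad ?\<phi> x - ?G x) \<bullet> i)\<^sup>2)"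
      unfolding power2_norm_eq_inner by (subst euclidean_inner) (simp only: power2_eq_square)
    then show "(norm (cgrad ?\<phi> x - ?G x))\<^sup>2 = (\<Sum>i\<in>Basis. (partial ?\<phi> i x - ?G x \<bullet> i)\<^sup>2)"
      by (simp add: inner_diff_left[of "cgrad ?\<phi> x"] cgrad_inner)
  qed simp
  also have "\<dots> = (\<Sum>i\<in>Basis. (LINT x|lebesgue_on \<Omega>. (partial ?\<phi> i x - ?G x \<bullet> i)\<^sup>2))"
  proof (rule Bochner_Integration.integral_sum)
    fix i :: 'a assume i: "i \<in> Basis"
    have "(\<lambda>x. (cgrad ?\<phi> x - ?G x) \<bullet> i) \<in> L2 (lebesgue_on \<Omega>)"
      by (intro L2_inner_component L2_diff cL G) (simp add: i)
    then have "integrable (lebesgue_on \<Omega>) (\<lambda>x. ((cgrad ?\<phi> x - ?G x) \<bullet> i)\<^sup>2)" using L2_integrable by fastforce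
    then show "integrable (lebesgue_on \<Omega>) (\<lambda>x. (partial ?\<phi> i x - ?G x \<bullet> i)\<^sup>2)"
      by (simp only: inner_diff_left[of "cgrad ?\<phi> _"] cgrad_inner[OF i])
  qed
  also have "\<dots> \<le> (\<Sum>i\<in>(Basis::'a set). \<epsilon>)" by (rule sum_mono) (rule 2)
  also have "\<dots> = real DIM('a) * \<epsilon>" by simp
  finally have "(LINT x|lebesgue_on \<Omega>. (norm (?\<phi> x - ?v x))\<^sup>2) + (LINT x|lebesgue_on \<Omega>. (norm (cgrad ?\<phi> x - grad \<Omega> ?v x))\<^sup>2)
    \<le> (1 + real DIM('a)) * \<epsilon>" using 1 by (simp add: distrib_right)
  also have "\<dots> < \<epsilon>'" using \<open>\<epsilon>' > 0\<close> by (simp add: \<epsilon>_def field_simps add_pos_nonneg)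
  finally show "\<exists>\<phi>. smooth \<phi> \<and> (LINT x|lebesgue_on \<Omega>. (norm (\<phi> x - ?v x))\<^sup>2) + (LINT x|lebesgue_on \<Omega>. (norm (cgrad \<phi> x - grad \<Omega> ?v x))\<^sup>2) < \<epsilon>'"
    using sm by blast
qed

text \<open>At a boundary point take \<open>c = (1 + L) b\<close>, where \<open>\<Omega>\<close> lies above an \<open>L\<close>-Lipschitz graph in direction
  \<open>b\<close>. Moving up by \<open>\<rho> (1 + L)\<close> compensates a displacement of length \<open>\<rho>\<close>, which lowers the height by at
  most \<open>\<rho>\<close> and raises the graph by at most \<open>L \<rho>\<close>.\<close>

lemma inner_cone_exists:
  assumes \<Omega>: "smooth_bounded_domain \<Omega>" and x0: "x0 \<in> closure \<Omega>"
  obtains r c \<rho>0 where "r > 0" "\<rho>0 > 0" "inner_cone \<Omega> x0 r c \<rho>0"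
proof (cases "x0 \<in> \<Omega>")
  case True
  obtain e where e: "e > 0" "ball x0 e \<subseteq> \<Omega>" using \<Omega> True openE by (auto simp: smooth_bounded_domain_def)
  have "inner_cone \<Omega> x0 (e/2) 0 (e/2)"
    unfolding inner_cone_def
  proof (intro ballI allI impI)
    fix x \<rho> assume x: "x \<in> \<Omega> \<inter> ball x0 (e/2)" and \<rho>: "0 < \<rho> \<and> \<rho> < e/2"
    have "cball (x + \<rho> *\<^sub>R 0) \<rho> \<subseteq> ball x0 e"
    proof
      fix y assume "y \<in> cball (x + \<rho> *\<^sub>R 0) \<rho>"
      then show "y \<in> ball x0 e" using x \<rho> dist_triangle[of x0 y x] by simp
    qed
    then show "cball (x + \<rho> *\<^sub>R 0) \<rho> \<subseteq> \<Omega>" using e(2) by blast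
  qed
  with e(1) that[of "e/2" "e/2" 0] show ?thesis by simp
next
  case False
  then have "x0 \<in> frontier \<Omega>" using x0 \<Omega> by (simp add: smooth_bounded_domain_def frontier_def interior_open)
  then obtain r b \<gamma> where r: "r > 0" and b: "b \<in> Basis \<union> uminus ` Basis" and \<gamma>: "smooth \<gamma>"
    "\<And>x t. \<gamma> (x + t *\<^sub>R b) = \<gamma> x" "\<Omega> \<inter> ball x0 r = {x \<in> ball x0 r. \<gamma> x < x \<bullet> b}"
  proof -
    have "smooth_boundary \<Omega>" using \<Omega> by (simp add: smooth_bounded_domain_def)
    then show ?thesis using \<open>x0 \<in> frontier \<Omega>\<close> that unfolding smooth_boundary_def by blast
  qed
  have nb: "norm b = 1" using b by auto
  obtain L where L: "L \<ge> 0" "\<And>x y. x \<in> cball x0 r \<Longrightarrow> y \<in> cball x0 r \<Longrightarrow> \<bar>\<gamma> x - \<gamma> y\<bar> \<le> L * norm (x - y)"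
    using smooth_lipschitz_on_compact[OF \<gamma>(1) compact_cball convex_cball] by metis
  define M where "M = 1 + L"
  define \<rho>0 where "\<rho>0 = r / (2 * (M + 1))"
  have M: "M > 0" using L(1) by (simp add: M_def)
  have \<rho>0: "\<rho>0 > 0" using r M by (simp add: \<rho>0_def)
  have "inner_cone \<Omega> x0 (r/2) (M *\<^sub>R b) \<rho>0"
    unfolding inner_cone_def
  proof (intro ballI allI impI subsetI)
    fix x \<rho> y assume x: "x \<in> \<Omega> \<inter> ball x0 (r/2)" and \<rho>: "0 < \<rho> \<and> \<rho> < \<rho>0" and y: "y \<in> cball (x + \<rho> *\<^sub>R M *\<^sub>R b) \<rho>"
    define w where "w = y - (x + (\<rho> * M) *\<^sub>R b)"
    have w: "norm w \<le> \<rho>" using y by (simp add: w_def dist_norm norm_minus_commute)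
    have y_eq: "y = (x + w) + (\<rho> * M) *\<^sub>R b" by (simp add: w_def)
    have "\<rho> * (M + 1) < \<rho>0 * (M + 1)" using \<rho> M by (intro mult_strict_right_mono) auto
    moreover have "\<rho>0 * (M + 1) = r/2" using M by (simp add: \<rho>0_def field_simps)
    ultimately have \<rho>M: "\<rho> * M + \<rho> < r/2" by (simp add: distrib_left)
    have xr: "dist x0 x < r/2" using x by simp
    have "dist x y \<le> norm w + \<rho> * M"
      using norm_triangle_ineq[of w "(\<rho> * M) *\<^sub>R b"] nb \<rho> M unfolding dist_commute[of x] by (simp add: y_eq dist_norm)
    then have yr: "y \<in> ball x0 r" using xr \<rho>M w dist_triangle[of x0 y x] by simp
    have "0 \<le> \<rho> * M" using \<rho> M by simp
    then have xw: "x + w \<in> cball x0 r"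
      using xr \<rho>M w dist_triangle[of x0 "x + w" x] by (simp add: dist_norm[of x])
    have "\<gamma> y = \<gamma> (x + w)" unfolding y_eq by (rule \<gamma>(2))
    also have "\<dots> \<le> \<gamma> x + L * norm w" using L(2)[OF xw, of x] xr r by (simp add: dist_norm)
    also have "\<dots> \<le> \<gamma> x + L * \<rho>" using w L(1) by (simp add: mult_left_mono)
    also have "\<dots> < x \<bullet> b + L * \<rho>"
    proof -
      have "x \<in> \<Omega> \<inter> ball x0 r" using x xr r by auto
      then show ?thesis using \<gamma>(3) by auto
    qed
    also have "\<dots> = x \<bullet> b + \<rho> * M - \<rho>" by (simp add: M_def algebra_simps)
    also have "\<dots> \<le> y \<bullet> b"
    proof -
      have "\<bar>w \<bullet> b\<bar> \<le> \<rho>" using Cauchy_Schwarz_ineq2[of w b] nb w by simp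
      moreover have "b \<bullet> b = 1" using nb by (simp add: norm_eq_1)
      ultimately show ?thesis by (simp add: y_eq inner_add_left)
    qed
    finally have "y \<in> {x \<in> ball x0 r. \<gamma> x < x \<bullet> b}" using yr by simp
    then show "y \<in> \<Omega>" using \<gamma>(3) by blast
  qed
  with r \<rho>0 that[of "r/2" \<rho>0 "M *\<^sub>R b"] show ?thesis by simp
qed

text \<open>Cover the closure of \<open>\<Omega>\<close> by finitely many balls on which cutoffs \<open>\<beta>\<close> equal one. Each splitting
  \<open>u = \<beta> u + (1 - \<beta>) u\<close> reduces the claim to a function that vanishes on one more ball, until
  nothing remains.\<close>

theorem smooth_dense_H1:
  assumes \<Omega>: "smooth_bounded_domain \<Omega>" and u: "u \<in> H1 \<Omega>"
  shows "approximable \<Omega> u"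
proof -
  have ob: "open \<Omega>" "bounded \<Omega>" using \<Omega> by (auto simp: smooth_bounded_domain_def)
  have "\<exists>r c \<rho>0. r > 0 \<and> \<rho>0 > 0 \<and> inner_cone \<Omega> x r c \<rho>0" if "x \<in> closure \<Omega>" for x
    using inner_cone_exists[OF \<Omega> that] by metis
  then obtain r c \<rho>0 where cone: "\<And>x. x \<in> closure \<Omega> \<Longrightarrow> r x > 0 \<and> \<rho>0 x > 0 \<and> inner_cone \<Omega> x (r x) (c x) (\<rho>0 x)"
    by metis
  have "\<exists>\<beta>. smooth \<beta> \<and> (\<forall>y\<in>ball x (r x / 2 / 2). \<beta> y = 1) \<and> (\<forall>y. y \<notin> ball x (r x / 2) \<longrightarrow> \<beta> y = 0)"
    if "x \<in> closure \<Omega>" for x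
    using cutoff_exists[of "r x / 2" x] cone[OF that] by (metis half_gt_zero)
  then obtain \<beta> where \<beta>: "\<And>x. x \<in> closure \<Omega> \<Longrightarrow> smooth (\<beta> x) \<and> (\<forall>y\<in>ball x (r x / 2 / 2). \<beta> x y = 1) \<and> (\<forall>y. y \<notin> ball x (r x / 2) \<longrightarrow> \<beta> x y = 0)"
    by metis
  have comp: "compact (closure \<Omega>)" using ob by simp
  have cov: "closure \<Omega> \<subseteq> (\<Union>x\<in>closure \<Omega>. ball x (r x / 2 / 2))" using cone by force
  obtain F where F: "F \<subseteq> closure \<Omega>" "finite F" "closure \<Omega> \<subseteq> (\<Union>x\<in>F. ball x (r x / 2 / 2))"
    using compactE_image[OF comp open_ball cov] by blast
  have "finite F \<Longrightarrow> F \<subseteq> closure \<Omega> \<Longrightarrow> u \<in> H1 \<Omega> \<Longrightarrow> (\<And>y. y \<in> \<Omega> - (\<Union>x\<in>F. ball x (r x / 2 / 2)) \<Longrightarrow> u y = 0) \<Longrightarrow> approximable \<Omega> u" for u F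
  proof (induction F arbitrary: u rule: finite_induct)
    case empty
    then show ?case by (intro approximable_zero[OF ob]) auto
  next
    case (insert x F)
    have x: "x \<in> closure \<Omega>" using insert.prems by auto
    let ?b = "\<lambda>y. 1 - \<beta> x y"
    have sm: "smooth (\<beta> x)" "smooth ?b" using \<beta>[OF x] by (auto intro: smooth_diff smooth_const)
    have a1: "approximable \<Omega> (\<lambda>y. \<beta> x y * u y)"
      using approximable_local[OF ob, of "r x" "\<rho>0 x" x "c x" "\<beta> x" u] cone[OF x] \<beta>[OF x] insert.prems(2) by blast
    have h: "(\<lambda>y. ?b y * u y) \<in> H1 \<Omega>" "(\<lambda>y. \<beta> x y * u y) \<in> H1 \<Omega>"
      by (intro smooth_mult_H1 ob sm insert.prems)+
    have a2: "approximable \<Omega> (\<lambda>y. ?b y * u y)"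
    proof (rule insert.IH[OF _ h(1)])
      show "F \<subseteq> closure \<Omega>" using insert.prems by auto
      show "?b y * u y = 0" if "y \<in> \<Omega> - (\<Union>x\<in>F. ball x (r x / 2 / 2))" for y
        using that insert.prems(3)[of y] \<beta>[OF x] by (cases "y \<in> ball x (r x / 2 / 2)") auto
    qed
    have "approximable \<Omega> (\<lambda>y. \<beta> x y * u y + ?b y * u y)" by (rule approximable_add[OF ob h(2,1) a1 a2])
    then show ?case by (simp add: algebra_simps)
  qed
  from this[OF F(2,1) u] show ?thesis using F(3) closure_subset[of \<Omega>] by blast
qed

section \<open>Surface measure and the trace inequality\<close>

lemma sets_hausdorff_measure [simp, measurable_cong]: "sets (hausdorff_measure m :: 'a::metric_space measure) = sets borel"
proof -
  have "sigma_sets UNIV (sets (borel :: 'a measure)) = sets borel"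
    using sets.sigma_sets_eq[of "borel :: 'a measure"] by simp
  then show ?thesis by (simp add: hausdorff_measure_def)
qed

lemma space_hausdorff_measure [simp]: "space (hausdorff_measure m :: 'a::metric_space measure) = UNIV"
  by (simp add: hausdorff_measure_def)

text \<open>\<open>measure_of\<close> is the outer measure if that is countably additive on the Borel sets, and zero otherwise.\<close>

lemma emeasure_hausdorff_le_outer: "emeasure (hausdorff_measure m) A \<le> hausdorff_outer m A"
  unfolding hausdorff_measure_def emeasure_measure_of_conv by simp

lemma hausdorff_content_le_sum:
  assumes "finite F" "A \<subseteq> (\<Union>c\<in>F. U c)" "\<And>c. c \<in> F \<Longrightarrow> bounded (U c) \<and> diameter (U c) \<le> d" "0 \<le> d" "d \<le> \<delta>" "m > 0"
  shows "hausdorff_content m \<delta> A \<le> of_nat (card F) * ennreal (unit_ball_vol (real m) * (d / 2) ^ m)"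
proof -
  obtain f where f: "bij_betw f {..<card F} F"
    using ex_bij_betw_nat_finite[OF assms(1)] by (auto simp: atLeast0LessThan)
  define V where "V n = (if n < card F then U (f n) else {})" for n
  have fF: "f n \<in> F" if "n < card F" for n using bij_betwE[OF f] that by auto
  have cover: "A \<subseteq> (\<Union>n. V n)"
  proof
    fix x assume "x \<in> A"
    then obtain c where c: "c \<in> F" "x \<in> U c" using assms(2) by blast
    then obtain n where "n < card F" "f n = c"
      using f by (metis bij_betw_imp_surj_on imageE lessThan_iff)
    then show "x \<in> (\<Union>n. V n)" using c by (auto simp: V_def)
  qed
  have V: "bounded (V n) \<and> diameter (V n) \<le> \<delta>" for n
    using assms(3)[OF fF[of n]] assms(4,5) by (cases "n < card F") (auto simp: V_def)
  have "hausdorff_content m \<delta> A \<le> (\<Sum>i. ennreal (unit_ball_vol (real m) * (diameter (V i) / 2) ^ m))"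
    unfolding hausdorff_content_def by (rule INF_lower) (use cover V in auto)
  also have "\<dots> = (\<Sum>i<card F. ennreal (unit_ball_vol (real m) * (diameter (V i) / 2) ^ m))"
    by (rule suminf_finite) (use assms(6) in \<open>auto simp: V_def diameter_def\<close>)
  also have "\<dots> \<le> (\<Sum>i<card F. ennreal (unit_ball_vol (real m) * (d / 2) ^ m))"
  proof (rule sum_mono)
    fix i assume "i \<in> {..<card F}"
    then have i: "i < card F" by simp
    have "diameter (V i) \<le> d" "0 \<le> diameter (V i)"
      using assms(3)[OF fF[OF i]] i by (auto simp: V_def diameter_ge_0)
    then show "ennreal (unit_ball_vol (real m) * (diameter (V i) / 2) ^ m) \<le> ennreal (unit_ball_vol (real m) * (d / 2) ^ m)"
      by (intro ennreal_leI mult_left_mono power_mono) auto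
  qed
  finally show ?thesis by simp
qed

text \<open>A boundary chart around \<open>x0\<close>: the graph of \<open>\<gamma>\<close> in the direction \<open>b\<close>, which is the coordinate axis
  \<open>e\<close> up to sign. The constant \<open>L\<close> is a Lipschitz constant of \<open>\<gamma>\<close>, and \<open>h\<close> is the height of a
  cylinder above the graph.\<close>

locale boundary_patch =
  fixes \<Omega> :: "'a::euclidean_space set" and x0 b e :: 'a and r L h :: real and \<gamma> :: "'a \<Rightarrow> real"
  assumes pos: "r > 0" "h > 0" "h \<le> r/2" "L \<ge> 0" and e: "e \<in> Basis" and b: "b = e \<or> b = - e"
    and \<gamma>: "smooth \<gamma>" "\<And>x t. \<gamma> (x + t *\<^sub>R b) = \<gamma> x"
    and \<Omega>: "open \<Omega>" "\<Omega> \<inter> ball x0 r = {x \<in> ball x0 r. \<gamma> x < x \<bullet> b}"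
    and L: "\<And>x y. x \<in> cball x0 r \<Longrightarrow> y \<in> cball x0 r \<Longrightarrow> \<bar>\<gamma> x - \<gamma> y\<bar> \<le> L * norm (x - y)"
    and dim: "DIM('a) \<ge> 2"
begin

lemma b_simps: "norm b = 1" "b \<bullet> b = 1"
  using b e by auto

text \<open>\<open>P\<close> projects onto the graph along \<open>b\<close>. The cylinder lies above a larger part of the graph than
  \<open>patch\<close>, so that it contains the cylinders above small neighbourhoods of subsets of \<open>patch\<close>.\<close>

definition P :: "'a \<Rightarrow> 'a" where "P y = y + (\<gamma> y - y \<bullet> b) *\<^sub>R b"
definition height :: "'a \<Rightarrow> real" where "height y = y \<bullet> b - \<gamma> y"
definition cyl :: "'a set" where "cyl = {y. P y \<in> ball x0 (r/2) \<and> 0 < height y \<and> height y < h}"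
definition patch :: "'a set" where "patch = frontier \<Omega> \<inter> ball x0 (r/4)"

lemma P_add: "P (y + t *\<^sub>R b) = P y"
  by (simp add: P_def \<gamma> inner_add_left b_simps algebra_simps)

lemma height_add: "height (y + t *\<^sub>R b) = height y + t"
  by (simp add: height_def \<gamma> inner_add_left b_simps)

lemma eq_P: "y = P y + height y *\<^sub>R b"
  by (simp add: P_def height_def algebra_simps)

lemma continuous_P: "continuous_on UNIV P" and continuous_height: "continuous_on UNIV height"
  unfolding P_def[abs_def] height_def[abs_def] by (intro continuous_intros smooth_continuous \<gamma>)+

lemma measurable_P [measurable]: "P \<in> borel_measurable borel"
  and measurable_height [measurable]: "height \<in> borel_measurable borel"
  by (intro borel_measurable_continuous_onI continuous_P continuous_height)+

lemma open_cyl: "open cyl"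
proof -
  have "cyl = P -` ball x0 (r/2) \<inter> height -` {0<..<h}" by (auto simp: cyl_def)
  then show ?thesis
    using continuous_P continuous_height by (auto intro!: open_Int open_vimage)
qed

lemma measurable_cyl [measurable]: "cyl \<in> sets borel"
  using open_cyl by auto

lemma cyl_subset: "cyl \<subseteq> \<Omega> \<inter> ball x0 r"
proof
  fix y assume y: "y \<in> cyl"
  have "P y - y = (- height y) *\<^sub>R b" by (simp add: P_def height_def)
  then have "dist (P y) y = height y" using y b_simps by (simp add: dist_norm cyl_def)
  then have "y \<in> ball x0 r" using y pos dist_triangle[of x0 y "P y"] by (simp add: cyl_def)
  moreover have "\<gamma> y < y \<bullet> b" using y by (simp add: cyl_def height_def)
  ultimately show "y \<in> \<Omega> \<inter> ball x0 r" using \<Omega>(2) by blast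
qed

lemma emeasure_cyl_finite: "emeasure lborel cyl < \<infinity>"
  using cyl_subset by (intro emeasure_bounded_finite bounded_subset[OF bounded_ball]) blast

lemma patch_height: "x \<in> patch \<Longrightarrow> height x = 0"
proof -
  assume x: "x \<in> patch"
  then have xr: "x \<in> ball x0 r" using pos by (simp add: patch_def)
  have "x \<notin> \<Omega>" using x \<Omega>(1) by (auto simp: patch_def frontier_def interior_open)
  then have "height x \<le> 0" using \<Omega>(2) xr by (auto simp: height_def not_less[symmetric])
  moreover have "\<not> height x < 0"
  proof
    assume "height x < 0"
    then have "x \<in> ball x0 r \<inter> height -` {..<0}" using xr by simp
    moreover have "open (ball x0 r \<inter> height -` {..<0})"
      by (intro open_Int open_vimage continuous_height) auto
    moreover have "x \<in> closure \<Omega>" using x by (simp add: patch_def frontier_def)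
    ultimately obtain y where "y \<in> \<Omega>" "y \<in> ball x0 r" "height y < 0"
      using open_Int_closure_eq_empty[of "ball x0 r \<inter> height -` {..<0}" \<Omega>] by blast
    moreover from this have "y \<in> {x \<in> ball x0 r. \<gamma> x < x \<bullet> b}" using \<Omega>(2) by blast
    ultimately show False by (simp add: height_def)
  qed
  ultimately show ?thesis by simp
qed

lemma patch_P: "x \<in> patch \<Longrightarrow> P x = x"
  using eq_P[of x] patch_height[of x] by simp

text \<open>Points on nearby vertical lines project to nearby points of the graph: sliding \<open>y\<close> along \<open>b\<close> to the
  level of \<open>x\<close> leaves \<open>\<gamma> y\<close> unchanged and makes the distance to \<open>x\<close> that of the lines.\<close>

lemma P_close:
  assumes x: "x \<in> ball x0 (r/4)" "P x = x" and z: "norm ((y - x) - ((y - x) \<bullet> b) *\<^sub>R b) \<le> d" "d \<le> r/4"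
  shows "\<bar>\<gamma> y - \<gamma> x\<bar> \<le> L * d" "norm (P y - x) \<le> (1 + L) * d"
proof -
  define z where "z = (y - x) - ((y - x) \<bullet> b) *\<^sub>R b"
  have y: "y = (x + z) + ((y - x) \<bullet> b) *\<^sub>R b" by (simp add: z_def)
  have xz: "x + z \<in> cball x0 r" "x \<in> cball x0 r"
    using x(1) assms(3,4) pos dist_triangle[of x0 "x + z" x] by (auto simp: z_def[symmetric] dist_norm[of x])
  have "\<gamma> y = \<gamma> (x + z)" by (subst y) (rule \<gamma>)
  then have "\<bar>\<gamma> y - \<gamma> x\<bar> \<le> L * norm z" using L[OF xz] by simp
  also have "\<dots> \<le> L * d" using assms(3) pos by (intro mult_left_mono) (auto simp: z_def)
  finally show 1: "\<bar>\<gamma> y - \<gamma> x\<bar> \<le> L * d" .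
  have gx: "\<gamma> x = x \<bullet> b" using x(2) b_simps by (auto simp: P_def)
  have "P y - x = z + (\<gamma> y - \<gamma> x) *\<^sub>R b"
    by (simp add: P_def z_def gx inner_diff_left algebra_simps)
  then have "norm (P y - x) \<le> norm z + \<bar>\<gamma> y - \<gamma> x\<bar>"
    using norm_triangle_ineq[of z "(\<gamma> y - \<gamma> x) *\<^sub>R b"] b_simps by simp
  then show "norm (P y - x) \<le> (1 + L) * d" using 1 assms(3) by (simp add: z_def algebra_simps)
qed

text \<open>A grid of prisms of width \<open>s\<close>, unbounded in the direction \<open>b\<close>; \<open>corner s y\<close> is the corner of the
  prism of \<open>y\<close>, at level zero.\<close>

definition corner :: "real \<Rightarrow> 'a \<Rightarrow> 'a"
  where "corner s y = (\<Sum>i\<in>Basis - {e}. (s * of_int \<lfloor>(y \<bullet> i) / s\<rfloor>) *\<^sub>R i)"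

lemma corner_inner: "i \<in> Basis \<Longrightarrow> corner s y \<bullet> i = (if i = e then 0 else s * of_int \<lfloor>(y \<bullet> i) / s\<rfloor>)"
  unfolding corner_def by (auto simp: inner_sum_left inner_Basis if_distrib[of "\<lambda>c. _ * c"] sum.delta cong: if_cong)

lemma corner_eqI:
  assumes "s > 0" "\<And>i. i \<in> Basis \<Longrightarrow> i \<noteq> e \<Longrightarrow> corner s x \<bullet> i \<le> y \<bullet> i \<and> y \<bullet> i < corner s x \<bullet> i + s"
  shows "corner s y = corner s x"
proof (rule euclidean_eqI)
  fix i :: 'a assume i: "i \<in> Basis"
  show "corner s y \<bullet> i = corner s x \<bullet> i"
  proof (cases "i = e")
    case False
    have "\<lfloor>(y \<bullet> i) / s\<rfloor> = \<lfloor>(x \<bullet> i) / s\<rfloor>"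
      using assms(2)[OF i False] assms(1) i False
      by (intro floor_unique) (auto simp: corner_inner field_simps)
    then show ?thesis by (simp add: corner_inner i)
  qed (simp add: corner_inner e)
qed

lemma corner_bounds:
  assumes "s > 0" "i \<in> Basis" "i \<noteq> e"
  shows "corner s y \<bullet> i \<le> y \<bullet> i" "y \<bullet> i < corner s y \<bullet> i + s"
proof -
  have "of_int \<lfloor>(y \<bullet> i) / s\<rfloor> \<le> (y \<bullet> i) / s" and 2: "(y \<bullet> i) / s < of_int \<lfloor>(y \<bullet> i) / s\<rfloor> + 1" by linarith+
  then have "s * of_int \<lfloor>(y \<bullet> i) / s\<rfloor> \<le> s * ((y \<bullet> i) / s)" using assms(1) by (intro mult_left_mono) auto
  with 2 show "corner s y \<bullet> i \<le> y \<bullet> i" "y \<bullet> i < corner s y \<bullet> i + s"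
    using assms by (auto simp: corner_inner field_simps)
qed

lemma corner_eq_imp_close:
  assumes "s > 0" "corner s x = corner s y"
  shows "norm ((y - x) - ((y - x) \<bullet> b) *\<^sub>R b) \<le> real DIM('a) * s"
proof -
  let ?z = "(y - x) - ((y - x) \<bullet> b) *\<^sub>R b"
  have "norm ?z \<le> (\<Sum>i\<in>Basis. \<bar>?z \<bullet> i\<bar>)" by (rule norm_le_l1)
  also have "\<dots> \<le> (\<Sum>i\<in>(Basis::'a set). s)"
  proof (rule sum_mono)
    fix i :: 'a assume i: "i \<in> Basis"
    show "\<bar>?z \<bullet> i\<bar> \<le> s"
    proof (cases "i = e")
      case True
      then have "?z \<bullet> i = 0" using b e by (auto simp: inner_diff_left)
      then show ?thesis using assms(1) by simp
    next
      case False
      then have "b \<bullet> i = 0" using b e i by (auto simp: inner_Basis)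
      then have "?z \<bullet> i = y \<bullet> i - x \<bullet> i" by (simp add: inner_diff_left)
      then show ?thesis
        using corner_bounds[OF assms(1) i False, of x] corner_bounds[OF assms(1) i False, of y] assms(2) by (simp add: abs_le_iff)
    qed
  qed
  finally show ?thesis by simp
qed

lemma finite_corners:
  assumes "s > 0" "bounded A" shows "finite (corner s ` A)"
proof -
  obtain R where R: "\<And>x. x \<in> A \<Longrightarrow> norm x \<le> R" using assms(2) by (auto simp: bounded_iff)
  let ?I = "{\<lfloor>-R/s\<rfloor>..\<lfloor>R/s\<rfloor>}"
  let ?g = "\<lambda>k. \<Sum>i\<in>Basis - {e}. (s * of_int (k i)) *\<^sub>R i"
  have "corner s ` A \<subseteq> ?g ` ((Basis - {e}) \<rightarrow>\<^sub>E ?I)"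
  proof
    fix c assume "c \<in> corner s ` A"
    then obtain x where x: "x \<in> A" "c = corner s x" by blast
    define k where "k = restrict (\<lambda>i. \<lfloor>(x \<bullet> i) / s\<rfloor>) (Basis - {e})"
    have "\<lfloor>(x \<bullet> i) / s\<rfloor> \<in> ?I" if "i \<in> Basis" for i
    proof -
      have "\<bar>x \<bullet> i\<bar> \<le> R" using Basis_le_norm[OF that, of x] R[OF x(1)] by simp
      then have "-R \<le> x \<bullet> i" "x \<bullet> i \<le> R" by (simp_all add: abs_le_iff)
      then have "-R/s \<le> (x \<bullet> i)/s" "(x \<bullet> i)/s \<le> R/s" using assms(1) by (auto intro!: divide_right_mono simp del: divide_minus_left)
      then show ?thesis by (auto intro!: floor_mono)
    qed
    then have "k \<in> (Basis - {e}) \<rightarrow>\<^sub>E ?I" by (auto simp: k_def)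
    moreover have "c = ?g k" by (simp add: x(2) corner_def k_def)
    ultimately show "c \<in> ?g ` ((Basis - {e}) \<rightarrow>\<^sub>E ?I)" by blast
  qed
  moreover have "finite (?g ` ((Basis - {e}) \<rightarrow>\<^sub>E ?I))" by (intro finite_imageI finite_PiE) auto
  ultimately show ?thesis by (rule finite_subset)
qed

text \<open>The middle half of the cylinder above the prism of \<open>x\<close>. Over a small prism the graph is almost
  flat, so a box with constant bottom and top fits between the graph and the top of the cylinder.\<close>

definition slab :: "real \<Rightarrow> 'a \<Rightarrow> 'a set"
  where "slab s x = {y. (\<forall>i\<in>Basis - {e}. corner s x \<bullet> i < y \<bullet> i \<and> y \<bullet> i < corner s x \<bullet> i + s) \<and>
    \<gamma> x + h/4 < y \<bullet> b \<and> y \<bullet> b < \<gamma> x + 3*h/4}"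

lemma emeasure_slab:
  assumes "s > 0"
  shows "slab s x \<in> sets borel" "emeasure lborel (slab s x) = ennreal (s ^ (DIM('a) - 1) * (h/2))"
proof -
  define a where "a = (if b = e then \<gamma> x + h/4 else - (\<gamma> x + 3*h/4))"
  let ?l = "corner s x + a *\<^sub>R e" and ?u = "corner s x + (\<Sum>i\<in>Basis - {e}. s *\<^sub>R i) + (a + h/2) *\<^sub>R e"
  have l: "?l \<bullet> i = (if i = e then a else corner s x \<bullet> i)" if "i \<in> Basis" for i
    using that e by (auto simp: inner_add_left corner_inner inner_Basis)
  have u: "?u \<bullet> i = (if i = e then a + h/2 else corner s x \<bullet> i + s)" if "i \<in> Basis" for i
    using that e by (auto simp: inner_add_left corner_inner inner_Basis inner_sum_left if_distrib[of "\<lambda>c. _ * c"] sum.delta cong: if_cong)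
  have "b \<noteq> e \<Longrightarrow> b = - e" using b by auto
  then have ab: "(\<gamma> x + h/4 < y \<bullet> b \<and> y \<bullet> b < \<gamma> x + 3*h/4) \<longleftrightarrow> (a < y \<bullet> e \<and> y \<bullet> e < a + h/2)" for y
    by (auto simp: a_def)
  have eq: "slab s x = box ?l ?u"
  proof (rule set_eqI)
    fix y
    have "y \<in> box ?l ?u \<longleftrightarrow> (\<forall>i\<in>Basis. ?l \<bullet> i < y \<bullet> i \<and> y \<bullet> i < ?u \<bullet> i)" by (simp add: mem_box)
    also have "\<dots> \<longleftrightarrow> (\<forall>i\<in>Basis - {e}. corner s x \<bullet> i < y \<bullet> i \<and> y \<bullet> i < corner s x \<bullet> i + s) \<and> (a < y \<bullet> e \<and> y \<bullet> e < a + h/2)"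
      using e by (auto simp: l u)
    finally show "y \<in> slab s x \<longleftrightarrow> y \<in> box ?l ?u" by (simp add: slab_def ab)
  qed
  show "slab s x \<in> sets borel" unfolding eq by simp
  have le: "?l \<bullet> i \<le> ?u \<bullet> i" if "i \<in> Basis" for i using that assms pos by (simp add: l u)
  have "emeasure lborel (slab s x) = ennreal (\<Prod>i\<in>Basis. (?u - ?l) \<bullet> i)"
    unfolding eq using le by (rule emeasure_lborel_box)
  also have "(\<Prod>i\<in>Basis. (?u - ?l) \<bullet> i) = (\<Prod>i\<in>Basis. if i = e then h/2 else s)"
  proof (rule prod.cong)
    fix i :: 'a assume i: "i \<in> Basis"
    show "(?u - ?l) \<bullet> i = (if i = e then h/2 else s)"
      unfolding inner_diff_left[of ?u ?l] l[OF i] u[OF i] by simp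
  qed simp
  also have "\<dots> = h/2 * (\<Prod>i\<in>Basis - {e}. if i = e then h/2 else s)"
    using prod.remove[OF finite_Basis e, of "\<lambda>i. if i = e then h/2 else s"] by simp
  also have "(\<Prod>i\<in>Basis - {e}. if i = e then h/2 else s) = (\<Prod>i\<in>Basis - {e}. s)"
    by (rule prod.cong) auto
  also have "\<dots> = s ^ (DIM('a) - 1)" using e by (simp add: card_Diff_singleton)
  finally show "emeasure lborel (slab s x) = ennreal (s ^ (DIM('a) - 1) * (h/2))" by (simp add: mult.commute)
qed

text \<open>A cell of diameter \<open>(1 + L) DIM s\<close> contributes the ball volume of that diameter to the Hausdorff content,
  and its slab has volume \<open>s\<^sup>m h / 2\<close>, with \<open>m = DIM - 1\<close>. This is the ratio.\<close>

definition K :: real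
  where "K = unit_ball_vol (real (DIM('a) - 1)) * ((1 + L) * real DIM('a) / 2) ^ (DIM('a) - 1) * (2/h)"

lemma K_nonneg: "K \<ge> 0"
  using pos unfolding K_def by (intro mult_nonneg_nonneg zero_le_power) auto

text \<open>Cover \<open>A\<close> by its intersections with the prisms of width \<open>s\<close>. The slabs above these cells are disjoint,
  are contained in the cylinder, and project into a small neighbourhood of \<open>A\<close>.\<close>

lemma content_le_neighbourhood:
  assumes A: "A \<noteq> {}" "A \<subseteq> patch" and s: "s > 0" "(1 + L) * real DIM('a) * s \<le> \<delta>" "(1 + L) * real DIM('a) * s \<le> r / 4"
    "L * (real DIM('a) * s) < h / 4"
  shows "hausdorff_content (DIM('a) - 1) \<delta> A
    \<le> ennreal K * emeasure lborel {y \<in> cyl. infdist (P y) A \<le> (1 + L) * real DIM('a) * s}"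
proof -
  let ?m = "DIM('a) - 1" and ?D = "real DIM('a) * s"
  let ?N = "{y \<in> cyl. infdist (P y) A \<le> (1 + L) * real DIM('a) * s}"
  have D0: "?D \<ge> 0" using s by simp
  have "0 \<le> L * ?D" using pos D0 by simp
  then have D: "?D \<le> r/4" using s(3) by (simp add: algebra_simps)
  have Ab: "x \<in> ball x0 (r/4)" "P x = x" if "x \<in> A" for x
    using subsetD[OF A(2) that] patch_P by (auto simp: patch_def)
  have bA: "bounded A" using Ab(1) by (meson bounded_ball bounded_subset subsetI)
  define F where "F = corner s ` A"
  have F: "finite F" unfolding F_def by (rule finite_corners[OF s(1) bA])
  have "\<forall>c\<in>F. \<exists>x\<in>A. corner s x = c" by (auto simp: F_def)
  then obtain X where X: "\<And>c. c \<in> F \<Longrightarrow> X c \<in> A" "\<And>c. c \<in> F \<Longrightarrow> corner s (X c) = c" by metis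
  have diam: "bounded (A \<inter> corner s -` {c}) \<and> diameter (A \<inter> corner s -` {c}) \<le> (1 + L) * ?D" for c
  proof
    show "bounded (A \<inter> corner s -` {c})" using bA bounded_subset by blast
    show "diameter (A \<inter> corner s -` {c}) \<le> (1 + L) * ?D"
    proof (rule diameter_le)
      show "A \<inter> corner s -` {c} \<noteq> {} \<or> 0 \<le> (1 + L) * ?D" using pos D0 by simp
      fix x y assume "x \<in> A \<inter> corner s -` {c}" "y \<in> A \<inter> corner s -` {c}"
      then have *: "x \<in> A" "y \<in> A" "corner s x = corner s y" by auto
      have "norm (P y - x) \<le> (1 + L) * ?D"
        by (rule P_close(2)[OF Ab[OF *(1)] corner_eq_imp_close[OF s(1) *(3)] D])
      then show "norm (x - y) \<le> (1 + L) * ?D" using Ab(2)[OF *(2)] by (simp add: norm_minus_commute)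
    qed
  qed
  have slab: "slab s x \<subseteq> ?N" "\<And>y. y \<in> slab s x \<Longrightarrow> corner s y = corner s x" if x: "x \<in> A" for x
  proof -
    show cy: "corner s y = corner s x" if "y \<in> slab s x" for y
      by (rule corner_eqI[OF s(1)]) (use that in \<open>auto simp: slab_def intro: less_imp_le\<close>)
    show "slab s x \<subseteq> ?N"
    proof
      fix y assume y: "y \<in> slab s x"
      note close = P_close[OF Ab[OF x] corner_eq_imp_close[OF s(1) cy[OF y, symmetric]] D]
      have hy: "0 < height y \<and> height y < h"
        using y close(1) s(4) by (auto simp: slab_def height_def abs_le_iff)
      have "dist (P y) x \<le> r/4" using close(2) s(3) by (simp add: dist_norm mult.assoc)
      then have "P y \<in> ball x0 (r/2)" using Ab(1)[OF x] dist_triangle[of x0 "P y" x] by (simp add: dist_commute)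
      then have "y \<in> cyl" using hy by (simp add: cyl_def)
      moreover have "infdist (P y) A \<le> dist (P y) x" by (rule infdist_le[OF x])
      ultimately show "y \<in> ?N" using close(2) by (simp add: dist_norm mult.assoc)
    qed
  qed
  have "hausdorff_content ?m \<delta> A \<le> of_nat (card F) * ennreal (unit_ball_vol (real ?m) * ((1 + L) * ?D / 2) ^ ?m)"
    by (rule hausdorff_content_le_sum[where U="\<lambda>c. A \<inter> corner s -` {c}"])
      (use F diam s pos D0 dim in \<open>auto simp: F_def mult.assoc\<close>)
  also have "unit_ball_vol (real ?m) * ((1 + L) * ?D / 2) ^ ?m = K * (s ^ ?m * (h/2))"
    using pos by (simp add: K_def power_mult_distrib power_divide)
  also have "of_nat (card F) * ennreal (K * (s ^ ?m * (h/2))) = ennreal K * (\<Sum>c\<in>F. emeasure lborel (slab s (X c)))"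
  proof -
    have "ennreal (K * (s ^ ?m * (h/2))) = ennreal K * ennreal (s ^ ?m * (h/2))"
      using K_nonneg s(1) pos by (intro ennreal_mult) auto
    then show ?thesis using s(1) by (simp add: emeasure_slab mult_ac)
  qed
  also have "(\<Sum>c\<in>F. emeasure lborel (slab s (X c))) = emeasure lborel (\<Union>c\<in>F. slab s (X c))"
  proof (rule sum_emeasure)
    show "(\<lambda>c. slab s (X c)) ` F \<subseteq> sets lborel" using emeasure_slab(1)[OF s(1)] by auto
    show "disjoint_family_on (\<lambda>c. slab s (X c)) F"
      unfolding disjoint_family_on_def using slab(2) X by (metis disjoint_iff)
  qed (rule F)
  also have "\<dots> \<le> emeasure lborel ?N"
  proof (rule emeasure_mono)
    show "(\<Union>c\<in>F. slab s (X c)) \<subseteq> ?N" using slab(1) X(1) by blast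
    have "(\<lambda>y. infdist (P y) A) \<in> borel_measurable borel"
      by (intro borel_measurable_continuous_onI continuous_on_infdist continuous_P)
    then have [measurable]: "(\<lambda>y. infdist (P y) A) \<in> borel_measurable lborel" by simp
    show "?N \<in> sets lborel" by measurable
  qed
  finally show ?thesis by (simp add: mult_left_mono)
qed

text \<open>As \<open>s\<close> tends to zero, the neighbourhoods of \<open>A\<close> shrink to its closure.\<close>

lemma outer_le_closure:
  assumes A: "A \<noteq> {}" "A \<subseteq> patch"
  shows "hausdorff_outer (DIM('a) - 1) A \<le> ennreal K * emeasure lborel {y \<in> cyl. P y \<in> closure A}"
  unfolding hausdorff_outer_def
proof (rule SUP_least)
  fix \<delta> :: real assume "\<delta> \<in> {0<..}"
  then have \<delta>: "\<delta> > 0" by simp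
  define N where "N n = {y \<in> cyl. infdist (P y) A \<le> (1 + L) * real DIM('a) * (1 / real (Suc n))}" for n :: nat
  have [measurable]: "(\<lambda>y. infdist (P y) A) \<in> borel_measurable borel"
    by (intro borel_measurable_continuous_onI continuous_on_infdist continuous_P)
  have Ns: "N n \<in> sets lborel" for n unfolding N_def by measurable
  have dec: "decseq N"
  proof (rule decseq_SucI)
    fix n
    have "(1 + L) * real DIM('a) * (1 / real (Suc (Suc n))) \<le> (1 + L) * real DIM('a) * (1 / real (Suc n))"
      using pos by (intro mult_left_mono frac_le) auto
    then show "N (Suc n) \<subseteq> N n" unfolding N_def by (auto intro: order_trans)
  qed
  have fin: "emeasure lborel (N n) \<noteq> \<infinity>" for n
  proof -
    have "emeasure lborel (N n) \<le> emeasure lborel cyl" by (rule emeasure_mono) (auto simp: N_def)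
    then show ?thesis using emeasure_cyl_finite by (auto simp: top_unique)
  qed
  have s0: "(\<lambda>n. c * (1 / real (Suc n))) \<longlonglongrightarrow> 0" for c
    using tendsto_mult[OF tendsto_const[of c] lim_1_over_n[THEN LIMSEQ_Suc]] by simp
  have Int: "(\<Inter>n. N n) = {y \<in> cyl. P y \<in> closure A}"
  proof (intro equalityI subsetI)
    fix y assume y: "y \<in> (\<Inter>n. N n)"
    then have "infdist (P y) A \<le> (1 + L) * real DIM('a) * (1 / real (Suc n))" for n by (auto simp: N_def)
    then have "infdist (P y) A \<le> 0" by (intro LIMSEQ_le_const[OF s0]) auto
    then have "infdist (P y) A = 0" using infdist_nonneg[of "P y" A] by simp
    then show "y \<in> {y \<in> cyl. P y \<in> closure A}" using y A(1) by (auto simp: N_def in_closure_iff_infdist_zero)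
  next
    fix y assume "y \<in> {y \<in> cyl. P y \<in> closure A}"
    then show "y \<in> (\<Inter>n. N n)" using A(1) pos by (auto simp: N_def in_closure_iff_infdist_zero)
  qed
  have "(\<lambda>n. emeasure lborel (N n)) \<longlonglongrightarrow> emeasure lborel {y \<in> cyl. P y \<in> closure A}"
    using Lim_emeasure_decseq[OF _ dec fin] Ns Int by auto
  then have lim: "(\<lambda>n. ennreal K * emeasure lborel (N n)) \<longlonglongrightarrow> ennreal K * emeasure lborel {y \<in> cyl. P y \<in> closure A}"
    by (intro ennreal_tendsto_cmult) auto
  have "\<delta> > 0" "r/4 > 0" "h/4 > 0" using \<delta> pos by auto
  note ev = order_tendstoD(2)[OF s0 this(1), of "(1 + L) * real DIM('a)"]
    order_tendstoD(2)[OF s0 this(2), of "(1 + L) * real DIM('a)"] order_tendstoD(2)[OF s0 this(3), of "L * real DIM('a)"]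
  have "\<forall>\<^sub>F n in sequentially. hausdorff_content (DIM('a) - 1) \<delta> A \<le> ennreal K * emeasure lborel (N n)"
    using ev(1) ev(2) ev(3)
  proof eventually_elim
    case (elim n)
    then show ?case unfolding N_def by (intro content_le_neighbourhood A) (auto simp: mult.assoc)
  qed
  from tendsto_lowerbound[OF lim this]
  show "hausdorff_content (DIM('a) - 1) \<delta> A \<le> ennreal K * emeasure lborel {y \<in> cyl. P y \<in> closure A}" by simp
qed

abbreviation "\<mu> \<equiv> hausdorff_measure (DIM('a) - 1) :: 'a measure"

lemma measurable_patch [measurable]: "patch \<in> sets borel"
  unfolding patch_def by (intro sets.Int borel_closed borel_open) auto

text \<open>Inner regularity reduces the comparison of the two measures to compact sets, which coincide with their
  closure.\<close>

lemma surface_measure_le: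
  assumes B: "B \<in> sets borel" "B \<subseteq> patch"
  shows "emeasure \<mu> B \<le> ennreal K * emeasure lborel {y \<in> cyl. P y \<in> B}"
proof -
  define \<mu>' where "\<mu>' = density \<mu> (indicator patch)"
  have \<mu>': "emeasure \<mu>' C = emeasure \<mu> (patch \<inter> C)" if "C \<in> sets borel" for C
    using that unfolding \<mu>'_def by (subst emeasure_density) (auto simp: indicator_inter_arith[symmetric])
  have compact_le: "emeasure \<mu> C \<le> ennreal K * emeasure lborel {y \<in> cyl. P y \<in> closure C}" if "C \<subseteq> patch" for C
    using order_trans[OF emeasure_hausdorff_le_outer outer_le_closure[OF _ that]] by (cases "C = {}") auto
  have sets: "sets \<mu>' = sets borel" by (simp add: \<mu>'_def)
  have sp: "space \<mu>' = UNIV" by (simp add: \<mu>'_def)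
  have "emeasure \<mu>' (space \<mu>') \<le> ennreal K * emeasure lborel {y \<in> cyl. P y \<in> closure patch}"
    using compact_le[of patch] by (simp add: sp \<mu>')
  also have "\<dots> \<le> ennreal K * emeasure lborel cyl"
    by (intro mult_left_mono emeasure_mono) auto
  also have "\<dots> < \<infinity>" using emeasure_cyl_finite by (simp add: ennreal_mult_less_top)
  finally have fin: "emeasure \<mu>' (space \<mu>') \<noteq> \<infinity>" by simp
  have "emeasure \<mu> B = emeasure \<mu>' B" using B by (simp add: \<mu>' Int_absorb1)
  also have "\<dots> = (SUP C \<in> {C. C \<subseteq> B \<and> compact C}. emeasure \<mu>' C)"
    by (rule inner_regular[OF sets fin B(1)])
  also have "\<dots> \<le> ennreal K * emeasure lborel {y \<in> cyl. P y \<in> B}"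
  proof (rule SUP_least)
    fix C assume "C \<in> {C. C \<subseteq> B \<and> compact C}"
    then have C: "C \<subseteq> B" "closed C" "C \<in> sets borel" by (auto simp: compact_imp_closed borel_compact)
    have "emeasure \<mu>' C = emeasure \<mu> C" using C B(2) by (simp add: \<mu>' Int_absorb1)
    also have "\<dots> \<le> ennreal K * emeasure lborel {y \<in> cyl. P y \<in> closure C}"
      using C B(2) by (intro compact_le) auto
    also have "\<dots> \<le> ennreal K * emeasure lborel {y \<in> cyl. P y \<in> B}"
    proof (intro mult_left_mono emeasure_mono)
      have [measurable]: "B \<in> sets borel" by (rule B(1))
      show "{y \<in> cyl. P y \<in> B} \<in> sets lborel" by measurable
    qed (use C in auto)
    finally show "emeasure \<mu>' C \<le> ennreal K * emeasure lborel {y \<in> cyl. P y \<in> B}" .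
  qed
  finally show ?thesis .
qed

lemma surface_integral_le:
  assumes [measurable]: "F \<in> borel_measurable borel"
  shows "(\<integral>\<^sup>+x. F x * indicator patch x \<partial>\<mu>) \<le> ennreal K * (\<integral>\<^sup>+y. F (P y) * indicator cyl y \<partial>lborel)"
proof -
  define \<nu> where "\<nu> = distr (density lborel (indicator cyl)) borel P"
  have \<nu>: "emeasure \<nu> B = emeasure lborel {y \<in> cyl. P y \<in> B}" if [measurable]: "B \<in> sets borel" for B
  proof -
    have "emeasure \<nu> B = emeasure (density lborel (indicator cyl)) (P -` B \<inter> UNIV)"
      unfolding \<nu>_def by (subst emeasure_distr) auto
    also have "\<dots> = emeasure lborel (cyl \<inter> (P -` B))"
      using measurable_sets[OF measurable_P that] by (subst emeasure_density) (auto simp: indicator_inter_arith[symmetric])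
    also have "cyl \<inter> (P -` B) = {y \<in> cyl. P y \<in> B}" by auto
    finally show ?thesis .
  qed
  let ?M = "density \<mu> (indicator patch)"
  have s1: "sets ?M = sets (scale_measure (ennreal K) \<nu>)" by (simp add: \<nu>_def)
  have "?M \<le> scale_measure (ennreal K) \<nu>"
  proof (subst le_measure[OF s1], intro ballI)
    fix B assume "B \<in> sets ?M"
    then have B: "B \<in> sets borel" by simp
    then have PB: "patch \<inter> B \<in> sets borel" by auto
    have "emeasure ?M B = emeasure \<mu> (patch \<inter> B)"
      using B by (subst emeasure_density) (auto simp: indicator_inter_arith[symmetric])
    also have "\<dots> \<le> ennreal K * emeasure lborel {y \<in> cyl. P y \<in> patch \<inter> B}"
      by (rule surface_measure_le[OF PB]) auto
    also have "\<dots> \<le> ennreal K * emeasure lborel {y \<in> cyl. P y \<in> B}"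
    proof (intro mult_left_mono emeasure_mono)
      have [measurable]: "B \<in> sets borel" by (rule B)
      show "{y \<in> cyl. P y \<in> B} \<in> sets lborel" by measurable
    qed auto
    also have "\<dots> = emeasure (scale_measure (ennreal K) \<nu>) B" using \<nu>[OF B] by simp
    finally show "emeasure ?M B \<le> emeasure (scale_measure (ennreal K) \<nu>) B" .
  qed
  from nn_integral_mono_measure[OF s1 this, of F]
  have "(\<integral>\<^sup>+x. F x \<partial>?M) \<le> ennreal K * (\<integral>\<^sup>+x. F x \<partial>\<nu>)"
    by (subst (asm) nn_integral_scale_measure) (auto simp: \<nu>_def)
  also have "(\<integral>\<^sup>+x. F x \<partial>\<nu>) = (\<integral>\<^sup>+y. indicator cyl y * F (P y) \<partial>lborel)"
    unfolding \<nu>_def by (subst nn_integral_distr) (auto simp: nn_integral_density)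
  also have "(\<integral>\<^sup>+x. F x \<partial>?M) = (\<integral>\<^sup>+x. indicator patch x * F x \<partial>\<mu>)"
    by (rule nn_integral_density) auto
  finally show ?thesis by (simp add: mult.commute)
qed

text \<open>In the coordinates (foot point, height), passing from \<open>y\<close> to \<open>P y + s b\<close> is a vertical shift by less than
  \<open>h\<close> in absolute value. For each fixed shift, translation invariance bounds the integral.\<close>

lemma integral_along_fibres_le:
  assumes [measurable]: "G \<in> borel_measurable borel"
  shows "(\<integral>\<^sup>+y. (\<integral>\<^sup>+s. G (P y + s *\<^sub>R b) * indicator {0<..<h} s \<partial>lborel) * indicator cyl y \<partial>lborel)
    \<le> ennreal (2 * h) * (\<integral>\<^sup>+y. G y * indicator cyl y \<partial>lborel)"
proof -
  have 1: "(\<integral>\<^sup>+s. G (P y + s *\<^sub>R b) * indicator {0<..<h} s \<partial>lborel) * indicator cyl y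
      \<le> (\<integral>\<^sup>+t. G (y + t *\<^sub>R b) * indicator cyl (y + t *\<^sub>R b) * indicator {-h<..<h} t \<partial>lborel)" for y
  proof (cases "y \<in> cyl")
    case True
    have "(\<integral>\<^sup>+s. G (P y + s *\<^sub>R b) * indicator {0<..<h} s \<partial>lborel)
      = (\<integral>\<^sup>+t. G (P y + (t + height y) *\<^sub>R b) * indicator {0<..<h} (t + height y) \<partial>lborel)"
      by (rule nn_integral_lborel_shift[symmetric, where f="\<lambda>s. G (P y + s *\<^sub>R b) * indicator {0<..<h} s"]) measurable
    also have "\<dots> \<le> (\<integral>\<^sup>+t. G (y + t *\<^sub>R b) * indicator cyl (y + t *\<^sub>R b) * indicator {-h<..<h} t \<partial>lborel)"
    proof (rule nn_integral_mono)
      fix t :: real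
      have "P y + (t + height y) *\<^sub>R b = y + t *\<^sub>R b"
        by (subst (3) eq_P) (simp add: algebra_simps)
      then show "G (P y + (t + height y) *\<^sub>R b) * indicator {0<..<h} (t + height y)
        \<le> G (y + t *\<^sub>R b) * indicator cyl (y + t *\<^sub>R b) * indicator {-h<..<h} t"
        using True by (auto simp: indicator_def cyl_def P_add height_add)
    qed
    finally show ?thesis using True by simp
  qed simp
  have "(\<integral>\<^sup>+y. (\<integral>\<^sup>+s. G (P y + s *\<^sub>R b) * indicator {0<..<h} s \<partial>lborel) * indicator cyl y \<partial>lborel)
    \<le> (\<integral>\<^sup>+y. (\<integral>\<^sup>+t. G (y + t *\<^sub>R b) * indicator cyl (y + t *\<^sub>R b) * indicator {-h<..<h} t \<partial>lborel) \<partial>lborel)"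
    by (rule nn_integral_mono) (rule 1)
  also have "\<dots> = (\<integral>\<^sup>+t. (\<integral>\<^sup>+y. G (y + t *\<^sub>R b) * indicator cyl (y + t *\<^sub>R b) * indicator {-h<..<h} t \<partial>lborel) \<partial>lborel)"
    by (rule lborel_pair.Fubini') measurable
  also have "\<dots> = (\<integral>\<^sup>+t. (\<integral>\<^sup>+y. G y * indicator cyl y \<partial>lborel) * indicator {-h<..<h} t \<partial>lborel)"
  proof (rule nn_integral_cong)
    fix t :: real
    have "(\<integral>\<^sup>+y. G (y + t *\<^sub>R b) * indicator cyl (y + t *\<^sub>R b) * indicator {-h<..<h} t \<partial>lborel)
      = (\<integral>\<^sup>+y. G (y + t *\<^sub>R b) * indicator cyl (y + t *\<^sub>R b) \<partial>lborel) * indicator {-h<..<h} t"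
      by (rule nn_integral_multc) measurable
    also have "(\<integral>\<^sup>+y. G (y + t *\<^sub>R b) * indicator cyl (y + t *\<^sub>R b) \<partial>lborel) = (\<integral>\<^sup>+y. G y * indicator cyl y \<partial>lborel)"
      by (rule nn_integral_lborel_shift[where f="\<lambda>y. G y * indicator cyl y"]) measurable
    finally show "(\<integral>\<^sup>+y. G (y + t *\<^sub>R b) * indicator cyl (y + t *\<^sub>R b) * indicator {-h<..<h} t \<partial>lborel)
      = (\<integral>\<^sup>+y. G y * indicator cyl y \<partial>lborel) * indicator {-h<..<h} t" .
  qed
  also have "\<dots> = (\<integral>\<^sup>+y. G y * indicator cyl y \<partial>lborel) * ennreal (2 * h)"
    using pos by (simp add: nn_integral_cmult)
  finally show ?thesis by (simp add: mult.commute)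
qed

text \<open>Fundamental theorem of calculus on the segment from \<open>P y\<close> to \<open>y\<close>, and the Cauchy-Schwarz inequality.\<close>

lemma square_on_graph_le:
  assumes \<phi>: "smooth \<phi>" and y: "y \<in> cyl"
  shows "ennreal ((\<phi> (P y))\<^sup>2) \<le> ennreal (2 * (\<phi> y)\<^sup>2)
    + ennreal (2 * h) * (\<integral>\<^sup>+s. ennreal ((norm (cgrad \<phi> (P y + s *\<^sub>R b)))\<^sup>2) * indicator {0<..<h} s \<partial>lborel)"
proof -
  let ?g = "\<lambda>s. cgrad \<phi> (P y + s *\<^sub>R b)" and ?t = "height y"
  have t: "0 < ?t" "?t < h" using y by (auto simp: cyl_def)
  have cg: "continuous_on UNIV ?g"
    by (intro continuous_on_compose2[OF cgrad_continuous[OF \<phi>, of UNIV]] continuous_intros) auto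
  then have [measurable]: "?g \<in> borel_measurable borel" by (rule borel_measurable_continuous_onI)
  have "has_bochner_integral lborel (\<lambda>s. indicator {0..?t} s *\<^sub>R (?g s \<bullet> b)) (\<phi> (P y + ?t *\<^sub>R b) - \<phi> (P y + 0 *\<^sub>R b))"
  proof (rule has_bochner_integral_FTC_Icc)
    show "0 \<le> ?t" using t by simp
    show "continuous_on {0..?t} (\<lambda>s. ?g s \<bullet> b)"
      by (intro continuous_intros continuous_on_subset[OF cg]) auto
    fix s assume "0 \<le> s" "s \<le> ?t"
    have "((\<lambda>s. \<phi> (P y + s *\<^sub>R b)) has_derivative (\<lambda>d. ?g s \<bullet> (d *\<^sub>R b))) (at s within {0..?t})"
      by (rule has_derivative_compose[OF _ smooth_has_derivative_cgrad[OF \<phi>]]) (auto intro!: derivative_eq_intros)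
    then show "((\<lambda>s. \<phi> (P y + s *\<^sub>R b)) has_vector_derivative ?g s \<bullet> b) (at s within {0..?t})"
      by (simp add: has_vector_derivative_def)
  qed
  then have int: "integrable lborel (\<lambda>s. indicator {0..?t} s *\<^sub>R (?g s \<bullet> b))"
    and val: "(LINT s|lborel. indicator {0..?t} s *\<^sub>R (?g s \<bullet> b)) = \<phi> y - \<phi> (P y)"
    using eq_P[of y] by (auto simp: has_bochner_integral_iff)
  have "ennreal \<bar>\<phi> y - \<phi> (P y)\<bar> \<le> (\<integral>\<^sup>+s. ennreal (norm (indicator {0..?t} s *\<^sub>R (?g s \<bullet> b))) \<partial>lborel)"
    using integral_norm_bound_ennreal[OF int] val by simp
  also have "\<dots> \<le> (\<integral>\<^sup>+s. ennreal (norm (?g s)) * indicator {0<..<h} s * indicator {0<..<h} s \<partial>lborel)"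
  proof (rule nn_integral_mono_AE)
    show "AE s in lborel. ennreal (norm (indicator {0..?t} s *\<^sub>R (?g s \<bullet> b))) \<le> ennreal (norm (?g s)) * indicator {0<..<h} s * indicator {0<..<h} s"
      using AE_lborel_singleton[of 0]
    proof eventually_elim
      case (elim s)
      have "\<bar>?g s \<bullet> b\<bar> \<le> norm (?g s)" using Cauchy_Schwarz_ineq2[of "?g s" b] b_simps by simp
      then show ?case using elim t by (auto simp: indicator_def intro: ennreal_leI)
    qed
  qed
  finally have "(ennreal \<bar>\<phi> y - \<phi> (P y)\<bar>)\<^sup>2 \<le> (\<integral>\<^sup>+s. ennreal (norm (?g s)) * indicator {0<..<h} s * indicator {0<..<h} s \<partial>lborel)\<^sup>2"
    by (intro power_mono) auto
  also have "\<dots> \<le> (\<integral>\<^sup>+s. (ennreal (norm (?g s)) * indicator {0<..<h} s)\<^sup>2 \<partial>lborel) * (\<integral>\<^sup>+s. (indicator {0<..<h} s)\<^sup>2 \<partial>lborel)"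
    by (rule Cauchy_Schwarz_nn_integral) measurable
  also have "(\<integral>\<^sup>+s. (indicator {0<..<h} s)\<^sup>2 \<partial>lborel) = (\<integral>\<^sup>+s. indicator {0<..<h} s \<partial>lborel)"
    by (rule nn_integral_cong) (auto simp: indicator_def)
  also have "\<dots> = ennreal h" using pos by simp
  also have "(\<integral>\<^sup>+s. (ennreal (norm (?g s)) * indicator {0<..<h} s)\<^sup>2 \<partial>lborel) = (\<integral>\<^sup>+s. ennreal ((norm (?g s))\<^sup>2) * indicator {0<..<h} s \<partial>lborel)"
    by (rule nn_integral_cong) (auto simp: indicator_def ennreal_power)
  finally have I: "ennreal ((\<phi> y - \<phi> (P y))\<^sup>2) \<le> ennreal h * (\<integral>\<^sup>+s. ennreal ((norm (?g s))\<^sup>2) * indicator {0<..<h} s \<partial>lborel)"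
    by (simp add: ennreal_power mult.commute)
  have "(\<phi> (P y))\<^sup>2 \<le> 2 * (\<phi> y)\<^sup>2 + 2 * (\<phi> y - \<phi> (P y))\<^sup>2"
    using norm_add_square[of "\<phi> y" "\<phi> (P y) - \<phi> y"] by (simp add: power2_commute)
  then have "ennreal ((\<phi> (P y))\<^sup>2) \<le> ennreal (2 * (\<phi> y)\<^sup>2 + 2 * (\<phi> y - \<phi> (P y))\<^sup>2)" by (rule ennreal_leI)
  also have "\<dots> = ennreal (2 * (\<phi> y)\<^sup>2) + 2 * ennreal ((\<phi> y - \<phi> (P y))\<^sup>2)" by (simp add: ennreal_mult')
  also have "\<dots> \<le> ennreal (2 * (\<phi> y)\<^sup>2) + 2 * (ennreal h * (\<integral>\<^sup>+s. ennreal ((norm (?g s))\<^sup>2) * indicator {0<..<h} s \<partial>lborel))"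
    by (intro add_left_mono mult_left_mono I) auto
  finally show ?thesis by (simp add: ennreal_mult' mult.assoc)
qed

lemma local_trace_inequality:
  assumes \<phi>: "smooth \<phi>"
  shows "(\<integral>\<^sup>+x. ennreal ((\<phi> x)\<^sup>2) * indicator patch x \<partial>\<mu>)
    \<le> ennreal (K * (2 + 4 * h\<^sup>2)) * (\<integral>\<^sup>+y. ennreal ((\<phi> y)\<^sup>2 + (norm (cgrad \<phi> y))\<^sup>2) * indicator \<Omega> y \<partial>lborel)"
proof -
  have [measurable]: "\<phi> \<in> borel_measurable borel" by (rule smooth_measurable[OF \<phi>])
  have [measurable]: "cgrad \<phi> \<in> borel_measurable borel"
    by (intro borel_measurable_continuous_onI cgrad_continuous \<phi>)
  have [measurable]: "\<Omega> \<in> sets borel" using \<Omega> by auto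
  let ?G = "\<lambda>y. ennreal ((norm (cgrad \<phi> y))\<^sup>2)"
  let ?E = "\<integral>\<^sup>+y. ennreal ((\<phi> y)\<^sup>2 + (norm (cgrad \<phi> y))\<^sup>2) * indicator \<Omega> y \<partial>lborel"
  have "(\<integral>\<^sup>+y. ennreal ((\<phi> (P y))\<^sup>2) * indicator cyl y \<partial>lborel)
    \<le> (\<integral>\<^sup>+y. ennreal 2 * (ennreal ((\<phi> y)\<^sup>2) * indicator cyl y)
        + ennreal (2 * h) * ((\<integral>\<^sup>+s. ?G (P y + s *\<^sub>R b) * indicator {0<..<h} s \<partial>lborel) * indicator cyl y) \<partial>lborel)"
  proof (rule nn_integral_mono)
    fix y
    show "ennreal ((\<phi> (P y))\<^sup>2) * indicator cyl y \<le> ennreal 2 * (ennreal ((\<phi> y)\<^sup>2) * indicator cyl y)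
        + ennreal (2 * h) * ((\<integral>\<^sup>+s. ?G (P y + s *\<^sub>R b) * indicator {0<..<h} s \<partial>lborel) * indicator cyl y)"
      using square_on_graph_le[OF \<phi>, of y] by (cases "y \<in> cyl") (auto simp: ennreal_mult')
  qed
  also have "\<dots> = ennreal 2 * (\<integral>\<^sup>+y. ennreal ((\<phi> y)\<^sup>2) * indicator cyl y \<partial>lborel)
    + ennreal (2 * h) * (\<integral>\<^sup>+y. (\<integral>\<^sup>+s. ?G (P y + s *\<^sub>R b) * indicator {0<..<h} s \<partial>lborel) * indicator cyl y \<partial>lborel)"
    by (subst nn_integral_add) (measurable, simp add: nn_integral_cmult)
  also have "\<dots> \<le> ennreal 2 * ?E + ennreal (2 * h) * (ennreal (2 * h) * ?E)"
  proof (intro add_mono mult_left_mono order_trans[OF integral_along_fibres_le] nn_integral_mono)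
    fix y
    show "ennreal ((\<phi> y)\<^sup>2) * indicator cyl y \<le> ennreal ((\<phi> y)\<^sup>2 + (norm (cgrad \<phi> y))\<^sup>2) * indicator \<Omega> y"
      "?G y * indicator cyl y \<le> ennreal ((\<phi> y)\<^sup>2 + (norm (cgrad \<phi> y))\<^sup>2) * indicator \<Omega> y"
      using cyl_subset by (auto simp: indicator_def intro: ennreal_leI)
  qed auto
  also have "\<dots> = ennreal (2 + 4 * h\<^sup>2) * ?E"
  proof -
    have "ennreal 2 + ennreal (2 * h) * ennreal (2 * h) = ennreal (2 + 4 * h\<^sup>2)"
      using pos by (simp add: ennreal_mult[symmetric] ennreal_plus[symmetric] power2_eq_square del: ennreal_plus ennreal_numeral)
    then show ?thesis by (simp add: distrib_right[symmetric] mult.assoc[symmetric])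
  qed
  finally have "(\<integral>\<^sup>+y. ennreal ((\<phi> (P y))\<^sup>2) * indicator cyl y \<partial>lborel) \<le> ennreal (2 + 4 * h\<^sup>2) * ?E" .
  then have "ennreal K * (\<integral>\<^sup>+y. ennreal ((\<phi> (P y))\<^sup>2) * indicator cyl y \<partial>lborel) \<le> ennreal K * (ennreal (2 + 4 * h\<^sup>2) * ?E)"
    by (rule mult_left_mono) simp
  with surface_integral_le[of "\<lambda>x. ennreal ((\<phi> x)\<^sup>2)"] K_nonneg show ?thesis
    by (simp add: ennreal_mult mult.assoc del: ennreal_plus)
qed

end

text \<open>The height of the cylinder is \<open>r/2\<close>: then the cylinder above the ball of radius \<open>r/2\<close> stays in the ball
  of radius \<open>r\<close> where \<open>\<Omega>\<close> is an epigraph.\<close>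

lemma boundary_patch_exists:
  fixes \<Omega> :: "'a::euclidean_space set"
  assumes \<Omega>: "smooth_bounded_domain \<Omega>" and x0: "x0 \<in> frontier \<Omega>" and dim: "DIM('a) \<ge> 2"
  obtains b e r L h \<gamma> where "boundary_patch \<Omega> x0 b e r L h \<gamma>"
proof -
  have "smooth_boundary \<Omega>" "open \<Omega>" using \<Omega> by (auto simp: smooth_bounded_domain_def)
  then obtain r b \<gamma> where r: "r > 0" and b: "b \<in> Basis \<union> uminus ` Basis" and \<gamma>: "smooth \<gamma>"
    "\<And>x t. \<gamma> (x + t *\<^sub>R b) = \<gamma> x" "\<Omega> \<inter> ball x0 r = {x \<in> ball x0 r. \<gamma> x < x \<bullet> b}"
    using x0 unfolding smooth_boundary_def by meson
  from b obtain e where e: "e \<in> Basis" "b = e \<or> b = - e" by auto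
  obtain L where L: "L \<ge> 0" "\<And>x y. x \<in> cball x0 r \<Longrightarrow> y \<in> cball x0 r \<Longrightarrow> \<bar>\<gamma> x - \<gamma> y\<bar> \<le> L * norm (x - y)"
    using smooth_lipschitz_on_compact[OF \<gamma>(1) compact_cball convex_cball] by metis
  have "boundary_patch \<Omega> x0 b e r L (r/2) \<gamma>"
    using r L e \<gamma> \<open>open \<Omega>\<close> dim by unfold_locales auto
  then show ?thesis by (rule that)
qed

lemma frontier_borel [measurable]: "frontier \<Omega> \<in> sets borel"
  by (intro borel_closed) simp

lemma nn_integral_surface:
  "(\<integral>\<^sup>+x. F x \<partial>surface_measure \<Omega>) = (\<integral>\<^sup>+x. F x * indicator (frontier \<Omega>) x \<partial>hausdorff_measure (DIM('a) - 1))"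
  for \<Omega> :: "'a::euclidean_space set"
  unfolding surface_measure_def by (rule nn_integral_restrict_space) simp

text \<open>Finitely many patches cover the boundary by compactness.\<close>

lemma smooth_trace_inequality:
  fixes \<Omega> :: "'a::euclidean_space set"
  assumes \<Omega>: "smooth_bounded_domain \<Omega>" and dim: "DIM('a) \<ge> 2"
  obtains C where "C \<ge> 0" "\<And>\<phi>. smooth \<phi> \<Longrightarrow> (\<integral>\<^sup>+x. ennreal ((\<phi> x)\<^sup>2) \<partial>surface_measure \<Omega>)
    \<le> ennreal C * (\<integral>\<^sup>+y. ennreal ((\<phi> y)\<^sup>2 + (norm (cgrad \<phi> y))\<^sup>2) * indicator \<Omega> y \<partial>lborel)"
proof -
  let ?\<mu> = "hausdorff_measure (DIM('a) - 1) :: 'a measure"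
  let ?E = "\<lambda>\<phi>. \<integral>\<^sup>+y. ennreal ((\<phi> y)\<^sup>2 + (norm (cgrad \<phi> y))\<^sup>2) * indicator \<Omega> y \<partial>lborel"
  have "\<exists>\<rho> C. \<rho> > 0 \<and> C \<ge> 0 \<and> (\<forall>\<phi>. smooth \<phi> \<longrightarrow>
    (\<integral>\<^sup>+x. ennreal ((\<phi> x)\<^sup>2) * indicator (frontier \<Omega> \<inter> ball x0 \<rho>) x \<partial>?\<mu>) \<le> ennreal C * ?E \<phi>)"
    if x0: "x0 \<in> frontier \<Omega>" for x0
  proof -
    obtain b e r L h \<gamma> where "boundary_patch \<Omega> x0 b e r L h \<gamma>"
      using boundary_patch_exists[OF \<Omega> x0 dim] by blast
    then interpret boundary_patch \<Omega> x0 b e r L h \<gamma> .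
    have "0 \<le> K * (2 + 4 * h\<^sup>2)" using K_nonneg by simp
    moreover have "r/4 > 0" using pos by simp
    ultimately show ?thesis using local_trace_inequality unfolding patch_def by blast
  qed
  then have "\<forall>x0\<in>frontier \<Omega>. \<exists>\<rho> C. \<rho> > 0 \<and> C \<ge> 0 \<and> (\<forall>\<phi>. smooth \<phi> \<longrightarrow>
    (\<integral>\<^sup>+x. ennreal ((\<phi> x)\<^sup>2) * indicator (frontier \<Omega> \<inter> ball x0 \<rho>) x \<partial>?\<mu>) \<le> ennreal C * ?E \<phi>)" ..
  from bchoice[OF this] obtain \<rho> where "\<forall>x0\<in>frontier \<Omega>. \<exists>C. \<rho> x0 > 0 \<and> C \<ge> 0 \<and> (\<forall>\<phi>. smooth \<phi> \<longrightarrow>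
    (\<integral>\<^sup>+x. ennreal ((\<phi> x)\<^sup>2) * indicator (frontier \<Omega> \<inter> ball x0 (\<rho> x0)) x \<partial>?\<mu>) \<le> ennreal C * ?E \<phi>)" ..
  from bchoice[OF this] obtain C where C: "\<forall>x0\<in>frontier \<Omega>. \<rho> x0 > 0 \<and> C x0 \<ge> 0 \<and> (\<forall>\<phi>. smooth \<phi> \<longrightarrow>
    (\<integral>\<^sup>+x. ennreal ((\<phi> x)\<^sup>2) * indicator (frontier \<Omega> \<inter> ball x0 (\<rho> x0)) x \<partial>?\<mu>) \<le> ennreal (C x0) * ?E \<phi>)" ..
  note loc = C[rule_format, THEN conjunct1] C[rule_format, THEN conjunct2, THEN conjunct1]
    C[rule_format, THEN conjunct2, THEN conjunct2, rule_format]
  have comp: "compact (frontier \<Omega>)"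
    using \<Omega> by (simp add: smooth_bounded_domain_def compact_frontier_bounded)
  have cov: "frontier \<Omega> \<subseteq> (\<Union>x\<in>frontier \<Omega>. ball x (\<rho> x))" using loc(1) by force
  obtain F where F: "F \<subseteq> frontier \<Omega>" "finite F" "frontier \<Omega> \<subseteq> (\<Union>x\<in>F. ball x (\<rho> x))"
    using compactE_image[OF comp open_ball cov] by blast
  have "(\<integral>\<^sup>+x. ennreal ((\<phi> x)\<^sup>2) \<partial>surface_measure \<Omega>) \<le> ennreal (\<Sum>x\<in>F. C x) * ?E \<phi>" if \<phi>: "smooth \<phi>" for \<phi>
  proof -
    have [measurable]: "\<phi> \<in> borel_measurable borel" by (rule smooth_measurable[OF \<phi>])
    have [measurable]: "ball x0 (\<rho> x0) \<in> sets borel" for x0 by simp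
    have "(\<integral>\<^sup>+x. ennreal ((\<phi> x)\<^sup>2) \<partial>surface_measure \<Omega>) = (\<integral>\<^sup>+x. ennreal ((\<phi> x)\<^sup>2) * indicator (frontier \<Omega>) x \<partial>?\<mu>)"
      by (rule nn_integral_surface)
    also have "\<dots> \<le> (\<integral>\<^sup>+x. (\<Sum>x0\<in>F. ennreal ((\<phi> x)\<^sup>2) * indicator (frontier \<Omega> \<inter> ball x0 (\<rho> x0)) x) \<partial>?\<mu>)"
    proof (rule nn_integral_mono)
      fix x
      show "ennreal ((\<phi> x)\<^sup>2) * indicator (frontier \<Omega>) x \<le> (\<Sum>x0\<in>F. ennreal ((\<phi> x)\<^sup>2) * indicator (frontier \<Omega> \<inter> ball x0 (\<rho> x0)) x)"
      proof (cases "x \<in> frontier \<Omega>")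
        case True
        then obtain x0 where x0: "x0 \<in> F" "x \<in> ball x0 (\<rho> x0)" using F(3) by blast
        have "ennreal ((\<phi> x)\<^sup>2) * indicator (frontier \<Omega>) x = ennreal ((\<phi> x)\<^sup>2) * indicator (frontier \<Omega> \<inter> ball x0 (\<rho> x0)) x"
          using x0 True by simp
        also have "\<dots> \<le> (\<Sum>x0\<in>F. ennreal ((\<phi> x)\<^sup>2) * indicator (frontier \<Omega> \<inter> ball x0 (\<rho> x0)) x)"
          by (rule member_le_sum[OF x0(1) _ F(2)]) simp
        finally show ?thesis .
      qed simp
    qed
    also have "\<dots> = (\<Sum>x0\<in>F. \<integral>\<^sup>+x. ennreal ((\<phi> x)\<^sup>2) * indicator (frontier \<Omega> \<inter> ball x0 (\<rho> x0)) x \<partial>?\<mu>)"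
      by (rule nn_integral_sum) measurable
    also have "\<dots> \<le> (\<Sum>x0\<in>F. ennreal (C x0) * ?E \<phi>)"
      by (rule sum_mono) (use loc(3)[OF _ \<phi>] F(1) in blast)
    also have "\<dots> = ennreal (\<Sum>x\<in>F. C x) * ?E \<phi>"
      using loc(2) F(1) by (subst sum_ennreal[symmetric]) (auto simp: sum_distrib_right)
    finally show ?thesis .
  qed
  moreover have "0 \<le> (\<Sum>x\<in>F. C x)" using loc(2) F(1) by (intro sum_nonneg) auto
  ultimately show ?thesis using that by blast
qed

section \<open>The energy forms\<close>

lemma (in form_space) form_lincomb_le:
  assumes "u \<in> V" "v \<in> V"
  shows "B (\<lambda>x. c * u x + d * v x) (\<lambda>x. c * u x + d * v x) \<le> 2 * c\<^sup>2 * B u u + 2 * d\<^sup>2 * B v v"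
  using form_nonneg[OF lincomb_closed[OF assms, of c "-d"]] form_square[OF assms, of c "-d"] form_square[OF assms, of c d]
  by (simp add: algebra_simps)

definition AE_bounded :: "'a measure \<Rightarrow> ('a \<Rightarrow> real) \<Rightarrow> real \<Rightarrow> bool"
  where "AE_bounded M s C \<longleftrightarrow> s \<in> borel_measurable M \<and> (AE x in M. \<bar>s x\<bar> \<le> C)"

lemma energy_integrable:
  assumes s: "AE_bounded (lebesgue_on \<Omega>) s C" "AE_bounded (lebesgue_on \<Omega>) r C'" and u: "u \<in> H1 \<Omega>" "v \<in> H1 \<Omega>"
  shows "integrable (lebesgue_on \<Omega>) (\<lambda>x. s x * (grad \<Omega> u x \<bullet> grad \<Omega> v x))"
    "integrable (lebesgue_on \<Omega>) (\<lambda>x. r x * u x * v x)"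
proof -
  have "(\<lambda>x. s x *\<^sub>R grad \<Omega> u x) \<in> L2 (lebesgue_on \<Omega>)" "(\<lambda>x. r x *\<^sub>R u x) \<in> L2 (lebesgue_on \<Omega>)"
    using L2_bounded_mult[OF grad(1)[OF u(1)], of s C] L2_bounded_mult[OF H1_L2[OF u(1)], of r C'] s
    by (auto simp: AE_bounded_def)
  from L2_inner_integrable[OF this(1) grad(1)[OF u(2)]] L2_inner_integrable[OF this(2) H1_L2[OF u(2)]]
  show "integrable (lebesgue_on \<Omega>) (\<lambda>x. s x * (grad \<Omega> u x \<bullet> grad \<Omega> v x))"
    "integrable (lebesgue_on \<Omega>) (\<lambda>x. r x * u x * v x)" by simp_all
qed

lemma energy_form_sym: "energy_form \<Omega> s r u v = energy_form \<Omega> s r v u"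
  by (simp add: energy_form_def inner_commute mult_ac)

lemma energy_form_lincomb:
  assumes \<Omega>: "open \<Omega>" and s: "AE_bounded (lebesgue_on \<Omega>) s C" "AE_bounded (lebesgue_on \<Omega>) r C'"
    and u: "u \<in> H1 \<Omega>" "v \<in> H1 \<Omega>" "w \<in> H1 \<Omega>"
  shows "energy_form \<Omega> s r (\<lambda>x. c * u x + d * v x) w = c * energy_form \<Omega> s r u w + d * energy_form \<Omega> s r v w"
proof -
  let ?M = "lebesgue_on \<Omega>"
  note int = energy_integrable[OF s u(1,3)] energy_integrable[OF s u(2,3)] energy_integrable[OF s H1_lincomb(1)[OF \<Omega> u(1,2)] u(3), of c d]
  have "energy_form \<Omega> s r (\<lambda>x. c * u x + d * v x) w = (LINT x|?M. c * (s x * (grad \<Omega> u x \<bullet> grad \<Omega> w x) + r x * u x * w x)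
    + d * (s x * (grad \<Omega> v x \<bullet> grad \<Omega> w x) + r x * v x * w x))"
    unfolding energy_form_def
  proof (rule integral_cong_AE)
    show "AE x in ?M. s x * (grad \<Omega> (\<lambda>x. c * u x + d * v x) x \<bullet> grad \<Omega> w x) + r x * (c * u x + d * v x) * w x =
       c * (s x * (grad \<Omega> u x \<bullet> grad \<Omega> w x) + r x * u x * w x) + d * (s x * (grad \<Omega> v x \<bullet> grad \<Omega> w x) + r x * v x * w x)"
      using H1_lincomb(2)[OF \<Omega> u(1,2), of c d] by eventually_elim (simp add: inner_add_left algebra_simps)
  qed (use int in \<open>auto intro!: borel_measurable_integrable\<close>)
  also have "\<dots> = c * energy_form \<Omega> s r u w + d * energy_form \<Omega> s r v w"
    using int by (simp add: energy_form_def)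
  finally show ?thesis .
qed

lemma energy_form_add_coefficients:
  assumes "AE_bounded (lebesgue_on \<Omega>) s C" "AE_bounded (lebesgue_on \<Omega>) r C'"
    "AE_bounded (lebesgue_on \<Omega>) s' D" "AE_bounded (lebesgue_on \<Omega>) r' D'" and u: "u \<in> H1 \<Omega>" "v \<in> H1 \<Omega>"
  shows "energy_form \<Omega> (\<lambda>x. s x + s' x) (\<lambda>x. r x + r' x) u v = energy_form \<Omega> s r u v + energy_form \<Omega> s' r' u v"
  using energy_integrable[OF assms(1,2) u] energy_integrable[OF assms(3,4) u]
  by (simp add: energy_form_def distrib_right)

lemma energy_form_space:
  assumes \<Omega>: "open \<Omega>" and s: "AE_bounded (lebesgue_on \<Omega>) s C" "AE_bounded (lebesgue_on \<Omega>) r C'"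
    and nn: "AE x in lebesgue_on \<Omega>. 0 \<le> s x" "AE x in lebesgue_on \<Omega>. 0 \<le> r x"
  shows "form_space (H1 \<Omega>) (energy_form \<Omega> s r)"
proof
  fix u v w :: "'a \<Rightarrow> real" and c d :: real
  show "energy_form \<Omega> s r u v = energy_form \<Omega> s r v u" by (rule energy_form_sym)
  assume u: "u \<in> H1 \<Omega>"
  show "0 \<le> energy_form \<Omega> s r u u"
    unfolding energy_form_def
  proof (rule integral_nonneg_AE)
    show "AE x in lebesgue_on \<Omega>. 0 \<le> s x * (grad \<Omega> u x \<bullet> grad \<Omega> u x) + r x * u x * u x"
      using nn by eventually_elim (simp add: mult.assoc)
  qed
  assume v: "v \<in> H1 \<Omega>"
  show "(\<lambda>x. c * u x + d * v x) \<in> H1 \<Omega>" by (rule H1_lincomb[OF \<Omega> u v])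
  assume w: "w \<in> H1 \<Omega>"
  show "energy_form \<Omega> s r (\<lambda>x. c * u x + d * v x) w = c * energy_form \<Omega> s r u w + d * energy_form \<Omega> s r v w"
    by (rule energy_form_lincomb[OF \<Omega> s u v w])
qed

lemma energy_form_1: "u \<in> H1 \<Omega> \<Longrightarrow> energy_form \<Omega> (\<lambda>_. 1) (\<lambda>_. 1) u u = (H1_norm \<Omega> u)\<^sup>2"
  using L2_integrable[OF H1_L2, of u \<Omega>] L2_integrable[OF grad(1), of u \<Omega>]
  by (simp add: H1_norm_square energy_form_def dot_square_norm flip: power2_eq_square)

lemma AE_bounded_const: "AE_bounded M (\<lambda>_. c) \<bar>c\<bar>"
  by (simp add: AE_bounded_def)

lemma H1_form_space: "open \<Omega> \<Longrightarrow> form_space (H1 \<Omega>) (energy_form \<Omega> (\<lambda>_. 1) (\<lambda>_. 1))"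
  by (rule energy_form_space[OF _ AE_bounded_const AE_bounded_const]) auto

text \<open>The Cauchy-Schwarz inequality, pointwise for the vectors that consist of the gradient and the value, and
  then for the integral of the product of their norms \<open>N\<close>.\<close>

lemma energy_form_bounded:
  assumes s: "AE_bounded (lebesgue_on \<Omega>) s \<eta>" "AE_bounded (lebesgue_on \<Omega>) r \<eta>" and \<eta>: "\<eta> \<ge> 0" and u: "u \<in> H1 \<Omega>" "v \<in> H1 \<Omega>"
  shows "\<bar>energy_form \<Omega> s r u v\<bar> \<le> \<eta> * (H1_norm \<Omega> u * H1_norm \<Omega> v)"
proof -
  let ?M = "lebesgue_on \<Omega>"
  define N where "N w x = sqrt ((w x)\<^sup>2 + (norm (grad \<Omega> w x))\<^sup>2)" for w :: "'a \<Rightarrow> real" and x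
  have N: "N w \<in> L2 ?M" "(LINT x|?M. (N w x)\<^sup>2) = (H1_norm \<Omega> w)\<^sup>2" if w: "w \<in> H1 \<Omega>" for w
  proof -
    have sq: "(N w x)\<^sup>2 = (w x)\<^sup>2 + (norm (grad \<Omega> w x))\<^sup>2" for x by (simp add: N_def)
    have i: "integrable ?M (\<lambda>x. (w x)\<^sup>2)" "integrable ?M (\<lambda>x. (norm (grad \<Omega> w x))\<^sup>2)"
      using L2_integrable[OF H1_L2[OF w]] L2_integrable[OF grad(1)[OF w]] by simp_all
    have [measurable]: "w \<in> borel_measurable ?M" "grad \<Omega> w \<in> borel_measurable ?M"
      using L2_measurable H1_L2 grad(1) w by blast+
    have "N w \<in> borel_measurable ?M" unfolding N_def[abs_def] by measurable
    then show "N w \<in> L2 ?M" using i by (simp add: L2_def sq)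
    show "(LINT x|?M. (N w x)\<^sup>2) = (H1_norm \<Omega> w)\<^sup>2" using i by (simp add: sq H1_norm_square[OF w])
  qed
  have pt: "\<bar>s x * (grad \<Omega> u x \<bullet> grad \<Omega> v x) + r x * u x * v x\<bar> \<le> \<eta> * (N u x * N v x)"
    if "\<bar>s x\<bar> \<le> \<eta>" "\<bar>r x\<bar> \<le> \<eta>" for x
  proof -
    let ?a = "norm (grad \<Omega> u x)" and ?b = "norm (grad \<Omega> v x)"
    have "\<bar>s x * (grad \<Omega> u x \<bullet> grad \<Omega> v x)\<bar> \<le> \<eta> * (?a * ?b)"
      using that Cauchy_Schwarz_ineq2[of "grad \<Omega> u x" "grad \<Omega> v x"] by (simp add: abs_mult mult_mono)
    moreover have "\<bar>r x * u x * v x\<bar> \<le> \<eta> * (\<bar>u x\<bar> * \<bar>v x\<bar>)"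
      using that by (simp add: abs_mult mult.assoc mult_right_mono)
    ultimately have "\<bar>s x * (grad \<Omega> u x \<bullet> grad \<Omega> v x) + r x * u x * v x\<bar> \<le> \<eta> * (?a * ?b + \<bar>u x\<bar> * \<bar>v x\<bar>)"
      by (simp add: distrib_left)
    also have "?a * ?b + \<bar>u x\<bar> * \<bar>v x\<bar> \<le> N u x * N v x"
    proof -
      have "(?a * ?b + \<bar>u x\<bar> * \<bar>v x\<bar>)\<^sup>2 \<le> ((u x)\<^sup>2 + ?a\<^sup>2) * ((v x)\<^sup>2 + ?b\<^sup>2)"
        using zero_le_power2[of "?a * \<bar>v x\<bar> - ?b * \<bar>u x\<bar>"] by (simp add: power2_eq_square algebra_simps)
      then have "?a * ?b + \<bar>u x\<bar> * \<bar>v x\<bar> \<le> sqrt (((u x)\<^sup>2 + ?a\<^sup>2) * ((v x)\<^sup>2 + ?b\<^sup>2))" by (rule real_le_rsqrt)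
      then show ?thesis by (simp add: N_def real_sqrt_mult)
    qed
    finally show ?thesis using \<eta> by (simp add: mult_left_mono)
  qed
  note int = energy_integrable[OF s u]
  have NN: "integrable ?M (\<lambda>x. N u x * N v x)" by (intro L2_mult_integrable N u)
  have "\<bar>energy_form \<Omega> s r u v\<bar> \<le> (LINT x|?M. \<bar>s x * (grad \<Omega> u x \<bullet> grad \<Omega> v x) + r x * u x * v x\<bar>)"
    unfolding energy_form_def by (rule integral_abs_bound)
  also have "\<dots> \<le> (LINT x|?M. \<eta> * (N u x * N v x))"
  proof (rule integral_mono_AE)
    have "AE x in ?M. \<bar>s x\<bar> \<le> \<eta>" "AE x in ?M. \<bar>r x\<bar> \<le> \<eta>" using s by (auto simp: AE_bounded_def)
    then show "AE x in ?M. \<bar>s x * (grad \<Omega> u x \<bullet> grad \<Omega> v x) + r x * u x * v x\<bar> \<le> \<eta> * (N u x * N v x)"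
      by eventually_elim (rule pt)
  qed (use int NN in auto)
  also have "\<dots> = \<eta> * (LINT x|?M. N u x * N v x)" by simp
  also have "(LINT x|?M. N u x * N v x) \<le> sqrt (LINT x|?M. (N u x)\<^sup>2) * sqrt (LINT x|?M. (N v x)\<^sup>2)"
    using L2_Cauchy_Schwarz[OF N(1)[OF u(1)] N(1)[OF u(2)]] by linarith
  also have "\<dots> = H1_norm \<Omega> u * H1_norm \<Omega> v" by (simp add: N u H1_norm_nonneg)
  finally show ?thesis using \<eta> by (simp add: mult_left_mono)
qed

lemma energy_form_coercive:
  assumes \<Omega>: "open \<Omega>" and s: "AE_bounded (lebesgue_on \<Omega>) s C" "AE_bounded (lebesgue_on \<Omega>) r C'"
    and c: "AE x in lebesgue_on \<Omega>. c \<le> s x" "AE x in lebesgue_on \<Omega>. c \<le> r x" and u: "u \<in> H1 \<Omega>"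
  shows "c * (H1_norm \<Omega> u)\<^sup>2 \<le> energy_form \<Omega> s r u u"
proof -
  let ?M = "lebesgue_on \<Omega>"
  have i: "integrable ?M (\<lambda>x. (u x)\<^sup>2)" "integrable ?M (\<lambda>x. (norm (grad \<Omega> u x))\<^sup>2)"
    using L2_integrable[OF H1_L2[OF u]] L2_integrable[OF grad(1)[OF u]] by simp_all
  have "c * (H1_norm \<Omega> u)\<^sup>2 = (LINT x|?M. c * (norm (grad \<Omega> u x))\<^sup>2 + c * (u x)\<^sup>2)"
    using i by (simp add: H1_norm_square[OF u] distrib_left)
  also have "\<dots> \<le> energy_form \<Omega> s r u u"
    unfolding energy_form_def
  proof (rule integral_mono_AE)
    show "AE x in ?M. c * (norm (grad \<Omega> u x))\<^sup>2 + c * (u x)\<^sup>2 \<le> s x * (grad \<Omega> u x \<bullet> grad \<Omega> u x) + r x * u x * u x"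
      using c
    proof eventually_elim
      case (elim x)
      then show ?case
        using mult_right_mono[of c "s x" "(norm (grad \<Omega> u x))\<^sup>2"] mult_right_mono[of c "r x" "(u x)\<^sup>2"]
        by (simp add: dot_square_norm mult.assoc flip: power2_eq_square)
    qed
  qed (use i energy_integrable[OF s u u] in auto)
  finally show ?thesis .
qed

text \<open>Both components of the graph of the gradient converge in \<open>L2\<close>, and the graph is closed.\<close>

lemma H1_complete:
  assumes \<Omega>: "open \<Omega>" and u: "\<And>n. u n \<in> H1 \<Omega>"
    and Cauchy: "\<And>\<epsilon>. \<epsilon> > 0 \<Longrightarrow> \<exists>N. \<forall>m\<ge>N. \<forall>n\<ge>N. (H1_norm \<Omega> (\<lambda>x. u m x - u n x))\<^sup>2 < \<epsilon>"
  obtains u' where "u' \<in> H1 \<Omega>" "(\<lambda>n::nat. (H1_norm \<Omega> (\<lambda>x. u n x - u' x))\<^sup>2) \<longlonglongrightarrow> 0"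
proof -
  let ?M = "lebesgue_on \<Omega>"
  have sq: "(H1_norm \<Omega> (\<lambda>x. v x - w x))\<^sup>2 = (LINT x|?M. (norm (v x - w x))\<^sup>2) + (LINT x|?M. (norm (grad \<Omega> v x - grad \<Omega> w x))\<^sup>2)"
    if "v \<in> H1 \<Omega>" "w \<in> H1 \<Omega>" for v w
  proof -
    note d = H1_diff[OF \<Omega> that]
    have "(LINT x|?M. (norm (grad \<Omega> (\<lambda>x. v x - w x) x))\<^sup>2) = (LINT x|?M. (norm (grad \<Omega> v x - grad \<Omega> w x))\<^sup>2)"
      by (rule LINT_norm_square_cong_AE[OF L2_measurable[OF grad(1)[OF d(1)]] L2_measurable[OF L2_diff[OF grad(1)[OF that(1)] grad(1)[OF that(2)]]] d(2)])
    then show ?thesis by (simp add: H1_norm_square[OF d(1)])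
  qed
  have nn: "0 \<le> (LINT x|?M. (norm (f x))\<^sup>2)" for f :: "'a \<Rightarrow> 'c::real_normed_vector" by (rule Bochner_Integration.integral_nonneg) simp
  have C1: "\<exists>N. \<forall>m\<ge>N. \<forall>n\<ge>N. (LINT x|?M. (norm (u m x - u n x))\<^sup>2) < \<epsilon>"
    and C2: "\<exists>N. \<forall>m\<ge>N. \<forall>n\<ge>N. (LINT x|?M. (norm (grad \<Omega> (u m) x - grad \<Omega> (u n) x))\<^sup>2) < \<epsilon>" if "\<epsilon> > 0" for \<epsilon>
  proof -
    obtain N where N: "\<And>m n. m \<ge> N \<Longrightarrow> n \<ge> N \<Longrightarrow> (H1_norm \<Omega> (\<lambda>x. u m x - u n x))\<^sup>2 < \<epsilon>" using Cauchy[OF \<open>\<epsilon> > 0\<close>] by blast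
    have "(LINT x|?M. (norm (u m x - u n x))\<^sup>2) < \<epsilon>" "(LINT x|?M. (norm (grad \<Omega> (u m) x - grad \<Omega> (u n) x))\<^sup>2) < \<epsilon>"
      if "m \<ge> N" "n \<ge> N" for m n
      using N[OF that] sq[OF u[of m] u[of n]] nn[of "\<lambda>x. u m x - u n x"] nn[of "\<lambda>x. grad \<Omega> (u m) x - grad \<Omega> (u n) x"] by linarith+
    then show "\<exists>N. \<forall>m\<ge>N. \<forall>n\<ge>N. (LINT x|?M. (norm (u m x - u n x))\<^sup>2) < \<epsilon>"
      "\<exists>N. \<forall>m\<ge>N. \<forall>n\<ge>N. (LINT x|?M. (norm (grad \<Omega> (u m) x - grad \<Omega> (u n) x))\<^sup>2) < \<epsilon>" by blast+
  qed
  obtain u' where u': "u' \<in> L2 ?M" "(\<lambda>n. LINT x|?M. (norm (u n x - u' x))\<^sup>2) \<longlonglongrightarrow> 0"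
    using L2_complete[OF H1_L2[OF u] C1] by blast
  obtain G where G: "G \<in> L2 ?M" "(\<lambda>n. LINT x|?M. (norm (grad \<Omega> (u n) x - G x))\<^sup>2) \<longlonglongrightarrow> 0"
    using L2_complete[OF grad(1)[OF u] C2] by blast
  have "weak_gradient \<Omega> u' G"
    by (rule weak_gradient_closed[OF \<Omega> H1_L2[OF u] grad(1)[OF u] u'(1) G(1) grad(2)[OF u] u'(2) G(2)])
  note H = H1_I[OF \<Omega> u'(1) G(1) this]
  have "(LINT x|?M. (norm (grad \<Omega> (u n) x - grad \<Omega> u' x))\<^sup>2) = (LINT x|?M. (norm (grad \<Omega> (u n) x - G x))\<^sup>2)" for n
    by (rule LINT_norm_square_cong_AE[OF L2_measurable[OF L2_diff[OF grad(1)[OF u] grad(1)[OF H(1)]]] L2_measurable[OF L2_diff[OF grad(1)[OF u] G(1)]]])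
      (use H(2) in \<open>auto elim!: eventually_mono\<close>)
  then have "(\<lambda>n. (H1_norm \<Omega> (\<lambda>x. u n x - u' x))\<^sup>2) \<longlonglongrightarrow> 0 + 0"
    unfolding sq[OF u H(1)] using u'(2) G(2) by (intro tendsto_add) simp_all
  with H(1) that show ?thesis by simp
qed

section \<open>Existence, uniqueness, linearity and boundedness of the trace\<close>

locale trace_domain =
  fixes \<Omega> :: "'a::euclidean_space set"
  assumes domain: "smooth_bounded_domain \<Omega>" and dim: "DIM('a) \<ge> 2"
begin

abbreviation "S \<equiv> surface_measure \<Omega>"

lemma open_domain: "open \<Omega>" and bounded_domain: "bounded \<Omega>"
  using domain by (auto simp: smooth_bounded_domain_def)

sublocale H: form_space "H1 \<Omega>" "energy_form \<Omega> (\<lambda>_. 1) (\<lambda>_. 1)"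
  by (rule H1_form_space[OF open_domain])

lemma H1_norm_lincomb_le:
  assumes "u \<in> H1 \<Omega>" "v \<in> H1 \<Omega>"
  shows "(H1_norm \<Omega> (\<lambda>x. c * u x + d * v x))\<^sup>2 \<le> 2 * c\<^sup>2 * (H1_norm \<Omega> u)\<^sup>2 + 2 * d\<^sup>2 * (H1_norm \<Omega> v)\<^sup>2"
  using H.form_lincomb_le[OF assms, of c d] by (simp add: energy_form_1 assms H.lincomb_closed)

lemma smooth_in_H1: "smooth \<phi> \<Longrightarrow> \<phi> \<in> H1 \<Omega>"
  by (rule smooth_H1[OF open_domain bounded_domain])

lemma smooth_S_measurable: "smooth \<phi> \<Longrightarrow> \<phi> \<in> borel_measurable S"
  unfolding surface_measure_def by (rule measurable_restrict_space1) (simp add: measurable_cong_sets[OF sets_hausdorff_measure refl] smooth_measurable)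

lemma smooth_trace_bound:
  obtains C where "C \<ge> 0" "\<And>\<phi>. smooth \<phi> \<Longrightarrow> \<phi> \<in> L2 S" "\<And>\<phi>. smooth \<phi> \<Longrightarrow> (LINT x|S. (\<phi> x)\<^sup>2) \<le> C * (H1_norm \<Omega> \<phi>)\<^sup>2"
proof -
  obtain C where C: "C \<ge> 0" "\<And>\<phi>. smooth \<phi> \<Longrightarrow> (\<integral>\<^sup>+x. ennreal ((\<phi> x)\<^sup>2) \<partial>S)
    \<le> ennreal C * (\<integral>\<^sup>+y. ennreal ((\<phi> y)\<^sup>2 + (norm (cgrad \<phi> y))\<^sup>2) * indicator \<Omega> y \<partial>lborel)"
    using smooth_trace_inequality[OF domain dim] by blast
  have nn: "(\<integral>\<^sup>+x. ennreal ((\<phi> x)\<^sup>2) \<partial>S) \<le> ennreal (C * (H1_norm \<Omega> \<phi>)\<^sup>2)" if \<phi>: "smooth \<phi>" for \<phi>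
  proof -
    let ?F = "\<lambda>y. (\<phi> y)\<^sup>2 + (norm (cgrad \<phi> y))\<^sup>2"
    have L: "\<phi> \<in> L2 (lebesgue_on \<Omega>)" "cgrad \<phi> \<in> L2 (lebesgue_on \<Omega>)"
      by (intro continuous_L2 open_domain bounded_domain smooth_continuous cgrad_continuous \<phi>)+
    have i: "integrable (lebesgue_on \<Omega>) (\<lambda>x. (\<phi> x)\<^sup>2)" "integrable (lebesgue_on \<Omega>) (\<lambda>x. (norm (cgrad \<phi> x))\<^sup>2)"
      using L2_integrable[OF L(1)] L2_integrable[OF L(2)] by simp_all
    have "(\<integral>\<^sup>+y. ennreal (?F y) * indicator \<Omega> y \<partial>lborel) = (\<integral>\<^sup>+y. ennreal (?F y) * indicator \<Omega> y \<partial>lebesgue)"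
      by (simp only: nn_integral_completion)
    also have "\<dots> = (\<integral>\<^sup>+y. ennreal (?F y) \<partial>lebesgue_on \<Omega>)"
      using open_domain by (subst nn_integral_restrict_space) auto
    also have "\<dots> = ennreal (LINT y|lebesgue_on \<Omega>. ?F y)"
      using i by (intro nn_integral_eq_integral) auto
    also have "(LINT y|lebesgue_on \<Omega>. ?F y) = (LINT x|lebesgue_on \<Omega>. (\<phi> x)\<^sup>2) + (LINT x|lebesgue_on \<Omega>. (norm (cgrad \<phi> x))\<^sup>2)"
      using i by simp
    also have "(LINT x|lebesgue_on \<Omega>. (norm (cgrad \<phi> x))\<^sup>2) = (LINT x|lebesgue_on \<Omega>. (norm (grad \<Omega> \<phi> x))\<^sup>2)"
      by (rule LINT_norm_square_cong_AE[OF L2_measurable[OF L(2)] L2_measurable[OF grad(1)[OF smooth_in_H1[OF \<phi>]]]])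
        (use smooth_H1(2)[OF open_domain bounded_domain \<phi>] in \<open>auto elim!: eventually_mono\<close>)
    finally have "(\<integral>\<^sup>+y. ennreal (?F y) * indicator \<Omega> y \<partial>lborel) = ennreal ((H1_norm \<Omega> \<phi>)\<^sup>2)"
      by (simp add: H1_norm_square[OF smooth_in_H1[OF \<phi>]])
    then show ?thesis using C(2)[OF \<phi>] C(1) by (simp add: ennreal_mult)
  qed
  show ?thesis
  proof
    show "C \<ge> 0" by (rule C(1))
    fix \<phi> :: "'a \<Rightarrow> real" assume \<phi>: "smooth \<phi>"
    show "\<phi> \<in> L2 S"
      using nn[OF \<phi>] by (intro L2_I_nn smooth_S_measurable \<phi>) (auto intro: le_less_trans)
    show "(LINT x|S. (\<phi> x)\<^sup>2) \<le> C * (H1_norm \<Omega> \<phi>)\<^sup>2"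
      by (rule integral_real_bounded[OF _ nn[OF \<phi>]]) (use C(1) in simp)
  qed
qed

lemma smooth_L2_S:
  assumes "smooth \<phi>" shows "\<phi> \<in> L2 S"
  by (rule smooth_trace_bound) (use assms in simp)

lemma LINT_S_lincomb_le:
  fixes f g :: "'a \<Rightarrow> real"
  assumes "f \<in> L2 S" "g \<in> L2 S"
  shows "(LINT x|S. (c * f x + d * g x)\<^sup>2) \<le> 2 * c\<^sup>2 * (LINT x|S. (f x)\<^sup>2) + 2 * d\<^sup>2 * (LINT x|S. (g x)\<^sup>2)"
  using form_space.form_lincomb_le[OF L2_form_space assms, of c d] by (simp add: power2_eq_square)

text \<open>The restrictions to the boundary of smooth functions that approximate \<open>u\<close> are Cauchy by the trace
  inequality.\<close>

lemma has_trace_exists: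
  assumes u: "u \<in> H1 \<Omega>" obtains h where "has_trace \<Omega> u h"
proof -
  obtain C where C: "C \<ge> 0" "\<And>\<phi>. smooth \<phi> \<Longrightarrow> (LINT x|S. (\<phi> x)\<^sup>2) \<le> C * (H1_norm \<Omega> \<phi>)\<^sup>2"
    by (rule smooth_trace_bound, rule that)
  have "\<exists>\<phi>. smooth \<phi> \<and> (H1_norm \<Omega> (\<lambda>x. \<phi> x - u x))\<^sup>2 < 1 / real (Suc n)" for n
  proof -
    have "1 / real (Suc n) > 0" by simp
    then obtain \<phi> where \<phi>: "smooth \<phi>" "(LINT x|lebesgue_on \<Omega>. (norm (\<phi> x - u x))\<^sup>2) + (LINT x|lebesgue_on \<Omega>. (norm (cgrad \<phi> x - grad \<Omega> u x))\<^sup>2) < 1 / real (Suc n)"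
      using smooth_dense_H1[OF domain u] unfolding approximable_def by blast
    note d = H1_diff[OF open_domain smooth_in_H1[OF \<phi>(1)] u]
    have "(LINT x|lebesgue_on \<Omega>. (norm (grad \<Omega> (\<lambda>x. \<phi> x - u x) x))\<^sup>2) = (LINT x|lebesgue_on \<Omega>. (norm (cgrad \<phi> x - grad \<Omega> u x))\<^sup>2)"
    proof (rule LINT_norm_square_cong_AE)
      show "grad \<Omega> (\<lambda>x. \<phi> x - u x) \<in> borel_measurable (lebesgue_on \<Omega>)" by (intro L2_measurable grad d)
      show "(\<lambda>x. cgrad \<phi> x - grad \<Omega> u x) \<in> borel_measurable (lebesgue_on \<Omega>)"
        by (intro L2_measurable L2_diff continuous_L2 open_domain bounded_domain cgrad_continuous \<phi> grad u)
      show "AE x in lebesgue_on \<Omega>. grad \<Omega> (\<lambda>x. \<phi> x - u x) x = cgrad \<phi> x - grad \<Omega> u x"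
        using d(2) smooth_H1(2)[OF open_domain bounded_domain \<phi>(1)] by eventually_elim simp
    qed
    then show ?thesis using \<phi> by (auto simp: H1_norm_square[OF d(1)])
  qed
  then obtain \<phi> where \<phi>: "\<And>n. smooth (\<phi> n)" "\<And>n. (H1_norm \<Omega> (\<lambda>x. \<phi> n x - u x))\<^sup>2 < 1 / real (Suc n)" by metis
  have diff: "(LINT x|S. (norm (\<phi> m x - \<phi> n x))\<^sup>2) \<le> 2 * C * (1 / real (Suc m) + 1 / real (Suc n))" for m n
  proof -
    have "(LINT x|S. (\<phi> m x - \<phi> n x)\<^sup>2) \<le> C * (H1_norm \<Omega> (\<lambda>x. \<phi> m x - \<phi> n x))\<^sup>2"
      by (rule C(2)) (intro smooth_diff \<phi>)
    also have "\<dots> \<le> C * (2 * (1 / real (Suc m) + 1 / real (Suc n)))"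
    proof (rule mult_left_mono[OF _ C(1)])
      have "(H1_norm \<Omega> (\<lambda>x. \<phi> m x - \<phi> n x))\<^sup>2 \<le> 2 * (H1_norm \<Omega> (\<lambda>x. \<phi> m x - u x))\<^sup>2 + 2 * (H1_norm \<Omega> (\<lambda>x. \<phi> n x - u x))\<^sup>2"
        using H1_norm_lincomb_le[OF H1_diff(1)[OF open_domain smooth_in_H1[OF \<phi>(1)[of m]] u] H1_diff(1)[OF open_domain smooth_in_H1[OF \<phi>(1)[of n]] u], of 1 "-1"]
        by simp
      also have "\<dots> \<le> 2 * (1 / real (Suc m) + 1 / real (Suc n))" using \<phi>(2)[of m] \<phi>(2)[of n] by argo
      finally show "(H1_norm \<Omega> (\<lambda>x. \<phi> m x - \<phi> n x))\<^sup>2 \<le> 2 * (1 / real (Suc m) + 1 / real (Suc n))" .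
    qed
    finally show ?thesis by (simp add: mult_ac)
  qed
  have "\<exists>N. \<forall>m\<ge>N. \<forall>n\<ge>N. (LINT x|S. (norm (\<phi> m x - \<phi> n x))\<^sup>2) < \<epsilon>" if "\<epsilon> > 0" for \<epsilon>
  proof -
    have "(\<lambda>n. 4 * C * (1 / real (Suc n))) \<longlonglongrightarrow> 0"
      using tendsto_mult[OF tendsto_const[of "4 * C"] lim_1_over_n[THEN LIMSEQ_Suc]] by simp
    from order_tendstoD(2)[OF this that] obtain N where N: "4 * C * (1 / real (Suc N)) < \<epsilon>"
      unfolding eventually_sequentially by blast
    have "(LINT x|S. (norm (\<phi> m x - \<phi> n x))\<^sup>2) < \<epsilon>" if "m \<ge> N" "n \<ge> N" for m n
    proof -
      have "1 / real (Suc m) + 1 / real (Suc n) \<le> 1 / real (Suc N) + 1 / real (Suc N)"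
        using that by (intro add_mono frac_le) auto
      then have "2 * C * (1 / real (Suc m) + 1 / real (Suc n)) \<le> 2 * C * (1 / real (Suc N) + 1 / real (Suc N))"
        using C(1) by (intro mult_left_mono) auto
      then show ?thesis using diff[of m n] N by argo
    qed
    then show ?thesis by blast
  qed
  then obtain h where h: "h \<in> L2 S" "(\<lambda>n. LINT x|S. (norm (\<phi> n x - h x))\<^sup>2) \<longlonglongrightarrow> 0"
    using L2_complete[of \<phi> S] smooth_L2_S[OF \<phi>(1)] by blast
  have "(\<lambda>n. (H1_norm \<Omega> (\<lambda>x. \<phi> n x - u x))\<^sup>2) \<longlonglongrightarrow> 0"
    by (rule Lim_null_comparison[OF _ lim_1_over_n[THEN LIMSEQ_Suc]])
      (use \<phi>(2) in \<open>auto intro!: always_eventually less_imp_le simp del: of_nat_Suc\<close>)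
  from tendsto_real_sqrt[OF this] have "(\<lambda>n. H1_norm \<Omega> (\<lambda>x. \<phi> n x - u x)) \<longlonglongrightarrow> 0"
    by (simp add: H1_norm_nonneg)
  then have "has_trace \<Omega> u h" unfolding has_trace_def using u h \<phi>(1) by auto
  then show ?thesis by (rule that)
qed

lemma has_trace_lincomb:
  assumes "has_trace \<Omega> u h" "has_trace \<Omega> v k"
  shows "has_trace \<Omega> (\<lambda>x. c * u x + d * v x) (\<lambda>x. c * h x + d * k x)"
proof -
  obtain \<phi> where \<phi>: "\<And>n. smooth (\<phi> n)" "(\<lambda>n. H1_norm \<Omega> (\<lambda>x. \<phi> n x - u x)) \<longlonglongrightarrow> 0" "(\<lambda>n. LINT x|S. (\<phi> n x - h x)\<^sup>2) \<longlonglongrightarrow> 0"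
    using assms(1) by (auto simp: has_trace_def)
  obtain \<psi> where \<psi>: "\<And>n. smooth (\<psi> n)" "(\<lambda>n. H1_norm \<Omega> (\<lambda>x. \<psi> n x - v x)) \<longlonglongrightarrow> 0" "(\<lambda>n. LINT x|S. (\<psi> n x - k x)\<^sup>2) \<longlonglongrightarrow> 0"
    using assms(2) by (auto simp: has_trace_def)
  have u: "u \<in> H1 \<Omega>" "v \<in> H1 \<Omega>" and h: "h \<in> L2 S" "k \<in> L2 S" using assms by (auto simp: has_trace_def)
  define \<xi> where "\<xi> n x = c * \<phi> n x + d * \<psi> n x" for n x
  have sm: "smooth (\<xi> n)" for n unfolding \<xi>_def[abs_def] by (intro smooth_add smooth_mult smooth_const \<phi> \<psi>)
  have "(\<lambda>n. (H1_norm \<Omega> (\<lambda>x. \<xi> n x - (c * u x + d * v x)))\<^sup>2) \<longlonglongrightarrow> 0"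
  proof (rule Lim_null_comparison)
    have "(\<lambda>n. 2 * c\<^sup>2 * (H1_norm \<Omega> (\<lambda>x. \<phi> n x - u x))\<^sup>2 + 2 * d\<^sup>2 * (H1_norm \<Omega> (\<lambda>x. \<psi> n x - v x))\<^sup>2) \<longlonglongrightarrow> 2 * c\<^sup>2 * 0\<^sup>2 + 2 * d\<^sup>2 * 0\<^sup>2"
      by (intro tendsto_intros \<phi> \<psi>)
    then show "(\<lambda>n. 2 * c\<^sup>2 * (H1_norm \<Omega> (\<lambda>x. \<phi> n x - u x))\<^sup>2 + 2 * d\<^sup>2 * (H1_norm \<Omega> (\<lambda>x. \<psi> n x - v x))\<^sup>2) \<longlonglongrightarrow> 0" by simp
    have "(H1_norm \<Omega> (\<lambda>x. \<xi> n x - (c * u x + d * v x)))\<^sup>2 \<le> 2 * c\<^sup>2 * (H1_norm \<Omega> (\<lambda>x. \<phi> n x - u x))\<^sup>2 + 2 * d\<^sup>2 * (H1_norm \<Omega> (\<lambda>x. \<psi> n x - v x))\<^sup>2" for n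
      using H1_norm_lincomb_le[OF H1_diff(1)[OF open_domain smooth_in_H1[OF \<phi>(1)[of n]] u(1)] H1_diff(1)[OF open_domain smooth_in_H1[OF \<psi>(1)[of n]] u(2)], of c d]
      by (simp add: \<xi>_def algebra_simps)
    then show "\<forall>\<^sub>F n in sequentially. norm ((H1_norm \<Omega> (\<lambda>x. \<xi> n x - (c * u x + d * v x)))\<^sup>2) \<le> 2 * c\<^sup>2 * (H1_norm \<Omega> (\<lambda>x. \<phi> n x - u x))\<^sup>2 + 2 * d\<^sup>2 * (H1_norm \<Omega> (\<lambda>x. \<psi> n x - v x))\<^sup>2"
      by simp
  qed
  from tendsto_real_sqrt[OF this] have 1: "(\<lambda>n. H1_norm \<Omega> (\<lambda>x. \<xi> n x - (c * u x + d * v x))) \<longlonglongrightarrow> 0"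
    by (simp add: H1_norm_nonneg)
  have 2: "(\<lambda>n. LINT x|S. (\<xi> n x - (c * h x + d * k x))\<^sup>2) \<longlonglongrightarrow> 0"
  proof (rule Lim_null_comparison)
    have "(\<lambda>n. 2 * c\<^sup>2 * (LINT x|S. (\<phi> n x - h x)\<^sup>2) + 2 * d\<^sup>2 * (LINT x|S. (\<psi> n x - k x)\<^sup>2)) \<longlonglongrightarrow> 2 * c\<^sup>2 * 0 + 2 * d\<^sup>2 * 0"
      by (intro tendsto_intros \<phi> \<psi>)
    then show "(\<lambda>n. 2 * c\<^sup>2 * (LINT x|S. (\<phi> n x - h x)\<^sup>2) + 2 * d\<^sup>2 * (LINT x|S. (\<psi> n x - k x)\<^sup>2)) \<longlonglongrightarrow> 0" by simp
    have "(LINT x|S. (\<xi> n x - (c * h x + d * k x))\<^sup>2) \<le> 2 * c\<^sup>2 * (LINT x|S. (\<phi> n x - h x)\<^sup>2) + 2 * d\<^sup>2 * (LINT x|S. (\<psi> n x - k x)\<^sup>2)" for n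
      using LINT_S_lincomb_le[OF L2_diff[OF smooth_L2_S[OF \<phi>(1)] h(1)] L2_diff[OF smooth_L2_S[OF \<psi>(1)] h(2)], of c n d n]
      by (simp add: \<xi>_def algebra_simps)
    then show "\<forall>\<^sub>F n in sequentially. norm (LINT x|S. (\<xi> n x - (c * h x + d * k x))\<^sup>2) \<le> 2 * c\<^sup>2 * (LINT x|S. (\<phi> n x - h x)\<^sup>2) + 2 * d\<^sup>2 * (LINT x|S. (\<psi> n x - k x)\<^sup>2)"
      by simp
  qed
  show ?thesis
    unfolding has_trace_def using sm 1 2 H.lincomb_closed[OF u] L2_lincomb_real[OF h] by blast
qed

text \<open>The factor 4 over the bound for smooth functions comes from splitting \<open>h\<close> and \<open>u\<close> with
  \<open>(a + b)\<^sup>2 \<le> 2 a\<^sup>2 + 2 b\<^sup>2\<close>.\<close>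

lemma trace_bound:
  obtains C where "C \<ge> 0" "\<And>u h. has_trace \<Omega> u h \<Longrightarrow> (LINT x|S. (h x)\<^sup>2) \<le> C * (H1_norm \<Omega> u)\<^sup>2"
proof -
  obtain C where C: "C \<ge> 0" "\<And>\<phi>. smooth \<phi> \<Longrightarrow> (LINT x|S. (\<phi> x)\<^sup>2) \<le> C * (H1_norm \<Omega> \<phi>)\<^sup>2"
    by (rule smooth_trace_bound, rule that)
  have "(LINT x|S. (h x)\<^sup>2) \<le> 4 * C * (H1_norm \<Omega> u)\<^sup>2" if ht: "has_trace \<Omega> u h" for u h
  proof -
    obtain \<phi> where \<phi>: "\<And>n. smooth (\<phi> n)" "(\<lambda>n. H1_norm \<Omega> (\<lambda>x. \<phi> n x - u x)) \<longlonglongrightarrow> 0" "(\<lambda>n. LINT x|S. (\<phi> n x - h x)\<^sup>2) \<longlonglongrightarrow> 0"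
      using ht by (auto simp: has_trace_def)
    have u: "u \<in> H1 \<Omega>" and h: "h \<in> L2 S" using ht by (auto simp: has_trace_def)
    have le: "(LINT x|S. (h x)\<^sup>2) \<le> 2 * (LINT x|S. (\<phi> n x - h x)\<^sup>2) + 4 * C * (H1_norm \<Omega> (\<lambda>x. \<phi> n x - u x))\<^sup>2 + 4 * C * (H1_norm \<Omega> u)\<^sup>2" for n
    proof -
      have "(LINT x|S. (h x)\<^sup>2) \<le> 2 * (LINT x|S. (\<phi> n x)\<^sup>2) + 2 * (LINT x|S. (\<phi> n x - h x)\<^sup>2)"
        using LINT_S_lincomb_le[OF smooth_L2_S[OF \<phi>(1)] L2_diff[OF smooth_L2_S[OF \<phi>(1)] h], of 1 n "-1" n] by simp
      moreover have "(LINT x|S. (\<phi> n x)\<^sup>2) \<le> C * (H1_norm \<Omega> (\<phi> n))\<^sup>2" by (rule C(2)[OF \<phi>(1)])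
      moreover have "C * (H1_norm \<Omega> (\<phi> n))\<^sup>2 \<le> C * (2 * (H1_norm \<Omega> (\<lambda>x. \<phi> n x - u x))\<^sup>2 + 2 * (H1_norm \<Omega> u)\<^sup>2)"
        using H1_norm_lincomb_le[OF H1_diff(1)[OF open_domain smooth_in_H1[OF \<phi>(1)[of n]] u] u, of 1 1] C(1) by (intro mult_left_mono) auto
      ultimately show ?thesis by (simp add: algebra_simps)
    qed
    have "(\<lambda>n. 2 * (LINT x|S. (\<phi> n x - h x)\<^sup>2) + 4 * C * (H1_norm \<Omega> (\<lambda>x. \<phi> n x - u x))\<^sup>2 + 4 * C * (H1_norm \<Omega> u)\<^sup>2) \<longlonglongrightarrow> 2 * 0 + 4 * C * 0\<^sup>2 + 4 * C * (H1_norm \<Omega> u)\<^sup>2"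
      by (intro tendsto_intros \<phi>)
    from LIMSEQ_le_const[OF this] le show ?thesis by auto
  qed
  with C(1) that[of "4 * C"] show ?thesis by simp
qed

text \<open>The difference of two traces of \<open>u\<close> is a trace of zero, so its norm is zero.\<close>

lemma has_trace_unique:
  assumes "has_trace \<Omega> u h" "has_trace \<Omega> u k" shows "AE x in S. h x = k x"
proof -
  obtain C where C: "\<And>u h. has_trace \<Omega> u h \<Longrightarrow> (LINT x|S. (h x)\<^sup>2) \<le> C * (H1_norm \<Omega> u)\<^sup>2"
    by (rule trace_bound, rule that)
  have u: "u \<in> H1 \<Omega>" and h: "h \<in> L2 S" "k \<in> L2 S" using assms by (auto simp: has_trace_def)
  have z: "(H1_norm \<Omega> (\<lambda>x. u x - u x))\<^sup>2 = 0"
    using H.form_square[OF u u, of 1 "-1"] H.diff_closed[OF u u] by (simp add: energy_form_1)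
  have "(LINT x|S. (h x - k x)\<^sup>2) \<le> C * (H1_norm \<Omega> (\<lambda>x. u x - u x))\<^sup>2"
    using C[OF has_trace_lincomb[OF assms, of 1 "-1"]] by simp
  then have "(LINT x|S. (h x - k x)\<^sup>2) \<le> 0" using z by simp
  moreover have "0 \<le> (LINT x|S. (h x - k x)\<^sup>2)" by (rule Bochner_Integration.integral_nonneg) simp
  ultimately have "(LINT x|S. (h x - k x)\<^sup>2) = 0" by simp
  then have "AE x in S. (h x - k x)\<^sup>2 = 0"
    using integral_nonneg_eq_0_iff_AE[of S "\<lambda>x. (h x - k x)\<^sup>2"] L2_integrable[OF L2_diff[OF h]] by simp
  then show ?thesis by eventually_elim simp
qed

abbreviation tr :: "('a \<Rightarrow> real) \<Rightarrow> 'a \<Rightarrow> real" where "tr \<equiv> boundary_trace \<Omega>"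

lemma has_trace_tr: "u \<in> H1 \<Omega> \<Longrightarrow> has_trace \<Omega> u (tr u)"
  using has_trace_exists[of u] someI[of "has_trace \<Omega> u"] unfolding boundary_trace_def by blast

lemma tr_L2: "u \<in> H1 \<Omega> \<Longrightarrow> tr u \<in> L2 S"
  using has_trace_tr by (auto simp: has_trace_def)

lemma tr_lincomb: "u \<in> H1 \<Omega> \<Longrightarrow> v \<in> H1 \<Omega> \<Longrightarrow> AE x in S. tr (\<lambda>x. c * u x + d * v x) x = c * tr u x + d * tr v x"
  by (rule has_trace_unique[OF has_trace_tr[OF H.lincomb_closed] has_trace_lincomb[OF has_trace_tr has_trace_tr]])

lemma tr_diff: "u \<in> H1 \<Omega> \<Longrightarrow> v \<in> H1 \<Omega> \<Longrightarrow> AE x in S. tr (\<lambda>x. u x - v x) x = tr u x - tr v x"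
  using tr_lincomb[of u v 1 "-1"] by simp

lemma flux_functional_lincomb:
  assumes "g \<in> L2 S" "u \<in> H1 \<Omega>" "v \<in> H1 \<Omega>"
  shows "(LINT x|S. g x * tr (\<lambda>x. c * u x + d * v x) x) = c * (LINT x|S. g x * tr u x) + d * (LINT x|S. g x * tr v x)"
proof -
  note i = L2_mult_integrable[OF assms(1) tr_L2[OF assms(2)]] L2_mult_integrable[OF assms(1) tr_L2[OF assms(3)]]
    L2_mult_integrable[OF assms(1) tr_L2[OF H.lincomb_closed[OF assms(2,3)]], of c d]
  have "(LINT x|S. g x * tr (\<lambda>x. c * u x + d * v x) x) = (LINT x|S. c * (g x * tr u x) + d * (g x * tr v x))"
    by (rule integral_cong_AE)
      (use i tr_lincomb[OF assms(2,3), of c d] in \<open>auto intro!: borel_measurable_integrable elim!: eventually_mono simp: algebra_simps\<close>)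
  also have "\<dots> = c * (LINT x|S. g x * tr u x) + d * (LINT x|S. g x * tr v x)" using i by simp
  finally show ?thesis .
qed

lemma flux_functional_bounded:
  assumes "g \<in> L2 S" obtains C where "C \<ge> 0" "\<And>v. v \<in> H1 \<Omega> \<Longrightarrow> \<bar>LINT x|S. g x * tr v x\<bar> \<le> C * H1_norm \<Omega> v"
proof -
  obtain C where C: "C \<ge> 0" "\<And>u h. has_trace \<Omega> u h \<Longrightarrow> (LINT x|S. (h x)\<^sup>2) \<le> C * (H1_norm \<Omega> u)\<^sup>2"
    by (rule trace_bound, rule that)
  have "\<bar>LINT x|S. g x * tr v x\<bar> \<le> sqrt (LINT x|S. (g x)\<^sup>2) * sqrt C * H1_norm \<Omega> v" if v: "v \<in> H1 \<Omega>" for v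
  proof -
    have "\<bar>LINT x|S. g x * tr v x\<bar> \<le> sqrt (LINT x|S. (g x)\<^sup>2) * sqrt (LINT x|S. (tr v x)\<^sup>2)"
      by (rule L2_Cauchy_Schwarz[OF assms tr_L2[OF v]])
    also have "sqrt (LINT x|S. (tr v x)\<^sup>2) \<le> sqrt (C * (H1_norm \<Omega> v)\<^sup>2)"
      using C(2)[OF has_trace_tr[OF v]] by simp
    also have "\<dots> = sqrt C * H1_norm \<Omega> v" by (simp add: real_sqrt_mult H1_norm_nonneg)
    finally show ?thesis by (simp add: mult_left_mono mult.assoc)
  qed
  then show ?thesis using that[of "sqrt (LINT x|S. (g x)\<^sup>2) * sqrt C"] C(1) by simp
qed

end

section \<open>Essentially bounded coefficients\<close>

lemma AE_False_imp_null: "AE x in M. False \<Longrightarrow> emeasure M (space M) = 0"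
  by (simp add: eventually_False ae_filter_eq_bot_iff)

lemma Linf_AE_bounded:
  assumes "f \<in> Linf M" shows "AE_bounded M f (Linf_norm M f)"
proof -
  have m: "f \<in> borel_measurable M" and fin: "esssup M (\<lambda>x. ereal \<bar>f x\<bar>) < \<infinity>"
    using assms by (auto simp: Linf_def)
  have "AE x in M. ereal \<bar>f x\<bar> \<le> esssup M (\<lambda>x. ereal \<bar>f x\<bar>)" by (rule esssup_AE)
  then have "AE x in M. \<bar>f x\<bar> \<le> Linf_norm M f"
    unfolding Linf_norm_def by eventually_elim (use fin in \<open>cases "esssup M (\<lambda>x. ereal \<bar>f x\<bar>)", auto\<close>)
  with m show ?thesis by (simp add: AE_bounded_def)
qed

text \<open>Over a null space the essential supremum is \<open>-\<infinity>\<close>, which \<open>real_of_ereal\<close> maps to zero.\<close>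

lemma Linf_norm_nonneg: "0 \<le> Linf_norm M f"
proof (rule ccontr)
  assume "\<not> 0 \<le> Linf_norm M f"
  then have neg: "real_of_ereal (esssup M (\<lambda>x. ereal \<bar>f x\<bar>)) < 0" by (simp add: Linf_norm_def)
  then have lt: "esssup M (\<lambda>x. ereal \<bar>f x\<bar>) < 0" by (cases "esssup M (\<lambda>x. ereal \<bar>f x\<bar>)") auto
  have "AE x in M. ereal \<bar>f x\<bar> \<le> esssup M (\<lambda>x. ereal \<bar>f x\<bar>)" by (rule esssup_AE)
  then have "AE x in M. False"
  proof eventually_elim
    case (elim x)
    then have "ereal \<bar>f x\<bar> < 0" using lt by (rule order.strict_trans1)
    then show False by simp
  qed
  then have "emeasure M (space M) = 0" by (rule AE_False_imp_null)
  moreover have "(\<lambda>x. ereal \<bar>f x\<bar>) \<in> borel_measurable M"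
  proof (rule ccontr)
    assume "\<not> ?thesis"
    then show False using lt esssup_non_measurable[of "\<lambda>x. ereal \<bar>f x\<bar>" M] by (simp add: top_ereal_def)
  qed
  ultimately have "esssup M (\<lambda>x. ereal \<bar>f x\<bar>) = - \<infinity>" by (rule esssup_zero_space)
  then show False using neg by simp
qed

lemma AE_bounded_mono: "AE_bounded M f C \<Longrightarrow> C \<le> D \<Longrightarrow> AE_bounded M f D"
  by (auto simp: AE_bounded_def)

lemma AE_bounded_imp_Linf: "AE_bounded M f C \<Longrightarrow> f \<in> Linf M"
  using esssup_I[of "\<lambda>x. ereal \<bar>f x\<bar>" M "ereal C"] by (auto simp: AE_bounded_def Linf_def)

lemma AE_bounded_add:
  assumes "AE_bounded M f C" "AE_bounded M g D" shows "AE_bounded M (\<lambda>x. f x + g x) (C + D)"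
proof -
  have "AE x in M. \<bar>f x\<bar> \<le> C" "AE x in M. \<bar>g x\<bar> \<le> D" using assms by (auto simp: AE_bounded_def)
  then have "AE x in M. \<bar>f x + g x\<bar> \<le> C + D" by eventually_elim linarith
  then show ?thesis using assms by (auto simp: AE_bounded_def)
qed

lemma AE_bounded_mult:
  assumes "AE_bounded M f C" "AE_bounded M g D" shows "AE_bounded M (\<lambda>x. f x * g x) (C * D)"
proof -
  have "AE x in M. \<bar>f x\<bar> \<le> C" "AE x in M. \<bar>g x\<bar> \<le> D" using assms by (auto simp: AE_bounded_def)
  then have "AE x in M. \<bar>f x * g x\<bar> \<le> C * D"
    by eventually_elim (auto simp: abs_mult intro!: mult_mono order_trans[OF abs_ge_zero])
  then show ?thesis using assms by (auto simp: AE_bounded_def)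
qed

definition elliptic :: "'a measure \<Rightarrow> ('a \<Rightarrow> real) \<Rightarrow> ('a \<Rightarrow> real) \<Rightarrow> real \<Rightarrow> real \<Rightarrow> bool"
  where "elliptic M \<sigma> q c C \<longleftrightarrow> 0 < c \<and> 0 \<le> C \<and> AE_bounded M \<sigma> C \<and> AE_bounded M q C \<and>
    (AE x in M. c \<le> \<sigma> x) \<and> (AE x in M. c \<le> q x)"

lemma Linf_pos_lower_bound:
  assumes "f \<in> Linf_pos M" obtains c where "c > 0" "AE x in M. c \<le> f x"
proof -
  let ?E = "esssup M (\<lambda>x. ereal (- f x))"
  have E: "?E < 0" using assms by (simp add: Linf_pos_def essinf_def ereal_uminus_less_reorder)
  have AE: "AE x in M. ereal (- f x) \<le> ?E" by (rule esssup_AE)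
  show ?thesis
  proof (cases ?E)
    case (real r)
    then have "- r > 0" using E by simp
    moreover have "AE x in M. - r \<le> f x" using AE by eventually_elim (simp add: real)
    ultimately show ?thesis by (rule that)
  next
    case PInf
    then show ?thesis using E by simp
  next
    \<comment> \<open>The space is a null set here, so every bound holds almost everywhere.\<close>
    case MInf
    have "AE x in M. 1 \<le> f x" using AE by eventually_elim (simp add: MInf)
    with that[of 1] show ?thesis by simp
  qed
qed

lemma Linf_pos_elliptic:
  assumes "\<sigma> \<in> Linf_pos M" "q \<in> Linf_pos M" obtains c C where "elliptic M \<sigma> q c C"
proof -
  obtain c1 where c1: "c1 > 0" "AE x in M. c1 \<le> \<sigma> x" using Linf_pos_lower_bound[OF assms(1)] by blast
  obtain c2 where c2: "c2 > 0" "AE x in M. c2 \<le> q x" using Linf_pos_lower_bound[OF assms(2)] by blast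
  have L: "\<sigma> \<in> Linf M" "q \<in> Linf M" using assms by (auto simp: Linf_pos_def)
  have "AE x in M. min c1 c2 \<le> \<sigma> x" using c1(2) by eventually_elim simp
  moreover have "AE x in M. min c1 c2 \<le> q x" using c2(2) by eventually_elim simp
  ultimately have "elliptic M \<sigma> q (min c1 c2) (max (Linf_norm M \<sigma>) (Linf_norm M q))"
    using c1(1) c2(1) Linf_norm_nonneg[of M \<sigma>] AE_bounded_mono[OF Linf_AE_bounded[OF L(1)]] AE_bounded_mono[OF Linf_AE_bounded[OF L(2)]]
    by (auto simp: elliptic_def le_max_iff_disj)
  then show ?thesis by (rule that)
qed

lemma Linf_pos_I:
  assumes "AE_bounded M f C" "c > 0" "AE x in M. c \<le> f x" shows "f \<in> Linf_pos M"
proof -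
  have [measurable]: "f \<in> borel_measurable M" using assms by (simp add: AE_bounded_def)
  have "esssup M (\<lambda>x. ereal (- f x)) \<le> ereal (- c)"
    by (rule esssup_I) (use assms(3) in auto)
  then have "ereal c \<le> essinf M f" unfolding essinf_def
    by (metis ereal_minus_le_minus ereal_uminus_uminus uminus_ereal.simps(1))
  then have "0 < essinf M f" using assms(2) by (metis ereal_less(2) order.strict_trans2)
  then show ?thesis using AE_bounded_imp_Linf[OF assms(1)] by (simp add: Linf_pos_def)
qed

lemma elliptic_Linf_pos: "elliptic M \<sigma> q c C \<Longrightarrow> \<sigma> \<in> Linf_pos M \<and> q \<in> Linf_pos M"
  by (auto simp: elliptic_def intro: Linf_pos_I)

lemma elliptic_perturb:
  assumes "elliptic M \<sigma> q c C" "AE_bounded M s \<eta>" "AE_bounded M r \<eta>" "0 \<le> \<eta>" "\<eta> \<le> c/2"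
  shows "elliptic M (\<lambda>x. \<sigma> x + s x) (\<lambda>x. q x + r x) (c/2) (C + \<eta>)"
proof -
  have *: "AE x in M. c \<le> \<sigma> x" "AE x in M. c \<le> q x" "AE x in M. \<bar>s x\<bar> \<le> \<eta>" "AE x in M. \<bar>r x\<bar> \<le> \<eta>"
    using assms by (auto simp: elliptic_def AE_bounded_def)
  have "AE x in M. c/2 \<le> \<sigma> x + s x" using *(1,3) by eventually_elim (use assms(5) in linarith)
  moreover have "AE x in M. c/2 \<le> q x + r x" using *(2,4) by eventually_elim (use assms(5) in linarith)
  ultimately show ?thesis
    using assms AE_bounded_add[of M \<sigma> C s \<eta>] AE_bounded_add[of M q C r \<eta>] by (auto simp: elliptic_def)
qed

section \<open>Solutions of the boundary value problems\<close>

context trace_domain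
begin

abbreviation "M \<equiv> lebesgue_on \<Omega>"

lemma elliptic_form_space:
  assumes "elliptic M \<sigma> q c C" shows "form_space (H1 \<Omega>) (energy_form \<Omega> \<sigma> q)"
proof -
  have c: "0 < c" "AE x in M. c \<le> \<sigma> x" "AE x in M. c \<le> q x" "AE_bounded M \<sigma> C" "AE_bounded M q C"
    using assms by (auto simp: elliptic_def)
  have "AE x in M. 0 \<le> \<sigma> x" using c(2) by eventually_elim (use c(1) in simp)
  moreover have "AE x in M. 0 \<le> q x" using c(3) by eventually_elim (use c(1) in simp)
  ultimately show ?thesis by (rule energy_form_space[OF open_domain c(4,5)])
qed

lemma elliptic_coercive: "elliptic M \<sigma> q c C \<Longrightarrow> u \<in> H1 \<Omega> \<Longrightarrow> c * (H1_norm \<Omega> u)\<^sup>2 \<le> energy_form \<Omega> \<sigma> q u u"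
  unfolding elliptic_def by (rule energy_form_coercive[OF open_domain]) auto

lemma elliptic_bounded: "elliptic M \<sigma> q c C \<Longrightarrow> u \<in> H1 \<Omega> \<Longrightarrow> v \<in> H1 \<Omega> \<Longrightarrow>
    \<bar>energy_form \<Omega> \<sigma> q u v\<bar> \<le> C * (H1_norm \<Omega> u * H1_norm \<Omega> v)"
  unfolding elliptic_def by (rule energy_form_bounded) auto

text \<open>The energy form is equivalent to the inner product of \<open>H1\<close>, so the Riesz representation theorem
  applies to it on closed subspaces. These are \<open>H1\<close> for Neumann and \<open>H10\<close> for Dirichlet data.\<close>

lemma weak_solution_exists:
  assumes ell: "elliptic M \<sigma> q c C" and V: "V \<subseteq> H1 \<Omega>" "V \<noteq> {}"
    and lin: "\<And>u v c d. u \<in> V \<Longrightarrow> v \<in> V \<Longrightarrow> (\<lambda>x. c * u x + d * v x) \<in> V"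
    and closed: "\<And>u u'. (\<And>n. u n \<in> V) \<Longrightarrow> u' \<in> H1 \<Omega> \<Longrightarrow> (\<lambda>n::nat. (H1_norm \<Omega> (\<lambda>x. u n x - u' x))\<^sup>2) \<longlonglongrightarrow> 0 \<Longrightarrow> u' \<in> V"
    and l: "\<And>u v c d. u \<in> V \<Longrightarrow> v \<in> V \<Longrightarrow> l (\<lambda>x. c * u x + d * v x) = c * l u + d * l v"
    and bdd: "\<And>v. v \<in> V \<Longrightarrow> \<bar>l v\<bar> \<le> A * H1_norm \<Omega> v" and A: "A \<ge> 0"
  shows "\<exists>u\<in>V. \<forall>v\<in>V. energy_form \<Omega> \<sigma> q u v = l v"
proof -
  let ?a = "energy_form \<Omega> \<sigma> q"
  interpret E: form_space "H1 \<Omega>" ?a by (rule elliptic_form_space[OF ell])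
  have c: "c > 0" "C \<ge> 0" using ell by (auto simp: elliptic_def)
  have VH: "v \<in> H1 \<Omega>" if "v \<in> V" for v using that V(1) by blast
  interpret V: form_space V ?a
    using lin VH E.form_sym E.form_lincomb E.form_nonneg by unfold_locales auto
  show ?thesis
  proof (rule V.Riesz_representation[OF V(2) _ l])
    show "\<bar>l v\<bar> \<le> A / sqrt c * sqrt (?a v v)" if v: "v \<in> V" for v
    proof -
      have "sqrt (c * (H1_norm \<Omega> v)\<^sup>2) \<le> sqrt (?a v v)" using elliptic_coercive[OF ell VH[OF v]] by simp
      then have "H1_norm \<Omega> v \<le> sqrt (?a v v) / sqrt c"
        using c by (simp add: real_sqrt_mult H1_norm_nonneg field_simps)
      then have "A * H1_norm \<Omega> v \<le> A * (sqrt (?a v v) / sqrt c)" by (rule mult_left_mono[OF _ A])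
      then show ?thesis using bdd[OF v] by simp
    qed
    fix u :: "nat \<Rightarrow> 'a \<Rightarrow> real"
    assume u: "\<And>n. u n \<in> V"
      and Cauchy: "\<And>\<epsilon>. \<epsilon> > 0 \<Longrightarrow> \<exists>N. \<forall>m\<ge>N. \<forall>n\<ge>N. ?a (\<lambda>x. u m x - u n x) (\<lambda>x. u m x - u n x) < \<epsilon>"
    have uH: "u n \<in> H1 \<Omega>" for n using u VH by blast
    have Cauchy_H1: "\<exists>N. \<forall>m\<ge>N. \<forall>n\<ge>N. (H1_norm \<Omega> (\<lambda>x. u m x - u n x))\<^sup>2 < \<epsilon>" if "\<epsilon> > 0" for \<epsilon>
    proof -
      obtain N where N: "\<forall>m\<ge>N. \<forall>n\<ge>N. ?a (\<lambda>x. u m x - u n x) (\<lambda>x. u m x - u n x) < c * \<epsilon>"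
        using Cauchy[of "c * \<epsilon>"] c(1) \<open>\<epsilon> > 0\<close> by auto
      have "(H1_norm \<Omega> (\<lambda>x. u m x - u n x))\<^sup>2 < \<epsilon>" if "m \<ge> N" "n \<ge> N" for m n
      proof -
        have "c * (H1_norm \<Omega> (\<lambda>x. u m x - u n x))\<^sup>2 < c * \<epsilon>"
          using elliptic_coercive[OF ell H1_diff(1)[OF open_domain uH[of m] uH[of n]]] N that by (meson le_less_trans)
        then show ?thesis using c(1) by simp
      qed
      then show ?thesis by blast
    qed
    obtain u' where u': "u' \<in> H1 \<Omega>" "(\<lambda>n. (H1_norm \<Omega> (\<lambda>x. u n x - u' x))\<^sup>2) \<longlonglongrightarrow> 0"
      by (rule H1_complete[OF open_domain uH Cauchy_H1], assumption, rule that)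
    have "u' \<in> V" by (rule closed[OF u u'])
    moreover have "(\<lambda>n. ?a (\<lambda>x. u n x - u' x) (\<lambda>x. u n x - u' x)) \<longlonglongrightarrow> 0"
    proof (rule Lim_null_comparison)
      show "(\<lambda>n. C * (H1_norm \<Omega> (\<lambda>x. u n x - u' x))\<^sup>2) \<longlonglongrightarrow> 0"
        using tendsto_mult[OF tendsto_const[of C] u'(2)] by simp
      show "\<forall>\<^sub>F n in sequentially. norm (?a (\<lambda>x. u n x - u' x) (\<lambda>x. u n x - u' x)) \<le> C * (H1_norm \<Omega> (\<lambda>x. u n x - u' x))\<^sup>2"
        using elliptic_bounded[OF ell H1_diff(1)[OF open_domain uH u'(1)] H1_diff(1)[OF open_domain uH u'(1)]]
        by (simp add: power2_eq_square)
    qed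
    ultimately show "\<exists>u'\<in>V. (\<lambda>n. ?a (\<lambda>x. u n x - u' x) (\<lambda>x. u n x - u' x)) \<longlonglongrightarrow> 0" by blast
  qed
qed

lemma zero_H1: "(\<lambda>_. 0) \<in> H1 \<Omega>"
  by (rule smooth_in_H1[OF smooth_const])

lemma neumann_solution_weak:
  assumes ell: "elliptic M \<sigma> q c C" and g: "g \<in> L2 S"
  shows "neumann_weak_solution \<Omega> \<sigma> q g (neumann_solution \<Omega> \<sigma> q g)"
proof -
  obtain A where A: "A \<ge> 0" "\<And>v. v \<in> H1 \<Omega> \<Longrightarrow> \<bar>LINT x|S. g x * tr v x\<bar> \<le> A * H1_norm \<Omega> v"
    by (rule flux_functional_bounded[OF g], rule that)
  have "\<exists>u\<in>H1 \<Omega>. \<forall>v\<in>H1 \<Omega>. energy_form \<Omega> \<sigma> q u v = (LINT x|S. g x * tr v x)"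
    by (rule weak_solution_exists[OF ell, where l="\<lambda>v. LINT x|S. g x * tr v x" and A=A])
      (use zero_H1 H.lincomb_closed flux_functional_lincomb[OF g] A in auto)
  then have "\<exists>u. neumann_weak_solution \<Omega> \<sigma> q g u" by (auto simp: neumann_weak_solution_def)
  then show ?thesis unfolding neumann_solution_def by (rule someI_ex)
qed

definition H10 :: "('a \<Rightarrow> real) set"
  where "H10 = {v \<in> H1 \<Omega>. AE x in S. tr v x = 0}"

lemma H10_lincomb: "u \<in> H10 \<Longrightarrow> v \<in> H10 \<Longrightarrow> (\<lambda>x. c * u x + d * v x) \<in> H10"
proof -
  assume uv: "u \<in> H10" "v \<in> H10"
  then have *: "u \<in> H1 \<Omega>" "v \<in> H1 \<Omega>" "AE x in S. tr u x = 0" "AE x in S. tr v x = 0" by (auto simp: H10_def)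
  have "AE x in S. tr (\<lambda>x. c * u x + d * v x) x = 0"
    using tr_lincomb[OF *(1,2), of c d] *(3,4) by eventually_elim simp
  then show ?thesis using H.lincomb_closed[OF *(1,2)] by (simp add: H10_def)
qed

text \<open>The trace is bounded, so the trace of the limit is approximated by zero.\<close>

lemma H10_closed:
  assumes u: "\<And>n. u n \<in> H10" and u': "u' \<in> H1 \<Omega>"
    and lim: "(\<lambda>n::nat. (H1_norm \<Omega> (\<lambda>x. u n x - u' x))\<^sup>2) \<longlonglongrightarrow> 0"
  shows "u' \<in> H10"
proof -
  obtain C where C: "C \<ge> 0" "\<And>u h. has_trace \<Omega> u h \<Longrightarrow> (LINT x|S. (h x)\<^sup>2) \<le> C * (H1_norm \<Omega> u)\<^sup>2"
    by (rule trace_bound, rule that)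
  have uH: "u n \<in> H1 \<Omega>" and tu: "AE x in S. tr (u n) x = 0" for n using u[of n] by (auto simp: H10_def)
  have "(LINT x|S. (tr u' x)\<^sup>2) \<le> C * (H1_norm \<Omega> (\<lambda>x. u n x - u' x))\<^sup>2" for n
  proof -
    note d = H1_diff(1)[OF open_domain uH[of n] u']
    have "(LINT x|S. (norm (tr u' x))\<^sup>2) = (LINT x|S. (norm (- tr (\<lambda>x. u n x - u' x) x))\<^sup>2)"
    proof (rule LINT_norm_square_cong_AE)
      show "tr u' \<in> borel_measurable S" by (intro L2_measurable tr_L2 u')
      show "(\<lambda>x. - tr (\<lambda>x. u n x - u' x) x) \<in> borel_measurable S"
        using L2_measurable[OF tr_L2[OF d]] by measurable
      show "AE x in S. tr u' x = - tr (\<lambda>x. u n x - u' x) x"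
        using tr_diff[OF uH[of n] u'] tu[of n] by eventually_elim simp
    qed
    then show ?thesis using C(2)[OF has_trace_tr[OF d]] by simp
  qed
  moreover have "(\<lambda>n. C * (H1_norm \<Omega> (\<lambda>x. u n x - u' x))\<^sup>2) \<longlonglongrightarrow> 0"
    using tendsto_mult[OF tendsto_const[of C] lim] by simp
  ultimately have "(LINT x|S. (tr u' x)\<^sup>2) \<le> 0" by (intro LIMSEQ_le_const) auto
  moreover have "0 \<le> (LINT x|S. (tr u' x)\<^sup>2)" by (rule Bochner_Integration.integral_nonneg) simp
  ultimately have "(LINT x|S. (tr u' x)\<^sup>2) = 0" by simp
  then have "AE x in S. (tr u' x)\<^sup>2 = 0"
    using integral_nonneg_eq_0_iff_AE[of S "\<lambda>x. (tr u' x)\<^sup>2"] L2_integrable[OF tr_L2[OF u']] by simp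
  then have "AE x in S. tr u' x = 0" by eventually_elim simp
  with u' show ?thesis by (simp add: H10_def)
qed

lemma zero_H10: "(\<lambda>_. 0) \<in> H10"
  using tr_lincomb[OF zero_H1 zero_H1, of 0 0] zero_H1 by (simp add: H10_def)

text \<open>The solution is \<open>u0 - w\<close>, where \<open>w\<close> is the orthogonal projection of the extension \<open>u0\<close> of the boundary
  data to the functions with zero trace.\<close>

lemma dirichlet_solution_weak:
  assumes ell: "elliptic M \<sigma> q c C" and u0: "u0 \<in> H1 \<Omega>" "AE x in S. f x = tr u0 x"
  shows "dirichlet_weak_solution \<Omega> \<sigma> q f (dirichlet_solution \<Omega> \<sigma> q f)"
proof -
  let ?a = "energy_form \<Omega> \<sigma> q"
  interpret E: form_space "H1 \<Omega>" ?a by (rule elliptic_form_space[OF ell])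
  have C: "C \<ge> 0" using ell by (simp add: elliptic_def)
  have "\<exists>w\<in>H10. \<forall>v\<in>H10. ?a w v = ?a u0 v"
  proof (rule weak_solution_exists[OF ell, where A="C * H1_norm \<Omega> u0"])
    show "H10 \<subseteq> H1 \<Omega>" by (auto simp: H10_def)
    show "H10 \<noteq> {}" using zero_H10 by blast
    show "?a u0 (\<lambda>x. c * u x + d * v x) = c * ?a u0 u + d * ?a u0 v" if "u \<in> H10" "v \<in> H10" for u v c d
      using that u0(1) E.form_lincomb[of u v u0 c d] by (simp add: H10_def E.form_sym[of u0])
    show "\<bar>?a u0 v\<bar> \<le> C * H1_norm \<Omega> u0 * H1_norm \<Omega> v" if "v \<in> H10" for v
      using elliptic_bounded[OF ell u0(1), of v] that by (simp add: H10_def mult.assoc)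
    show "0 \<le> C * H1_norm \<Omega> u0" using C by (simp add: H1_norm_nonneg)
  qed (fact H10_lincomb H10_closed)+
  then obtain w where w: "w \<in> H10" "\<And>v. v \<in> H10 \<Longrightarrow> ?a w v = ?a u0 v" by blast
  then have wH: "w \<in> H1 \<Omega>" and tw: "AE x in S. tr w x = 0" by (auto simp: H10_def)
  have "dirichlet_weak_solution \<Omega> \<sigma> q f (\<lambda>x. u0 x - w x)"
    unfolding dirichlet_weak_solution_def
  proof (intro conjI ballI impI)
    show "(\<lambda>x. u0 x - w x) \<in> H1 \<Omega>" by (rule E.diff_closed[OF u0(1) wH])
    show "AE x in S. tr (\<lambda>x. u0 x - w x) x = f x"
      using tr_diff[OF u0(1) wH] tw u0(2) by eventually_elim simp
    fix v assume "v \<in> H1 \<Omega>" "AE x in S. tr v x = 0"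
    then show "?a (\<lambda>x. u0 x - w x) v = 0"
      using w(2)[of v] E.form_diff_left[OF u0(1) wH, of v] by (simp add: H10_def)
  qed
  then show ?thesis
    unfolding dirichlet_solution_def by (rule someI[of "dirichlet_weak_solution \<Omega> \<sigma> q f"])
qed

section \<open>First variation of the energies\<close>

text \<open>If \<open>w\<close> solves the perturbed equation with the right-hand side that the perturbation of the
  coefficients produces from \<open>u\<close>, then \<open>w\<close> is of first order by coercivity, and its pairing with the
  perturbation is of second order.\<close>

lemma second_order_remainder:
  assumes ell: "elliptic M \<sigma> q c C" and s: "AE_bounded M s \<eta>" "AE_bounded M r \<eta>" and \<eta>: "0 \<le> \<eta>" "\<eta> \<le> c/2"
    and u: "u \<in> H1 \<Omega>" "w \<in> H1 \<Omega>"
    and eq: "energy_form \<Omega> (\<lambda>x. \<sigma> x + s x) (\<lambda>x. q x + r x) w w = - energy_form \<Omega> s r u w"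
  shows "\<bar>energy_form \<Omega> s r w u\<bar> \<le> 2 / c * (H1_norm \<Omega> u)\<^sup>2 * \<eta>\<^sup>2"
proof -
  have c: "c > 0" using ell by (simp add: elliptic_def)
  let ?u = "H1_norm \<Omega> u" and ?w = "H1_norm \<Omega> w"
  have "c/2 * ?w\<^sup>2 \<le> - energy_form \<Omega> s r u w"
    using elliptic_coercive[OF elliptic_perturb[OF ell s \<eta>] u(2)] eq by simp
  also have "\<dots> \<le> \<eta> * (?u * ?w)" using energy_form_bounded[OF s \<eta>(1) u] by simp
  finally have *: "c/2 * ?w * ?w \<le> \<eta> * ?u * ?w" by (simp add: power2_eq_square mult.assoc)
  have "c/2 * ?w \<le> \<eta> * ?u"
  proof (cases "?w = 0")
    case True
    then show ?thesis using \<eta> by (simp add: H1_norm_nonneg)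
  next
    case False
    then have "?w > 0" using H1_norm_nonneg[of \<Omega> w] by simp
    then show ?thesis using * by simp
  qed
  then have w: "?w \<le> 2 / c * (\<eta> * ?u)" using c by (simp add: field_simps)
  have "\<bar>energy_form \<Omega> s r w u\<bar> \<le> \<eta> * (?w * ?u)" by (rule energy_form_bounded[OF s \<eta>(1) u(2,1)])
  also have "\<dots> \<le> \<eta> * (2 / c * (\<eta> * ?u) * ?u)"
    using w \<eta> by (intro mult_left_mono mult_right_mono) (auto simp: H1_norm_nonneg)
  finally show ?thesis by (simp add: power2_eq_square mult_ac)
qed

text \<open>Testing each of the two problems with the solution of the other one gives
  \<open>l u' - l u = a(u, u') - a'(u', u) = - b(u', u)\<close>.\<close>

lemma neumann_energy_variation:
  assumes ell: "elliptic M \<sigma> q c C" and s: "AE_bounded M s \<eta>" "AE_bounded M r \<eta>" and \<eta>: "0 \<le> \<eta>" "\<eta> \<le> c/2"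
    and u: "neumann_weak_solution \<Omega> \<sigma> q g u"
    and u': "neumann_weak_solution \<Omega> (\<lambda>x. \<sigma> x + s x) (\<lambda>x. q x + r x) g u'"
  shows "\<bar>(LINT x|S. g x * tr u' x) - (LINT x|S. g x * tr u x) + energy_form \<Omega> s r u u\<bar> \<le> 2 / c * (H1_norm \<Omega> u)\<^sup>2 * \<eta>\<^sup>2"
proof -
  let ?l = "\<lambda>v. LINT x|S. g x * tr v x" and ?a = "energy_form \<Omega> \<sigma> q" and ?b = "energy_form \<Omega> s r"
  let ?a' = "energy_form \<Omega> (\<lambda>x. \<sigma> x + s x) (\<lambda>x. q x + r x)"
  have H: "u \<in> H1 \<Omega>" "u' \<in> H1 \<Omega>" and eqs: "\<And>v. v \<in> H1 \<Omega> \<Longrightarrow> ?a u v = ?l v" "\<And>v. v \<in> H1 \<Omega> \<Longrightarrow> ?a' u' v = ?l v"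
    using u u' by (auto simp: neumann_weak_solution_def)
  interpret A': form_space "H1 \<Omega>" ?a' by (rule elliptic_form_space[OF elliptic_perturb[OF ell s \<eta>]])
  have split: "?a' v v' = ?a v v' + ?b v v'" if "v \<in> H1 \<Omega>" "v' \<in> H1 \<Omega>" for v v'
    using ell s that unfolding elliptic_def by (intro energy_form_add_coefficients) auto
  let ?w = "\<lambda>x. u' x - u x"
  have w: "?w \<in> H1 \<Omega>" by (rule H1_diff(1)[OF open_domain H(2,1)])
  have "?a' ?w ?w = ?a' u' ?w - ?a' u ?w" by (rule A'.form_diff_left[OF H(2,1) w])
  also have "\<dots> = - ?b u ?w" using eqs w split[OF H(1) w] by simp
  finally have rem: "\<bar>?b ?w u\<bar> \<le> 2 / c * (H1_norm \<Omega> u)\<^sup>2 * \<eta>\<^sup>2"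
    by (rule second_order_remainder[OF ell s \<eta> H(1) w])
  have "?b ?w u = ?b u' u - ?b u u"
    using energy_form_lincomb[OF open_domain s H(2,1,1), of 1 "-1"] by simp
  moreover have "?l u' - ?l u = - ?b u' u"
    using eqs(1)[OF H(2)] eqs(2)[OF H(1)] split[OF H(2,1)] energy_form_sym[of \<Omega> \<sigma> q u u'] by simp
  ultimately show ?thesis using rem by simp
qed

text \<open>The difference of the two solutions has zero trace, so it is an admissible test function in both problems.
  Hence \<open>a'(u', u') - a(u, u) = a'(u', u) - a(u', u) = b(u', u)\<close>.\<close>

lemma dirichlet_energy_variation:
  assumes ell: "elliptic M \<sigma> q c C" and s: "AE_bounded M s \<eta>" "AE_bounded M r \<eta>" and \<eta>: "0 \<le> \<eta>" "\<eta> \<le> c/2"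
    and u: "dirichlet_weak_solution \<Omega> \<sigma> q f u"
    and u': "dirichlet_weak_solution \<Omega> (\<lambda>x. \<sigma> x + s x) (\<lambda>x. q x + r x) f u'"
  shows "\<bar>energy_form \<Omega> (\<lambda>x. \<sigma> x + s x) (\<lambda>x. q x + r x) u' u' - energy_form \<Omega> \<sigma> q u u - energy_form \<Omega> s r u u\<bar>
    \<le> 2 / c * (H1_norm \<Omega> u)\<^sup>2 * \<eta>\<^sup>2"
proof -
  let ?a = "energy_form \<Omega> \<sigma> q" and ?b = "energy_form \<Omega> s r"
  let ?a' = "energy_form \<Omega> (\<lambda>x. \<sigma> x + s x) (\<lambda>x. q x + r x)"
  have H: "u \<in> H1 \<Omega>" "u' \<in> H1 \<Omega>" and t: "AE x in S. tr u x = f x" "AE x in S. tr u' x = f x"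
    and eqs: "\<And>v. v \<in> H10 \<Longrightarrow> ?a u v = 0" "\<And>v. v \<in> H10 \<Longrightarrow> ?a' u' v = 0"
    using u u' by (auto simp: dirichlet_weak_solution_def H10_def)
  interpret A: form_space "H1 \<Omega>" ?a by (rule elliptic_form_space[OF ell])
  interpret A': form_space "H1 \<Omega>" ?a' by (rule elliptic_form_space[OF elliptic_perturb[OF ell s \<eta>]])
  have split: "?a' v v' = ?a v v' + ?b v v'" if "v \<in> H1 \<Omega>" "v' \<in> H1 \<Omega>" for v v'
    using ell s that unfolding elliptic_def by (intro energy_form_add_coefficients) auto
  let ?w = "\<lambda>x. u' x - u x"
  have w: "?w \<in> H1 \<Omega>" by (rule H1_diff(1)[OF open_domain H(2,1)])
  have "AE x in S. tr ?w x = 0" using tr_diff[OF H(2,1)] t by eventually_elim simp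
  then have w0: "?w \<in> H10" using w by (simp add: H10_def)
  have "?a' ?w ?w = ?a' u' ?w - ?a' u ?w" by (rule A'.form_diff_left[OF H(2,1) w])
  also have "\<dots> = - ?b u ?w" using eqs[OF w0] split[OF H(1) w] by simp
  finally have rem: "\<bar>?b ?w u\<bar> \<le> 2 / c * (H1_norm \<Omega> u)\<^sup>2 * \<eta>\<^sup>2"
    by (rule second_order_remainder[OF ell s \<eta> H(1) w])
  have "?b ?w u = ?b u' u - ?b u u"
    using energy_form_lincomb[OF open_domain s H(2,1,1), of 1 "-1"] by simp
  moreover have "?a' u' u' = ?a' u' u"
    using A'.form_diff_left[OF H(2,1,2)] eqs(2)[OF w0] A'.form_sym[of ?w u'] A'.form_sym[of u u'] by simp
  moreover have "?a u' u = ?a u u"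
    using A.form_diff_left[OF H(2,1,1)] eqs(1)[OF w0] A.form_sym[of ?w u] by simp
  ultimately show ?thesis using rem split[OF H(2,1)] by simp
qed

text \<open>The mixed term of the energy of \<open>u - v\<close> is the Neumann problem tested with \<open>v\<close>, so it only depends on the
  boundary values \<open>f\<close> of \<open>v\<close>.\<close>

lemma misfit_energy:
  assumes ell: "elliptic M \<sigma> q c C" and fm: "f \<in> borel_measurable S" and g: "g \<in> L2 S"
    and u: "neumann_weak_solution \<Omega> \<sigma> q g u" and v: "dirichlet_weak_solution \<Omega> \<sigma> q f v"
  shows "(LINT x|M. \<sigma> x * (norm (grad \<Omega> (\<lambda>x. u x - v x) x))\<^sup>2 + q x * (u x - v x)\<^sup>2)
    = (LINT x|S. g x * tr u x) - 2 * (LINT x|S. g x * f x) + energy_form \<Omega> \<sigma> q v v"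
proof -
  let ?a = "energy_form \<Omega> \<sigma> q"
  interpret E: form_space "H1 \<Omega>" ?a by (rule elliptic_form_space[OF ell])
  have H: "u \<in> H1 \<Omega>" "v \<in> H1 \<Omega>" using u v by (auto simp: neumann_weak_solution_def dirichlet_weak_solution_def)
  have "(LINT x|M. \<sigma> x * (norm (grad \<Omega> (\<lambda>x. u x - v x) x))\<^sup>2 + q x * (u x - v x)\<^sup>2) = ?a (\<lambda>x. u x - v x) (\<lambda>x. u x - v x)"
    by (simp add: energy_form_def dot_square_norm mult.assoc flip: power2_eq_square)
  also have "\<dots> = ?a u u - 2 * ?a u v + ?a v v" using E.form_square[OF H, of 1 "-1"] by simp
  also have "?a u u = (LINT x|S. g x * tr u x)" using u H by (simp add: neumann_weak_solution_def)
  also have "?a u v = (LINT x|S. g x * tr v x)" using u H by (simp add: neumann_weak_solution_def)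
  also have "\<dots> = (LINT x|S. g x * f x)"
  proof (rule integral_cong_AE)
    show "(\<lambda>x. g x * tr v x) \<in> borel_measurable S"
      using L2_measurable[OF g] L2_measurable[OF tr_L2[OF H(2)]] by measurable
    show "(\<lambda>x. g x * f x) \<in> borel_measurable S" using L2_measurable[OF g] fm by measurable
    have "AE x in S. tr v x = f x" using v by (simp add: dirichlet_weak_solution_def)
    then show "AE x in S. g x * tr v x = g x * f x" by eventually_elim simp
  qed
  finally show ?thesis .
qed

lemma finite_M: "finite_measure M"
  using lmeasurable_open[OF bounded_domain open_domain] by (intro finite_measureI) (auto simp: emeasure_restrict_space fmeasurable_def space_restrict_space)

lemma AE_bounded_integrable: "AE_bounded M f C \<Longrightarrow> integrable M f"
  using finite_measure.integrable_const_bound[OF finite_M, of f C] by (simp add: AE_bounded_def)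

lemma AE_bounded_integral_le:
  assumes "AE_bounded M f C" shows "\<bar>LINT x|M. f x\<bar> \<le> C * measure M (space M)"
proof -
  interpret finite_measure M by (rule finite_M)
  have "\<bar>LINT x|M. f x\<bar> \<le> (LINT x|M. \<bar>f x\<bar>)" by (rule integral_abs_bound)
  also have "\<dots> \<le> (LINT x|M. C)"
    using AE_bounded_integrable[OF assms] assms by (intro integral_mono_AE) (auto simp: AE_bounded_def)
  finally show ?thesis by (simp add: mult.commute)
qed

lemma energy_form_difference:
  assumes "AE_bounded M s C" "AE_bounded M r C'" "u \<in> H1 \<Omega>" "v \<in> H1 \<Omega>"
  shows "(LINT x|M. s x * ((norm (grad \<Omega> u x))\<^sup>2 - (norm (grad \<Omega> v x))\<^sup>2) + r x * ((u x)\<^sup>2 - (v x)\<^sup>2))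
    = energy_form \<Omega> s r u u - energy_form \<Omega> s r v v"
proof -
  note i = energy_integrable[OF assms(1,2,3,3)] energy_integrable[OF assms(1,2,4,4)]
  have "(LINT x|M. s x * ((norm (grad \<Omega> u x))\<^sup>2 - (norm (grad \<Omega> v x))\<^sup>2) + r x * ((u x)\<^sup>2 - (v x)\<^sup>2))
    = (LINT x|M. (s x * (grad \<Omega> u x \<bullet> grad \<Omega> u x) + r x * u x * u x) - (s x * (grad \<Omega> v x \<bullet> grad \<Omega> v x) + r x * v x * v x))"
    by (rule Bochner_Integration.integral_cong) (simp_all add: dot_square_norm algebra_simps power2_eq_square)
  also have "\<dots> = energy_form \<Omega> s r u u - energy_form \<Omega> s r v v" using i by (simp add: energy_form_def)
  finally show ?thesis .
qed

lemma energy_form_scale_coefficients: "energy_form \<Omega> (\<lambda>x. c * s x) (\<lambda>x. c * r x) u v = c * energy_form \<Omega> s r u v"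
proof -
  have "energy_form \<Omega> (\<lambda>x. c * s x) (\<lambda>x. c * r x) u v = (LINT x|M. c * (s x * (grad \<Omega> u x \<bullet> grad \<Omega> v x) + r x * u x * v x))"
    by (simp add: energy_form_def algebra_simps)
  then show ?thesis by (simp add: energy_form_def)
qed

lemma derivative_bounded_linear:
  assumes ell: "elliptic M \<sigma> q c C" and H: "\<And>k. k \<in> I \<Longrightarrow> u k \<in> H1 \<Omega>" "\<And>k. k \<in> I \<Longrightarrow> v k \<in> H1 \<Omega>"
    and I: "finite I" and \<rho>: "\<rho> \<ge> 0"
    and D: "\<And>s r. s \<in> Linf M \<Longrightarrow> r \<in> Linf M \<Longrightarrow>
      D (s, r) = (\<Sum>k\<in>I. energy_form \<Omega> s r (u k) (u k) - energy_form \<Omega> s r (v k) (v k)) + \<rho> * (LINT x|M. \<sigma> x * s x + q x * r x)"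
  shows "bounded_linear_Linf2 M D"
proof -
  have \<sigma>: "AE_bounded M \<sigma> C" "AE_bounded M q C" "C \<ge> 0" using ell by (auto simp: elliptic_def)
  note b = Linf_AE_bounded
  have int: "integrable M (\<lambda>x. \<sigma> x * s x)" "integrable M (\<lambda>x. q x * s x)" if "s \<in> Linf M" for s
    using AE_bounded_integrable AE_bounded_mult b that \<sigma> by blast+
  have Ladd: "(\<lambda>x. s x + s' x) \<in> Linf M" if "s \<in> Linf M" "s' \<in> Linf M" for s s'
    using AE_bounded_imp_Linf[OF AE_bounded_add[OF b[OF that(1)] b[OF that(2)]]] .
  have Lscale: "(\<lambda>x. a * s x) \<in> Linf M" if "s \<in> Linf M" for a s
    using AE_bounded_imp_Linf[OF AE_bounded_mult[OF AE_bounded_const b[OF that]]] .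
  show ?thesis
    unfolding bounded_linear_Linf2_def
  proof (intro conjI ballI allI)
    fix s r s' r' assume L: "s \<in> Linf M" "r \<in> Linf M" "s' \<in> Linf M" "r' \<in> Linf M"
    have "(LINT x|M. \<sigma> x * (s x + s' x) + q x * (r x + r' x)) = (LINT x|M. (\<sigma> x * s x + q x * r x) + (\<sigma> x * s' x + q x * r' x))"
      by (rule Bochner_Integration.integral_cong) (simp_all add: algebra_simps)
    also have "\<dots> = (LINT x|M. \<sigma> x * s x + q x * r x) + (LINT x|M. \<sigma> x * s' x + q x * r' x)"
      by (rule Bochner_Integration.integral_add) (use int L in auto)
    finally show "D (\<lambda>x. s x + s' x, \<lambda>x. r x + r' x) = D (s, r) + D (s', r')"
      using L energy_form_add_coefficients[OF b[OF L(1)] b[OF L(2)] b[OF L(3)] b[OF L(4)] H(1) H(1)]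
        energy_form_add_coefficients[OF b[OF L(1)] b[OF L(2)] b[OF L(3)] b[OF L(4)] H(2) H(2)]
      by (simp add: D Ladd sum.distrib sum_subtractf distrib_left)
  next
    fix a s r assume L: "s \<in> Linf M" "r \<in> Linf M"
    have "(LINT x|M. \<sigma> x * (a * s x) + q x * (a * r x)) = (LINT x|M. a * (\<sigma> x * s x + q x * r x))"
      by (rule Bochner_Integration.integral_cong) (simp_all add: algebra_simps)
    also have "\<dots> = a * (LINT x|M. \<sigma> x * s x + q x * r x)" by (rule integral_mult_right_zero)
    finally show "D (\<lambda>x. a * s x, \<lambda>x. a * r x) = a * D (s, r)"
      using L by (simp add: D Lscale energy_form_scale_coefficients sum_distrib_left right_diff_distrib distrib_left)
  next
    define N where "N k = (H1_norm \<Omega> (u k))\<^sup>2 + (H1_norm \<Omega> (v k))\<^sup>2" for k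
    let ?A = "(\<Sum>k\<in>I. N k) + \<rho> * (2 * C * measure M (space M))"
    show "\<exists>A. \<forall>s\<in>Linf M. \<forall>r\<in>Linf M. \<bar>D (s, r)\<bar> \<le> A * Linf2_norm M (s, r)"
    proof (intro exI[of _ ?A] ballI)
      fix s r assume L: "s \<in> Linf M" "r \<in> Linf M"
      define \<eta> where "\<eta> = Linf2_norm M (s, r)"
      have \<eta>: "0 \<le> \<eta>" using Linf_norm_nonneg[of M s] by (simp add: \<eta>_def Linf2_norm_def)
      have sr: "AE_bounded M s \<eta>" "AE_bounded M r \<eta>"
        using AE_bounded_mono[OF b[OF L(1)]] AE_bounded_mono[OF b[OF L(2)]] by (auto simp: \<eta>_def Linf2_norm_def)
      have e: "\<bar>energy_form \<Omega> s r w w\<bar> \<le> (H1_norm \<Omega> w)\<^sup>2 * \<eta>" if "w \<in> H1 \<Omega>" for w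
        using energy_form_bounded[OF sr \<eta> that that] by (simp add: power2_eq_square mult_ac)
      have 1: "\<bar>\<Sum>k\<in>I. energy_form \<Omega> s r (u k) (u k) - energy_form \<Omega> s r (v k) (v k)\<bar>
          \<le> (\<Sum>k\<in>I. N k * \<eta>)"
      proof (rule order_trans[OF sum_abs], rule sum_mono)
        fix k assume k: "k \<in> I"
        show "\<bar>energy_form \<Omega> s r (u k) (u k) - energy_form \<Omega> s r (v k) (v k)\<bar> \<le> N k * \<eta>"
          using e[OF H(1)[OF k]] e[OF H(2)[OF k]] by (simp add: N_def distrib_right)
      qed
      have "\<bar>LINT x|M. \<sigma> x * s x + q x * r x\<bar> \<le> (C * \<eta> + C * \<eta>) * measure M (space M)"
        by (intro AE_bounded_integral_le AE_bounded_add AE_bounded_mult \<sigma> sr)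
      then have "\<bar>\<rho> * (LINT x|M. \<sigma> x * s x + q x * r x)\<bar> \<le> \<rho> * ((C * \<eta> + C * \<eta>) * measure M (space M))"
        using \<rho> by (simp add: abs_mult mult_left_mono)
      moreover have "?A * \<eta> = (\<Sum>k\<in>I. N k * \<eta>) + \<rho> * ((C * \<eta> + C * \<eta>) * measure M (space M))"
        unfolding sum_distrib_right[symmetric] by (simp add: algebra_simps)
      ultimately show "\<bar>D (s, r)\<bar> \<le> ?A * Linf2_norm M (s, r)"
        using 1 unfolding \<eta>_def[symmetric] D[OF L] by linarith
    qed
  qed
qed

text \<open>The data \<open>f k\<close> are traces of the Neumann states for \<open>(\<sigma>\<^sub>0, q\<^sub>0)\<close>, which serve as extensions of the
  Dirichlet data into the domain. The remainder \<open>R k\<close> collects the two second order errors of the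
  \<open>k\<close>-th misfit.\<close>

theorem kohn_vogelius_has_frechet_derivative:
  fixes K :: nat
  assumes \<sigma>0: "\<sigma>\<^sub>0 \<in> Linf_pos M" "q\<^sub>0 \<in> Linf_pos M"
    and g: "\<And>k. k \<in> {1..K} \<Longrightarrow> g k \<in> L2 S" and f: "\<And>k. k \<in> {1..K} \<Longrightarrow> f k \<in> L2 S"
    and fg: "\<And>k. k \<in> {1..K} \<Longrightarrow> AE x in S. f k x = neumann_to_dirichlet \<Omega> \<sigma>\<^sub>0 q\<^sub>0 (g k) x"
    and \<rho>: "\<rho> \<ge> 0" and \<sigma>: "\<sigma> \<in> Linf_pos M" "q \<in> Linf_pos M"
    and D: "\<And>s r. D (s, r) = (\<Sum>k=1..K. let ug = neumann_solution \<Omega> \<sigma> q (g k); uf = dirichlet_solution \<Omega> \<sigma> q (f k)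
            in LINT x|M. s x * ((norm (grad \<Omega> uf x))\<^sup>2 - (norm (grad \<Omega> ug x))\<^sup>2) + r x * ((uf x)\<^sup>2 - (ug x)\<^sup>2))
          + \<rho> * (LINT x|M. \<sigma> x * s x + q x * r x)"
  shows "has_frechet_derivative_Linf2 M (kohn_vogelius \<Omega> K g f \<rho>) D (\<sigma>, q)"
proof -
  obtain c0 C0 where ell0: "elliptic M \<sigma>\<^sub>0 q\<^sub>0 c0 C0" using Linf_pos_elliptic[OF \<sigma>0] by blast
  obtain c C where ell: "elliptic M \<sigma> q c C" using Linf_pos_elliptic[OF \<sigma>] by blast
  have c: "c > 0" using ell by (simp add: elliptic_def)
  let ?ug = "\<lambda>\<sigma> q k. neumann_solution \<Omega> \<sigma> q (g k)" and ?uf = "\<lambda>\<sigma> q k. dirichlet_solution \<Omega> \<sigma> q (f k)"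
  have ug: "neumann_weak_solution \<Omega> \<sigma>' q' (g k) (?ug \<sigma>' q' k)" if "elliptic M \<sigma>' q' c' C'" "k \<in> {1..K}" for \<sigma>' q' c' C' k
    by (rule neumann_solution_weak[OF that(1) g[OF that(2)]])
  have uf: "dirichlet_weak_solution \<Omega> \<sigma>' q' (f k) (?uf \<sigma>' q' k)" if e: "elliptic M \<sigma>' q' c' C'" and k: "k \<in> {1..K}" for \<sigma>' q' c' C' k
  proof (rule dirichlet_solution_weak[OF e])
    show "?ug \<sigma>\<^sub>0 q\<^sub>0 k \<in> H1 \<Omega>" using ug[OF ell0 k] by (simp add: neumann_weak_solution_def)
    show "AE x in S. f k x = tr (?ug \<sigma>\<^sub>0 q\<^sub>0 k) x" using fg[OF k] by (simp add: neumann_to_dirichlet_def)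
  qed
  define l where "l k v = (LINT x|S. g k x * tr v x)" for k v
  define m where "m k = (LINT x|S. g k x * f k x)" for k
  define reg where "reg \<sigma>' q' = (LINT x|M. (\<sigma>' x)\<^sup>2 + (q' x)\<^sup>2)" for \<sigma>' q' :: "'a \<Rightarrow> real"
  have J: "kohn_vogelius \<Omega> K g f \<rho> (\<sigma>', q') = (\<Sum>k=1..K. l k (?ug \<sigma>' q' k) - 2 * m k + energy_form \<Omega> \<sigma>' q' (?uf \<sigma>' q' k) (?uf \<sigma>' q' k))
      + \<rho> / 2 * reg \<sigma>' q'" if e: "elliptic M \<sigma>' q' c' C'" for \<sigma>' q' c' C'
    unfolding kohn_vogelius_def prod.case Let_def l_def m_def reg_def
    by (intro arg_cong2[where f="(+)"] sum.cong refl misfit_energy[OF e L2_measurable[OF f] g ug[OF e] uf[OF e]])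
  define ug0 where "ug0 k = ?ug \<sigma> q k" for k
  define uf0 where "uf0 k = ?uf \<sigma> q k" for k
  have H: "ug0 k \<in> H1 \<Omega>" "uf0 k \<in> H1 \<Omega>" if "k \<in> {1..K}" for k
    using ug[OF ell that] uf[OF ell that] by (auto simp: neumann_weak_solution_def dirichlet_weak_solution_def ug0_def uf0_def)
  have D': "D (s, r) = (\<Sum>k=1..K. energy_form \<Omega> s r (uf0 k) (uf0 k) - energy_form \<Omega> s r (ug0 k) (ug0 k)) + \<rho> * (LINT x|M. \<sigma> x * s x + q x * r x)"
    if "s \<in> Linf M" "r \<in> Linf M" for s r
    unfolding D Let_def ug0_def[symmetric] uf0_def[symmetric]
    by (intro arg_cong2[where f="(+)"] sum.cong refl energy_form_difference[OF Linf_AE_bounded[OF that(1)] Linf_AE_bounded[OF that(2)] H(2,1)])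
  define A where "A = (\<Sum>k=1..K. 2 / c * (H1_norm \<Omega> (ug0 k))\<^sup>2 + 2 / c * (H1_norm \<Omega> (uf0 k))\<^sup>2) + \<rho> * measure M (space M)"
  have A: "A \<ge> 0" unfolding A_def using c \<rho> by (intro add_nonneg_nonneg sum_nonneg mult_nonneg_nonneg) auto
  have main: "elliptic M (\<lambda>x. \<sigma> x + s x) (\<lambda>x. q x + r x) (c/2) (C + \<eta>)"
    "\<bar>kohn_vogelius \<Omega> K g f \<rho> (\<lambda>x. \<sigma> x + s x, \<lambda>x. q x + r x) - kohn_vogelius \<Omega> K g f \<rho> (\<sigma>, q) - D (s, r)\<bar> \<le> A * \<eta>\<^sup>2"
    if L: "s \<in> Linf M" "r \<in> Linf M" and \<eta>_def: "\<eta> = Linf2_norm M (s, r)" and small: "\<eta> \<le> c/2" for s r \<eta>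
  proof -
    have \<eta>: "0 \<le> \<eta>" using Linf_norm_nonneg[of M s] by (simp add: \<eta>_def Linf2_norm_def)
    have sr: "AE_bounded M s \<eta>" "AE_bounded M r \<eta>"
      using AE_bounded_mono[OF Linf_AE_bounded[OF L(1)]] AE_bounded_mono[OF Linf_AE_bounded[OF L(2)]] by (auto simp: \<eta>_def Linf2_norm_def)
    let ?\<sigma> = "\<lambda>x. \<sigma> x + s x" and ?q = "\<lambda>x. q x + r x"
    show ell': "elliptic M ?\<sigma> ?q (c/2) (C + \<eta>)" by (rule elliptic_perturb[OF ell sr \<eta> small])
    define R where "R k = (l k (?ug ?\<sigma> ?q k) - l k (ug0 k) + energy_form \<Omega> s r (ug0 k) (ug0 k))
      + (energy_form \<Omega> ?\<sigma> ?q (?uf ?\<sigma> ?q k) (?uf ?\<sigma> ?q k) - energy_form \<Omega> \<sigma> q (uf0 k) (uf0 k) - energy_form \<Omega> s r (uf0 k) (uf0 k))" for k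
    have R: "\<bar>R k\<bar> \<le> (2 / c * (H1_norm \<Omega> (ug0 k))\<^sup>2 + 2 / c * (H1_norm \<Omega> (uf0 k))\<^sup>2) * \<eta>\<^sup>2" if k: "k \<in> {1..K}" for k
      using neumann_energy_variation[OF ell sr \<eta> small ug[OF ell k] ug[OF ell' k]]
        dirichlet_energy_variation[OF ell sr \<eta> small uf[OF ell k] uf[OF ell' k]]
      unfolding R_def l_def ug0_def[symmetric] uf0_def[symmetric] distrib_right by linarith
    have \<sigma>b: "AE_bounded M \<sigma> C" "AE_bounded M q C" using ell by (auto simp: elliptic_def)
    have reg: "reg ?\<sigma> ?q = reg \<sigma> q + 2 * (LINT x|M. \<sigma> x * s x + q x * r x) + reg s r"
    proof -
      have i: "integrable M (\<lambda>x. (\<sigma> x)\<^sup>2 + (q x)\<^sup>2)" "integrable M (\<lambda>x. \<sigma> x * s x + q x * r x)" "integrable M (\<lambda>x. (s x)\<^sup>2 + (r x)\<^sup>2)"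
        using AE_bounded_integrable[OF AE_bounded_add[OF AE_bounded_mult[OF \<sigma>b(1) \<sigma>b(1)] AE_bounded_mult[OF \<sigma>b(2) \<sigma>b(2)]]]
          AE_bounded_integrable[OF AE_bounded_add[OF AE_bounded_mult[OF \<sigma>b(1) sr(1)] AE_bounded_mult[OF \<sigma>b(2) sr(2)]]]
          AE_bounded_integrable[OF AE_bounded_add[OF AE_bounded_mult[OF sr(1) sr(1)] AE_bounded_mult[OF sr(2) sr(2)]]]
        by (simp_all add: power2_eq_square)
      have "reg ?\<sigma> ?q = (LINT x|M. ((\<sigma> x)\<^sup>2 + (q x)\<^sup>2) + 2 * (\<sigma> x * s x + q x * r x) + ((s x)\<^sup>2 + (r x)\<^sup>2))"
        unfolding reg_def by (rule Bochner_Integration.integral_cong) (simp_all add: power2_sum algebra_simps)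
      also have "\<dots> = reg \<sigma> q + 2 * (LINT x|M. \<sigma> x * s x + q x * r x) + reg s r"
        unfolding reg_def
        by (simp only: Bochner_Integration.integral_add[OF Bochner_Integration.integrable_add[OF i(1) integrable_mult_right[OF i(2)]] i(3)]
            Bochner_Integration.integral_add[OF i(1) integrable_mult_right[OF i(2)]] integral_mult_right_zero)
      finally show ?thesis .
    qed
    have regsr: "\<bar>reg s r\<bar> \<le> (\<eta> * \<eta> + \<eta> * \<eta>) * measure M (space M)"
      unfolding reg_def power2_eq_square by (intro AE_bounded_integral_le AE_bounded_add AE_bounded_mult sr)
    have "kohn_vogelius \<Omega> K g f \<rho> (?\<sigma>, ?q) - kohn_vogelius \<Omega> K g f \<rho> (\<sigma>, q) - D (s, r) = (\<Sum>k=1..K. R k) + \<rho> / 2 * reg s r"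
      unfolding J[OF ell] J[OF ell'] D'[OF L] reg R_def ug0_def uf0_def
      by (simp add: sum.distrib sum_subtractf algebra_simps)
    also have "\<bar>\<dots>\<bar> \<le> (\<Sum>k=1..K. \<bar>R k\<bar>) + \<rho> / 2 * \<bar>reg s r\<bar>"
    proof -
      have "\<bar>\<rho> / 2 * reg s r\<bar> = \<rho> / 2 * \<bar>reg s r\<bar>" using \<rho> by (simp add: abs_mult)
      then show ?thesis
        using sum_abs[of R "{1..K}"] abs_triangle_ineq[of "\<Sum>k=1..K. R k" "\<rho> / 2 * reg s r"] by linarith
    qed
    also have "\<dots> \<le> (\<Sum>k=1..K. (2 / c * (H1_norm \<Omega> (ug0 k))\<^sup>2 + 2 / c * (H1_norm \<Omega> (uf0 k))\<^sup>2) * \<eta>\<^sup>2)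
        + \<rho> / 2 * ((\<eta> * \<eta> + \<eta> * \<eta>) * measure M (space M))"
      using \<rho> regsr R by (intro add_mono sum_mono mult_left_mono) auto
    also have "\<dots> = A * \<eta>\<^sup>2"
      unfolding A_def sum_distrib_right[symmetric] distrib_right[of "sum _ _"]
      by (simp add: power2_eq_square algebra_simps)
    finally show "\<bar>kohn_vogelius \<Omega> K g f \<rho> (?\<sigma>, ?q) - kohn_vogelius \<Omega> K g f \<rho> (\<sigma>, q) - D (s, r)\<bar> \<le> A * \<eta>\<^sup>2" .
  qed
  show ?thesis
    unfolding has_frechet_derivative_Linf2_def prod.case
  proof (intro conjI allI impI)
    show "bounded_linear_Linf2 M D"
      by (rule derivative_bounded_linear[OF ell, of "{1..K}" uf0 ug0 \<rho>]) (use H \<rho> D' in auto)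
    fix \<epsilon> :: real assume \<epsilon>: "0 < \<epsilon>"
    define \<delta> where "\<delta> = min (c/2) (\<epsilon> / (A + 1))"
    have \<delta>: "\<delta> > 0" using c \<epsilon> A by (simp add: \<delta>_def)
    show "\<exists>\<delta>>0. \<forall>s\<in>Linf M. \<forall>r\<in>Linf M. Linf2_norm M (s, r) < \<delta> \<longrightarrow>
       (\<lambda>x. \<sigma> x + s x) \<in> Linf_pos M \<and> (\<lambda>x. q x + r x) \<in> Linf_pos M \<and>
       \<bar>kohn_vogelius \<Omega> K g f \<rho> (\<lambda>x. \<sigma> x + s x, \<lambda>x. q x + r x) - kohn_vogelius \<Omega> K g f \<rho> (\<sigma>, q) - D (s, r)\<bar> \<le> \<epsilon> * Linf2_norm M (s, r)"
    proof (intro exI[of _ \<delta>] conjI \<delta> ballI impI)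
      fix s r assume L: "s \<in> Linf M" "r \<in> Linf M" and lt: "Linf2_norm M (s, r) < \<delta>"
      define \<eta> where "\<eta> = Linf2_norm M (s, r)"
      have \<eta>: "0 \<le> \<eta>" using Linf_norm_nonneg[of M s] by (simp add: \<eta>_def Linf2_norm_def)
      have small: "\<eta> \<le> c/2" "\<eta> \<le> \<epsilon> / (A + 1)" using lt by (auto simp: \<eta>_def \<delta>_def)
      note mn = main[OF L \<eta>_def small(1)]
      show "(\<lambda>x. \<sigma> x + s x) \<in> Linf_pos M" "(\<lambda>x. q x + r x) \<in> Linf_pos M" using elliptic_Linf_pos[OF mn(1)] by auto
      have "A * \<eta> \<le> (A + 1) * \<eta>" using \<eta> by (simp add: distrib_right)
      also have "\<dots> \<le> \<epsilon>" using small(2) A by (simp add: field_simps)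
      finally have "A * \<eta>\<^sup>2 \<le> \<epsilon> * \<eta>" using mult_right_mono[of "A * \<eta>" \<epsilon> \<eta>] \<eta> by (simp add: power2_eq_square mult.assoc)
      then show "\<bar>kohn_vogelius \<Omega> K g f \<rho> (\<lambda>x. \<sigma> x + s x, \<lambda>x. q x + r x) - kohn_vogelius \<Omega> K g f \<rho> (\<sigma>, q) - D (s, r)\<bar> \<le> \<epsilon> * Linf2_norm M (s, r)"
        using mn(2) unfolding \<eta>_def[symmetric] by linarith
    qed
  qed
qed

end

theorem theorem5p1:
  fixes \<Omega> :: "'a::euclidean_space set"
    and K :: nat
    and g f :: "nat \<Rightarrow> 'a \<Rightarrow> real"
    and \<sigma>\<^sub>0 q\<^sub>0 :: "'a \<Rightarrow> real"
    and \<rho> :: real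
  assumes "DIM('a) \<ge> 2"
    and "smooth_bounded_domain \<Omega>"
    and "\<sigma>\<^sub>0 \<in> Linf_pos (lebesgue_on \<Omega>)" and "q\<^sub>0 \<in> Linf_pos (lebesgue_on \<Omega>)"
    and "\<And>k. k \<in> {1..K} \<Longrightarrow> g k \<in> L2 (surface_measure \<Omega>)"
    and "\<And>k. k \<in> {1..K} \<Longrightarrow> f k \<in> L2 (surface_measure \<Omega>)"
    and "\<And>k. k \<in> {1..K} \<Longrightarrow>
      AE x in surface_measure \<Omega>. f k x = neumann_to_dirichlet \<Omega> \<sigma>\<^sub>0 q\<^sub>0 (g k) x"
    and "\<rho> \<ge> 0"
  shows "\<forall>\<sigma>\<in>Linf_pos (lebesgue_on \<Omega>). \<forall>q\<in>Linf_pos (lebesgue_on \<Omega>).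
    \<exists>D. has_frechet_derivative_Linf2 (lebesgue_on \<Omega>) (kohn_vogelius \<Omega> K g f \<rho>) D (\<sigma>, q) \<and>
      (\<forall>\<sigma>'\<in>Linf_pos (lebesgue_on \<Omega>). \<forall>q'\<in>Linf_pos (lebesgue_on \<Omega>).
        D (\<sigma>', q') =
          (\<Sum>k=1..K.
            let ug = neumann_solution \<Omega> \<sigma> q (g k); uf = dirichlet_solution \<Omega> \<sigma> q (f k)
            in LINT x|lebesgue_on \<Omega>.
                 \<sigma>' x * ((norm (grad \<Omega> uf x))\<^sup>2 - (norm (grad \<Omega> ug x))\<^sup>2)
                 + q' x * ((uf x)\<^sup>2 - (ug x)\<^sup>2))
          + \<rho> * (LINT x|lebesgue_on \<Omega>. \<sigma> x * \<sigma>' x + q x * q' x))"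
proof (intro ballI)
  fix \<sigma> q assume \<sigma>: "\<sigma> \<in> Linf_pos (lebesgue_on \<Omega>)" "q \<in> Linf_pos (lebesgue_on \<Omega>)"
  interpret trace_domain \<Omega> by unfold_locales (rule assms)+
  define D where "D = (\<lambda>(s, r). (\<Sum>k=1..K. let ug = neumann_solution \<Omega> \<sigma> q (g k); uf = dirichlet_solution \<Omega> \<sigma> q (f k)
            in LINT x|lebesgue_on \<Omega>. s x * ((norm (grad \<Omega> uf x))\<^sup>2 - (norm (grad \<Omega> ug x))\<^sup>2) + r x * ((uf x)\<^sup>2 - (ug x)\<^sup>2))
          + \<rho> * (LINT x|lebesgue_on \<Omega>. \<sigma> x * s x + q x * r x))"
  have D: "D (s, r) = (\<Sum>k=1..K. let ug = neumann_solution \<Omega> \<sigma> q (g k); uf = dirichlet_solution \<Omega> \<sigma> q (f k)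
            in LINT x|lebesgue_on \<Omega>. s x * ((norm (grad \<Omega> uf x))\<^sup>2 - (norm (grad \<Omega> ug x))\<^sup>2) + r x * ((uf x)\<^sup>2 - (ug x)\<^sup>2))
          + \<rho> * (LINT x|lebesgue_on \<Omega>. \<sigma> x * s x + q x * r x)" for s r
    unfolding D_def prod.case ..
  have "has_frechet_derivative_Linf2 (lebesgue_on \<Omega>) (kohn_vogelius \<Omega> K g f \<rho>) D (\<sigma>, q)"
    by (rule kohn_vogelius_has_frechet_derivative[OF assms(3-8) \<sigma> D])
  with D show "\<exists>D. has_frechet_derivative_Linf2 (lebesgue_on \<Omega>) (kohn_vogelius \<Omega> K g f \<rho>) D (\<sigma>, q) \<and>
      (\<forall>\<sigma>'\<in>Linf_pos (lebesgue_on \<Omega>). \<forall>q'\<in>Linf_pos (lebesgue_on \<Omega>).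
        D (\<sigma>', q') =
          (\<Sum>k=1..K.
            let ug = neumann_solution \<Omega> \<sigma> q (g k); uf = dirichlet_solution \<Omega> \<sigma> q (f k)
            in LINT x|lebesgue_on \<Omega>.
                 \<sigma>' x * ((norm (grad \<Omega> uf x))\<^sup>2 - (norm (grad \<Omega> ug x))\<^sup>2)
                 + q' x * ((uf x)\<^sup>2 - (ug x)\<^sup>2))
          + \<rho> * (LINT x|lebesgue_on \<Omega>. \<sigma> x * \<sigma>' x + q x * q' x))"
    by blast
qed

end
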